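(* Let $N \cong \mathbb{Z}^n$ be a lattice, let $\Sigma$ be a complete fan in $N_{\mathbb{R}} = N \otimes_{\mathbb{Z}} \mathbb{R}$, let $\Sigma(1)$ be the set of primitive generators in $N$ of the 1-dimensional cones of $\Sigma$, and let $X = X(\Sigma)$ be the corresponding toric variety. If $\Sigma(1)$ is unimodular, then $X$ is diagonally split at $q$ for all integers $q \geq 2$.
   Context: Unimodular: $\Sigma(1)$ is unimodular if every maximal linearly independent subset of $\Sigma(1)$ generates the lattice $N$. Diagonal splittings: let $X$ be a toric variety (over a field) given by a complete fan $\Sigma$. For an integer $q\ge 2$, multiplication by $q$ on $N_{\mathbb{R}}$ preserves $\Sigma$ and induces a morphism $F\colon X\to X$. A splitting of $X$ at $q$ is an $\mathcal{O}_X$-module map $\pi\colon F_*\mathcal{O}_X\to\mathcal{O}_X$ whose composition with the natural map $\mathcal{O}_X\to F_*\mathcal{O}_X$ is the identity. It is compatible with a subvariety $Z\subset X$ with ideal sheaf $I_Z$ if $\pi(F_*I_Z)\subset I_Z$. The toric variety $X$ is diagonally split at $q$ if there is a splitting at $q$ of the toric variety $X\times X$ compatible with the diagonal $\Delta\subset X\times X$. Recalled known characterization (from earlier work of Payne): with $M=\operatorname{Hom}(N,\mathbb{Z})$ and $M_{\mathbb{R}}=M\otimes_{\mathbb{Z}}\mathbb{R}$, $X$ is diagonally split at $q\ge 2$ if and only if the open polytope $\mathbb{F}_\Sigma=\{u\in M_{\mathbb{R}} : |\langle u,v\rangle|<1 \text{ for all } v\in\Sigma(1)\}$ contains a representative of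 every class in $\frac{1}{q}M/M$. *)

theory Defs
  imports
    "HOL-Algebra.Ideal"
    "HOL-Analysis.Convex"
    "HOL-Analysis.Product_Vector"
    "HOL-Library.Poly_Mapping"
    "HOL-Library.Function_Algebras"
begin

section \<open>Lattices and fans\<close>

text \<open>
  The real vector space \<open>N\<^sub>\<real>\<close> is the whole type \<open>'v\<close>, and the lattice \<open>N\<close> is a subset of it.
  The vector space may be zero.
\<close>

definition int_span :: "'v::real_vector set \<Rightarrow> 'v set" where
  "int_span B = {\<Sum>b\<in>T. of_int (c b) *\<^sub>R b | T (c :: 'v \<Rightarrow> int). finite T \<and> T \<subseteq> B}"

definition full_lattice :: "'v::real_vector set \<Rightarrow> bool" where
  "full_lattice N \<longleftrightarrow>
     (\<exists>B. finite B \<and> independent B \<and> span B = UNIV \<and> N = int_span B)"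

text \<open>\<open>M = Hom(N, \<int>)\<close>, each element being extended to a linear functional on \<open>N\<^sub>\<real>\<close>.\<close>

definition dual_lattice :: "'v::real_vector set \<Rightarrow> ('v \<Rightarrow> real) set" where
  "dual_lattice N = {u. linear u \<and> (\<forall>v\<in>N. u v \<in> \<int>)}"

definition dual_cone :: "'v::real_vector set \<Rightarrow> ('v \<Rightarrow> real) set" where
  "dual_cone \<sigma> = {u. linear u \<and> (\<forall>v\<in>\<sigma>. 0 \<le> u v)}"

definition rational_pointed_cone :: "'v::real_vector set \<Rightarrow> 'v set \<Rightarrow> bool" where
  "rational_pointed_cone N \<sigma> \<longleftrightarrow>
     (\<exists>S. finite S \<and> S \<subseteq> N \<and> \<sigma> = convex_cone hull S) \<and>
     (\<forall>v. v \<in> \<sigma> \<and> - v \<in> \<sigma> \<longrightarrow> v = 0)"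

definition cone_face :: "'v::real_vector set \<Rightarrow> 'v set \<Rightarrow> bool" where
  "cone_face \<tau> \<sigma> \<longleftrightarrow> (\<exists>u\<in>dual_cone \<sigma>. \<tau> = {v\<in>\<sigma>. u v = 0})"

definition is_fan :: "'v::real_vector set \<Rightarrow> 'v set set \<Rightarrow> bool" where
  "is_fan N \<Sigma> \<longleftrightarrow>
     finite \<Sigma> \<and>
     (\<forall>\<sigma>\<in>\<Sigma>. rational_pointed_cone N \<sigma>) \<and>
     (\<forall>\<sigma>\<in>\<Sigma>. \<forall>\<tau>. cone_face \<tau> \<sigma> \<longrightarrow> \<tau> \<in> \<Sigma>) \<and>
     (\<forall>\<sigma>\<in>\<Sigma>. \<forall>\<tau>\<in>\<Sigma>. cone_face (\<sigma> \<inter> \<tau>) \<sigma> \<and> cone_face (\<sigma> \<inter> \<tau>) \<tau>)"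

definition complete_fan :: "'v::real_vector set \<Rightarrow> 'v set set \<Rightarrow> bool" where
  "complete_fan N \<Sigma> \<longleftrightarrow> is_fan N \<Sigma> \<and> \<Union>\<Sigma> = UNIV"

definition primitive :: "'v::real_vector set \<Rightarrow> 'v \<Rightarrow> bool" where
  "primitive N v \<longleftrightarrow>
     v \<in> N \<and> v \<noteq> 0 \<and> (\<forall>w\<in>N. \<forall>m::int. v = of_int m *\<^sub>R w \<longrightarrow> \<bar>m\<bar> = 1)"

text \<open>The set \<open>\<Sigma>(1)\<close>.\<close>

definition ray_generators :: "'v::real_vector set \<Rightarrow> 'v set set \<Rightarrow> 'v set" where
  "ray_generators N \<Sigma> = {v. primitive N v \<and> convex_cone hull {v} \<in> \<Sigma>}"

definition unimodular :: "'v::real_vector set \<Rightarrow> 'v set \<Rightarrow> bool" where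
  "unimodular N R \<longleftrightarrow>
     (\<forall>B. B \<subseteq> R \<and> independent B \<and> (\<forall>B'. B \<subseteq> B' \<and> B' \<subseteq> R \<and> independent B' \<longrightarrow> B' = B)
        \<longrightarrow> int_span B = N)"

definition product_fan :: "'v set set \<Rightarrow> 'w set set \<Rightarrow> ('v \<times> 'w) set set" where
  "product_fan \<Sigma> \<Sigma>' = {\<sigma> \<times> \<tau> | \<sigma> \<tau>. \<sigma> \<in> \<Sigma> \<and> \<tau> \<in> \<Sigma>'}"

section \<open>Affine schemes\<close>

definition Spec :: "('a, 'b) ring_scheme \<Rightarrow> 'a set set" where
  "Spec R = {p. primeideal p R}"

definition zariski_open :: "('a, 'b) ring_scheme \<Rightarrow> 'a set set \<Rightarrow> bool" where
  "zariski_open R U \<longleftrightarrow> (\<exists>I \<subseteq> carrier R. U = {p \<in> Spec R. \<not> I \<subseteq> p})"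

text \<open>The fraction \<open>a / s\<close> in the localization \<open>R\<^sub>p\<close>, as an equivalence class of pairs.\<close>

definition fraction :: "('a, 'b) ring_scheme \<Rightarrow> 'a set \<Rightarrow> 'a \<Rightarrow> 'a \<Rightarrow> ('a \<times> 'a) set" where
  "fraction R p a s =
     {(b, t). b \<in> carrier R \<and> t \<in> carrier R - p \<and>
        (\<exists>w \<in> carrier R - p. w \<otimes>\<^bsub>R\<^esub> (a \<otimes>\<^bsub>R\<^esub> t \<ominus>\<^bsub>R\<^esub> b \<otimes>\<^bsub>R\<^esub> s) = \<zero>\<^bsub>R\<^esub>)}"

definition localization :: "('a, 'b) ring_scheme \<Rightarrow> 'a set \<Rightarrow> ('a \<times> 'a) set ring" where
  "localization R p = \<lparr>
     carrier = {fraction R p a s | a s. a \<in> carrier R \<and> s \<in> carrier R - p},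
     mult = (\<lambda>x y. \<Union>(a, s)\<in>x. \<Union>(b, t)\<in>y. fraction R p (a \<otimes>\<^bsub>R\<^esub> b) (s \<otimes>\<^bsub>R\<^esub> t)),
     one = fraction R p \<one>\<^bsub>R\<^esub> \<one>\<^bsub>R\<^esub>,
     zero = fraction R p \<zero>\<^bsub>R\<^esub> \<one>\<^bsub>R\<^esub>,
     add = (\<lambda>x y. \<Union>(a, s)\<in>x. \<Union>(b, t)\<in>y.
              fraction R p (a \<otimes>\<^bsub>R\<^esub> t \<oplus>\<^bsub>R\<^esub> b \<otimes>\<^bsub>R\<^esub> s) (s \<otimes>\<^bsub>R\<^esub> t))\<rparr>"

text \<open>
  The ring of sections over \<open>U\<close> of the structure sheaf of \<open>Spec R\<close>: functions sending a point \<open>p\<close>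
  to an element of \<open>R\<^sub>p\<close> that are locally fractions.
\<close>

definition spec_sheaf ::
  "('a, 'b) ring_scheme \<Rightarrow> 'a set set \<Rightarrow> ('a set \<Rightarrow> ('a \<times> 'a) set) ring" where
  "spec_sheaf R U = \<lparr>
     carrier = {s \<in> (\<Pi>\<^sub>E p\<in>U. carrier (localization R p)).
       \<forall>p\<in>U. \<exists>V a f. zariski_open R V \<and> p \<in> V \<and> V \<subseteq> U \<and> a \<in> carrier R \<and> f \<in> carrier R \<and>
         (\<forall>p'\<in>V. f \<notin> p' \<and> s p' = fraction R p' a f)},
     mult = (\<lambda>s t. \<lambda>p\<in>U. s p \<otimes>\<^bsub>localization R p\<^esub> t p),
     one = (\<lambda>p\<in>U. \<one>\<^bsub>localization R p\<^esub>),
     zero = (\<lambda>p\<in>U. \<zero>\<^bsub>localization R p\<^esub>),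
     add = (\<lambda>s t. \<lambda>p\<in>U. s p \<oplus>\<^bsub>localization R p\<^esub> t p)\<rparr>"

text \<open>
  The morphism \<open>Spec S \<rightarrow> Spec R\<close> given by a ring homomorphism \<open>\<phi>: R \<rightarrow> S\<close>, on points and on
  sections. The pulled-back section is taken over the open set \<open>W\<close> of \<open>Spec S\<close>.
\<close>

definition spec_map ::
  "('a, 'c) ring_scheme \<Rightarrow> ('a \<Rightarrow> 'b) \<Rightarrow> 'b set \<Rightarrow> 'a set" where
  "spec_map R \<phi> p = {a \<in> carrier R. \<phi> a \<in> p}"

definition spec_pullback ::
  "('a, 'c) ring_scheme \<Rightarrow> ('b, 'd) ring_scheme \<Rightarrow> ('a \<Rightarrow> 'b) \<Rightarrow> 'b set set \<Rightarrow>
     ('a set \<Rightarrow> ('a \<times> 'a) set) \<Rightarrow> ('b set \<Rightarrow> ('b \<times> 'b) set)" where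
  "spec_pullback R S \<phi> W s =
     (\<lambda>p\<in>W. \<Union>(a, f)\<in>s (spec_map R \<phi> p). fraction S p (\<phi> a) (\<phi> f))"

section \<open>Toric varieties\<close>

text \<open>
  Elements of the group ring \<open>k[M]\<close> are finitely supported maps from linear functionals to \<open>k\<close>;
  the product of \<open>'m \<Rightarrow>\<^sub>0 'k\<close> is convolution with respect to pointwise addition of functionals.
\<close>

type_synonym ('v, 'k) laurent = "('v \<Rightarrow> real) \<Rightarrow>\<^sub>0 'k"

type_synonym ('v, 'k) toric_point = "('v set \<times> ('v, 'k) laurent set) set"

type_synonym ('v, 'k) toric_section =
  "'v set \<Rightarrow> ('v, 'k) laurent set \<Rightarrow> (('v, 'k) laurent \<times> ('v, 'k) laurent) set"

text \<open>The coordinate ring \<open>k[\<sigma>\<^sup>\<or> \<inter> M]\<close> of the chart \<open>U\<^sub>\<sigma>\<close>.\<close>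

definition chart_ring ::
  "'v::real_vector set \<Rightarrow> 'v set \<Rightarrow> ('v, 'k::field) laurent ring" where
  "chart_ring N \<sigma> = \<lparr>
     carrier = {f. Poly_Mapping.keys f \<subseteq> dual_cone \<sigma> \<inter> dual_lattice N},
     mult = (*), one = 1, zero = 0, add = (+)\<rparr>"

text \<open>
  \<open>X(\<Sigma>)\<close> is glued from the affine schemes \<open>U\<^sub>\<sigma>\<close> along the open subschemes \<open>U\<^bsub>\<sigma> \<inter> \<tau>\<^esub>\<close>. A point
  is an equivalence class of pairs \<open>(\<sigma>, p)\<close> with \<open>p\<close> a point of \<open>U\<^sub>\<sigma>\<close>.
\<close>

definition chart_points ::
  "'v::real_vector set \<Rightarrow> 'v set set \<Rightarrow> ('v set \<times> ('v, 'k::field) laurent set) set" where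
  "chart_points N \<Sigma> = (SIGMA \<sigma>:\<Sigma>. Spec (chart_ring N \<sigma>))"

definition glue ::
  "'v::real_vector set \<Rightarrow> 'v set set \<Rightarrow> ('v set \<times> ('v, 'k::field) laurent set) rel" where
  "glue N \<Sigma> = {((\<sigma>, p), (\<tau>, p')).
     (\<sigma>, p) \<in> chart_points N \<Sigma> \<and> (\<tau>, p') \<in> chart_points N \<Sigma> \<and>
     (\<exists>r \<in> Spec (chart_ring N (\<sigma> \<inter> \<tau>)).
        p = spec_map (chart_ring N \<sigma>) id r \<and> p' = spec_map (chart_ring N \<tau>) id r)}"

definition toric_points ::
  "'v::real_vector set \<Rightarrow> 'v set set \<Rightarrow> ('v, 'k::field) toric_point set" where
  "toric_points N \<Sigma> = chart_points N \<Sigma> // glue N \<Sigma>"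

text \<open>The set \<open>U \<inter> U\<^sub>\<sigma>\<close>, as a subset of \<open>Spec k[\<sigma>\<^sup>\<or> \<inter> M]\<close>.\<close>

definition on_chart ::
  "'v::real_vector set \<Rightarrow> 'v set set \<Rightarrow> ('v, 'k::field) toric_point set \<Rightarrow> 'v set \<Rightarrow>
     ('v, 'k) laurent set set" where
  "on_chart N \<Sigma> U \<sigma> = {p \<in> Spec (chart_ring N \<sigma>). glue N \<Sigma> `` {(\<sigma>, p)} \<in> U}"

definition toric_open ::
  "'v::real_vector set \<Rightarrow> 'v set set \<Rightarrow> ('v, 'k::field) toric_point set \<Rightarrow> bool" where
  "toric_open N \<Sigma> U \<longleftrightarrow>
     U \<subseteq> toric_points N \<Sigma> \<and> (\<forall>\<sigma>\<in>\<Sigma>. zariski_open (chart_ring N \<sigma>) (on_chart N \<Sigma> U \<sigma>))"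

text \<open>
  Sections of \<open>\<O>\<^sub>X\<close> over \<open>U\<close> are families of sections over the \<open>U \<inter> U\<^sub>\<sigma>\<close> compatible with restriction
  to smaller charts; as the fan contains all intersections \<open>\<sigma> \<inter> \<tau>\<close> of its members, this is agreement
  on all overlaps.
\<close>

definition toric_sheaf ::
  "'v::real_vector set \<Rightarrow> 'v set set \<Rightarrow> ('v, 'k::field) toric_point set \<Rightarrow> ('v, 'k) toric_section ring" where
  "toric_sheaf N \<Sigma> U = \<lparr>
     carrier = {s \<in> (\<Pi>\<^sub>E \<sigma>\<in>\<Sigma>. carrier (spec_sheaf (chart_ring N \<sigma>) (on_chart N \<Sigma> U \<sigma>))).
       \<forall>\<sigma>\<in>\<Sigma>. \<forall>\<tau>\<in>\<Sigma>. \<tau> \<subseteq> \<sigma> \<longrightarrow>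
         s \<tau> = spec_pullback (chart_ring N \<sigma>) (chart_ring N \<tau>) id (on_chart N \<Sigma> U \<tau>) (s \<sigma>)},
     mult = (\<lambda>s t. \<lambda>\<sigma>\<in>\<Sigma>. s \<sigma> \<otimes>\<^bsub>spec_sheaf (chart_ring N \<sigma>) (on_chart N \<Sigma> U \<sigma>)\<^esub> t \<sigma>),
     one = (\<lambda>\<sigma>\<in>\<Sigma>. \<one>\<^bsub>spec_sheaf (chart_ring N \<sigma>) (on_chart N \<Sigma> U \<sigma>)\<^esub>),
     zero = (\<lambda>\<sigma>\<in>\<Sigma>. \<zero>\<^bsub>spec_sheaf (chart_ring N \<sigma>) (on_chart N \<Sigma> U \<sigma>)\<^esub>),
     add = (\<lambda>s t. \<lambda>\<sigma>\<in>\<Sigma>. s \<sigma> \<oplus>\<^bsub>spec_sheaf (chart_ring N \<sigma>) (on_chart N \<Sigma> U \<sigma>)\<^esub> t \<sigma>)\<rparr>"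

definition restrict_section ::
  "'v::real_vector set \<Rightarrow> 'v set set \<Rightarrow> ('v, 'k::field) toric_point set \<Rightarrow>
     ('v, 'k) toric_section \<Rightarrow> ('v, 'k) toric_section" where
  "restrict_section N \<Sigma> V s = (\<lambda>\<sigma>\<in>\<Sigma>. restrict (s \<sigma>) (on_chart N \<Sigma> V \<sigma>))"

section \<open>Toric morphisms\<close>

text \<open>
  A linear map \<open>L\<close> with \<open>L ` N \<subseteq> N'\<close> that maps every cone of \<open>\<Sigma>\<close> into some cone of \<open>\<Sigma>'\<close> induces
  \<open>X(\<Sigma>) \<rightarrow> X(\<Sigma>')\<close>, given on charts by the ring homomorphisms sending a monomial \<open>x\<^sup>u\<close> to \<open>x\<^sup>u\<^sup>\<circ>\<^sup>L\<close>.
\<close>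

definition comonomial ::
  "('v \<Rightarrow> 'w) \<Rightarrow> ('w, 'k::field) laurent \<Rightarrow> ('v, 'k) laurent" where
  "comonomial L f =
     (\<Sum>u\<in>Poly_Mapping.keys f. Poly_Mapping.single (u \<circ> L) (Poly_Mapping.lookup f u))"

text \<open>The smallest cone of \<open>\<Sigma>'\<close> containing \<open>L ` \<sigma>\<close>.\<close>

definition image_cone :: "'w set set \<Rightarrow> ('v \<Rightarrow> 'w) \<Rightarrow> 'v set \<Rightarrow> 'w set" where
  "image_cone \<Sigma>' L \<sigma> = \<Inter>{\<sigma>'\<in>\<Sigma>'. L ` \<sigma> \<subseteq> \<sigma>'}"

definition toric_map ::
  "'w::real_vector set \<Rightarrow> 'w set set \<Rightarrow> ('v \<Rightarrow> 'w) \<Rightarrow>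
     ('v, 'k::field) toric_point \<Rightarrow> ('w, 'k) toric_point" where
  "toric_map N' \<Sigma>' L x =
     (\<Union>(\<sigma>, p)\<in>x. glue N' \<Sigma>' ``
        {(image_cone \<Sigma>' L \<sigma>, spec_map (chart_ring N' (image_cone \<Sigma>' L \<sigma>)) (comonomial L) p)})"

definition toric_preimage ::
  "'v::real_vector set \<Rightarrow> 'v set set \<Rightarrow> 'w::real_vector set \<Rightarrow> 'w set set \<Rightarrow> ('v \<Rightarrow> 'w) \<Rightarrow>
     ('w, 'k::field) toric_point set \<Rightarrow> ('v, 'k) toric_point set" where
  "toric_preimage N \<Sigma> N' \<Sigma>' L U = {x \<in> toric_points N \<Sigma>. toric_map N' \<Sigma>' L x \<in> U}"

text \<open>The ring homomorphism from sections over \<open>U\<close> to sections over the preimage of \<open>U\<close>.\<close>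

definition toric_pullback ::
  "'v::real_vector set \<Rightarrow> 'v set set \<Rightarrow> 'w::real_vector set \<Rightarrow> 'w set set \<Rightarrow> ('v \<Rightarrow> 'w) \<Rightarrow>
     ('w, 'k::field) toric_point set \<Rightarrow> ('w, 'k) toric_section \<Rightarrow> ('v, 'k) toric_section" where
  "toric_pullback N \<Sigma> N' \<Sigma>' L U s =
     (\<lambda>\<sigma>\<in>\<Sigma>. spec_pullback (chart_ring N' (image_cone \<Sigma>' L \<sigma>)) (chart_ring N \<sigma>) (comonomial L)
        (on_chart N \<Sigma> (toric_preimage N \<Sigma> N' \<Sigma>' L U) \<sigma>) (s (image_cone \<Sigma>' L \<sigma>)))"

section \<open>Splittings\<close>

text \<open>The morphism \<open>F: X \<rightarrow> X\<close> induced by multiplication by \<open>q\<close>.\<close>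

abbreviation mult_by :: "nat \<Rightarrow> 'v::real_vector \<Rightarrow> 'v" where
  "mult_by q \<equiv> (\<lambda>v. of_nat q *\<^sub>R v)"

abbreviation F_preimage ::
  "'v::real_vector set \<Rightarrow> 'v set set \<Rightarrow> nat \<Rightarrow>
     ('v, 'k::field) toric_point set \<Rightarrow> ('v, 'k) toric_point set" where
  "F_preimage N \<Sigma> q \<equiv> toric_preimage N \<Sigma> N \<Sigma> (mult_by q)"

abbreviation F_pullback ::
  "'v::real_vector set \<Rightarrow> 'v set set \<Rightarrow> nat \<Rightarrow>
     ('v, 'k::field) toric_point set \<Rightarrow> ('v, 'k) toric_section \<Rightarrow> ('v, 'k) toric_section" where
  "F_pullback N \<Sigma> q \<equiv> toric_pullback N \<Sigma> N \<Sigma> (mult_by q)"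

text \<open>
  \<open>\<pi>\<close> is a morphism \<open>F\<^sub>* \<O>\<^sub>X \<rightarrow> \<O>\<^sub>X\<close> of \<open>\<O>\<^sub>X\<close>-modules, where the sections of \<open>F\<^sub>* \<O>\<^sub>X\<close> over \<open>U\<close> are those of
  \<open>\<O>\<^sub>X\<close> over the preimage of \<open>U\<close>, with functions on \<open>U\<close> acting through pullback.
\<close>

definition module_map ::
  "'v::real_vector set \<Rightarrow> 'v set set \<Rightarrow> nat \<Rightarrow>
     (('v, 'k::field) toric_point set \<Rightarrow> ('v, 'k) toric_section \<Rightarrow> ('v, 'k) toric_section) \<Rightarrow> bool" where
  "module_map N \<Sigma> q \<pi> \<longleftrightarrow>
     (\<forall>U. toric_open N \<Sigma> U \<longrightarrow>
       \<pi> U \<in> carrier (toric_sheaf N \<Sigma> (F_preimage N \<Sigma> q U)) \<rightarrow> carrier (toric_sheaf N \<Sigma> U) \<and>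
       (\<forall>s \<in> carrier (toric_sheaf N \<Sigma> (F_preimage N \<Sigma> q U)).
        \<forall>t \<in> carrier (toric_sheaf N \<Sigma> (F_preimage N \<Sigma> q U)).
          \<pi> U (s \<oplus>\<^bsub>toric_sheaf N \<Sigma> (F_preimage N \<Sigma> q U)\<^esub> t) =
          \<pi> U s \<oplus>\<^bsub>toric_sheaf N \<Sigma> U\<^esub> \<pi> U t) \<and>
       (\<forall>a \<in> carrier (toric_sheaf N \<Sigma> U).
        \<forall>s \<in> carrier (toric_sheaf N \<Sigma> (F_preimage N \<Sigma> q U)).
          \<pi> U (F_pullback N \<Sigma> q U a \<otimes>\<^bsub>toric_sheaf N \<Sigma> (F_preimage N \<Sigma> q U)\<^esub> s) =
          a \<otimes>\<^bsub>toric_sheaf N \<Sigma> U\<^esub> \<pi> U s) \<and>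
       (\<forall>V. toric_open N \<Sigma> V \<and> V \<subseteq> U \<longrightarrow>
         (\<forall>s \<in> carrier (toric_sheaf N \<Sigma> (F_preimage N \<Sigma> q U)).
           restrict_section N \<Sigma> V (\<pi> U s) =
           \<pi> V (restrict_section N \<Sigma> (F_preimage N \<Sigma> q V) s))))"

definition splitting ::
  "'v::real_vector set \<Rightarrow> 'v set set \<Rightarrow> nat \<Rightarrow>
     (('v, 'k::field) toric_point set \<Rightarrow> ('v, 'k) toric_section \<Rightarrow> ('v, 'k) toric_section) \<Rightarrow> bool" where
  "splitting N \<Sigma> q \<pi> \<longleftrightarrow>
     module_map N \<Sigma> q \<pi> \<and>
     (\<forall>U. toric_open N \<Sigma> U \<longrightarrow>
       (\<forall>a \<in> carrier (toric_sheaf N \<Sigma> U). \<pi> U (F_pullback N \<Sigma> q U a) = a))"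

definition compatible_with ::
  "'v::real_vector set \<Rightarrow> 'v set set \<Rightarrow> nat \<Rightarrow>
     (('v, 'k::field) toric_point set \<Rightarrow> ('v, 'k) toric_section set) \<Rightarrow>
     (('v, 'k) toric_point set \<Rightarrow> ('v, 'k) toric_section \<Rightarrow> ('v, 'k) toric_section) \<Rightarrow> bool" where
  "compatible_with N \<Sigma> q I \<pi> \<longleftrightarrow>
     (\<forall>U. toric_open N \<Sigma> U \<longrightarrow> \<pi> U ` I (F_preimage N \<Sigma> q U) \<subseteq> I U)"

text \<open>
  The ideal sheaf of the diagonal is the kernel of \<open>\<O>\<^bsub>X\<times>X\<^esub> \<rightarrow> \<delta>\<^sub>* \<O>\<^sub>X\<close>, where \<open>\<delta>: X \<rightarrow> X \<times> X\<close> is the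
  diagonal morphism, and \<open>X \<times> X\<close> is the toric variety of the lattice \<open>N \<times> N\<close> and the fan \<open>\<Sigma> \<times> \<Sigma>\<close>.
\<close>

definition diagonal_ideal ::
  "'v::real_vector set \<Rightarrow> 'v set set \<Rightarrow>
     ('v \<times> 'v, 'k::field) toric_point set \<Rightarrow> ('v \<times> 'v, 'k) toric_section set" where
  "diagonal_ideal N \<Sigma> U =
     {s \<in> carrier (toric_sheaf (N \<times> N) (product_fan \<Sigma> \<Sigma>) U).
        toric_pullback N \<Sigma> (N \<times> N) (product_fan \<Sigma> \<Sigma>) (\<lambda>v. (v, v)) U s =
        \<zero>\<^bsub>toric_sheaf N \<Sigma> (toric_preimage N \<Sigma> (N \<times> N) (product_fan \<Sigma> \<Sigma>) (\<lambda>v. (v, v)) U)\<^esub>}"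

text \<open>The first argument only fixes the ground field of the toric variety.\<close>

definition diagonally_split ::
  "'k::field itself \<Rightarrow> 'v::real_vector set \<Rightarrow> 'v set set \<Rightarrow> nat \<Rightarrow> bool" where
  "diagonally_split k N \<Sigma> q \<longleftrightarrow>
     (\<exists>\<pi> :: ('v \<times> 'v, 'k) toric_point set \<Rightarrow> ('v \<times> 'v, 'k) toric_section \<Rightarrow> ('v \<times> 'v, 'k) toric_section.
        splitting (N \<times> N) (product_fan \<Sigma> \<Sigma>) q \<pi> \<and>
        compatible_with (N \<times> N) (product_fan \<Sigma> \<Sigma>) q (diagonal_ideal N \<Sigma>) \<pi>)"

end

theory Submission
  imports Defs
begin

text \<open>
  Write \<open>M\<close> for the dual lattice. For a real functional \<open>u\<close>, any vertex \<open>m\<close> of the polytope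
  \<open>\<lfloor>u v\<rfloor> \<le> m v \<le> \<lceil>u v\<rceil>\<close>, where \<open>v\<close> runs through \<open>\<Sigma>(1)\<close>, takes integral values on a basis contained
  in \<open>\<Sigma>(1)\<close>. By unimodularity \<open>m\<close> lies in \<open>M\<close>, so \<open>u - m\<close> represents the class of \<open>u\<close> in the open
  polytope of Payne's criterion. Such representatives, chosen once for each class in \<open>(1/q)M/M\<close>, define a
  semilinear map on Laurent monomials. It preserves the coordinate ring of each chart, since an integer
  greater than \<open>-1\<close> is nonnegative, and on the diagonal it induces a splitting of \<open>X\<close>.

  The map extends to sections because a section over the preimage of a basic open set \<open>D(g)\<close> is a fraction
  with denominator a power of \<open>F g\<close>: otherwise some prime ideal would contain the ideal of its denominators
  but not \<open>F g\<close>.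
\<close>

section \<open>Rational polyhedral cones\<close>

text \<open>The ideal of the diagonal is preserved because the two components of the image of an
  exponent \<open>(a, b)\<close> add up to \<open>(a + b)/q\<close>, so that on the diagonal the map
  only divides exponents by \<open>q\<close>. What remains to be chosen is the distribution of this
  sum over the two factors: the first receives a rounding of \<open>a/q\<close>, the second the
  rest. The rounding error enters the two components with opposite signs, which is why the polytope
  bounds it from both sides.

  A second task comes from the points of X being classes of primes of charts: the gluing relation
  has to be transitive, and for this the chart of a face is treated as the localization of the
  larger chart at one monomial. A face is given by a real functional, while the exponent of a
  monomial must lie in \<open>M\<close>. Farkas' lemma is therefore proved over an arbitrary ordered
  field. Over the rationals it makes the functional integral; over the reals it shows that each cone
  of the fan is generated by rays of the fan.\<close>

lemma farkas:
  fixes scale :: "'a::linordered_field \<Rightarrow> 'b::ab_group_add \<Rightarrow> 'b" (infixr "*s" 75)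
    and a :: "'i \<Rightarrow> 'b"
  assumes "vector_space scale" and "finite I"
  shows "(\<exists>c. (\<forall>i\<in>I. 0 \<le> c i) \<and> b = (\<Sum>i\<in>I. c i *s a i)) \<or>
    (\<exists>f. (\<forall>x y. f (x + y) = f x + f y) \<and> (\<forall>c x. f (c *s x) = c * f x) \<and> (\<forall>i\<in>I. 0 \<le> f (a i)) \<and> f b < 0)"
  using assms(2)
proof (induction I arbitrary: a b)
  interpret vector_space scale by fact
  interpret field: vector_space "(*) :: 'a \<Rightarrow> 'a \<Rightarrow> 'a" by unfold_locales (auto simp: algebra_simps)
  interpret pair: vector_space_pair scale "(*) :: 'a \<Rightarrow> 'a \<Rightarrow> 'a" ..
  case empty
  show ?case
  proof (cases "b = 0")
    case False
    then have "independent {b}" by simp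
    from pair.linear_independent_extend[OF this, of "\<lambda>_. - 1"]
    obtain g where g: "Vector_Spaces.linear scale (*) g" "g b = - 1" by auto
    interpret g: Vector_Spaces.linear scale "(*)" g by fact
    show ?thesis using g(2) g.add g.scale by (intro disjI2 exI[of _ g]) auto
  qed simp
next
  interpret vector_space scale by fact
  case (insert j I)
  consider c where "\<forall>i\<in>I. 0 \<le> c i" "b = (\<Sum>i\<in>I. c i *s a i)"
    | f where "\<forall>x y. f (x + y) = f x + f y" "\<forall>c x. f (c *s x) = c * f x" "\<forall>i\<in>I. 0 \<le> f (a i)" "f b < 0"
    using insert.IH[of b a] by blast
  then show ?case
  proof cases
    case 1
    have "(\<Sum>i\<in>insert j I. (c(j := 0)) i *s a i) = (\<Sum>i\<in>I. c i *s a i)"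
      using insert.hyps by (simp add: sum.insert) (intro sum.cong, auto)
    then show ?thesis using 1 by (intro disjI1 exI[of _ "c(j := 0)"]) simp
  next
    case 2
    show ?thesis
    proof (cases "0 \<le> f (a j)")
      case True
      then show ?thesis using 2 by (intro disjI2 exI[of _ f]) auto
    next
      case False
      \<comment> \<open>The hyperplane \<open>f = 0\<close> leaves \<open>a j\<close> on the same
        side as \<open>b\<close>. Everything is projected along \<open>a j\<close> onto it, and the
        induction hypothesis is applied to the images. The scaling gives
        \<open>g (a j) = - 1\<close>, so that the projection \<open>P\<close> kills
        \<open>a j\<close>.\<close>
      define g where "g x = f x / - f (a j)" for x
      have g_add: "g (x + y) = g x + g y" and g_scale: "g (k *s x) = k * g x" for x y k
        using 2 by (simp_all add: g_def add_divide_distrib)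
      have g_sum: "g (\<Sum>i\<in>I. h i) = (\<Sum>i\<in>I. g (h i))" for h
        using insert.hyps(1) g_scale[of 0] by (induction I rule: finite_induct) (auto simp: g_add)
      have gj: "g (a j) = - 1" using False by (simp add: g_def)
      have gb: "g b < 0" and gi: "\<forall>i\<in>I. 0 \<le> g (a i)"
        using 2 False by (auto simp: g_def divide_neg_pos divide_nonneg_pos field_simps mult_less_0_iff)
      define P where "P x = x + g x *s a j" for x
      have P_add: "P (x + y) = P x + P y" and P_scale: "P (k *s x) = k *s P x" for x y k
        by (simp_all add: P_def g_add g_scale algebra_simps)
      consider c where "\<forall>i\<in>I. 0 \<le> c i" "P b = (\<Sum>i\<in>I. c i *s P (a i))"
        | h where "\<forall>x y. h (x + y) = h x + h y" "\<forall>c x. h (c *s x) = c * h x" "\<forall>i\<in>I. 0 \<le> h (P (a i))" "h (P b) < 0"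
        using insert.IH[of "P b" "\<lambda>i. P (a i)"] by blast
      then show ?thesis
      proof cases
        case c: 1
        \<comment> \<open>Undoing the projection collects a multiple of \<open>a j\<close>. Each
          summand of its coefficient is nonnegative, since \<open>g\<close> is nonnegative on the
          \<open>a i\<close> and negative at \<open>b\<close>.\<close>
        let ?k = "(\<Sum>i\<in>I. c i * g (a i)) - g b"
        have k: "0 \<le> ?k" using c(1) gi gb by (simp add: sum_nonneg order.trans[of _ 0])
        have "b = P b - g b *s a j" by (simp add: P_def)
        also have "P b = (\<Sum>i\<in>I. c i *s a i) + (\<Sum>i\<in>I. c i * g (a i)) *s a j"
          unfolding c(2) by (simp add: P_def scale_right_distrib sum.distrib scale_sum_left)
        finally have "b = (\<Sum>i\<in>I. c i *s a i) + ?k *s a j"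
          by (simp add: algebra_simps)
        also have "(\<Sum>i\<in>I. c i *s a i) = (\<Sum>i\<in>I. (c(j := ?k)) i *s a i)"
          using insert.hyps by (intro sum.cong) auto
        finally have "b = (\<Sum>i\<in>insert j I. (c(j := ?k)) i *s a i)"
          using insert.hyps by (simp add: add.commute)
        then show ?thesis using c(1) k by (intro disjI1 exI[of _ "c(j := ?k)"]) auto
      next
        case h: 2
        have "P (a j) = 0" by (simp add: P_def gj)
        moreover have "h 0 = 0" using h(2)[rule_format, of 0 0] by simp
        ultimately show ?thesis
          using h by (intro disjI2 exI[of _ "\<lambda>x. h (P x)"]) (auto simp: P_add P_scale)
      qed
    qed
  qed
qed

lemma convex_cone_hull_finite:
  assumes "finite S"
  shows "convex_cone hull S = {\<Sum>s\<in>S. c s *\<^sub>R s | c. \<forall>s\<in>S. 0 \<le> c s}" (is "_ = ?R")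
proof (rule hull_unique)
  show "S \<subseteq> ?R"
  proof
    fix t assume t: "t \<in> S"
    have "t = (\<Sum>s\<in>S. (if s = t then 1 else 0) *\<^sub>R s)"
      using assms t by (simp add: if_distrib[of "\<lambda>x. x *\<^sub>R _"] cong: if_cong)
    then show "t \<in> ?R" by (intro CollectI exI[of _ "\<lambda>s. if s = t then 1 else 0"]) auto
  qed
  show "convex_cone ?R"
    unfolding convex_cone_iff
  proof (intro conjI ballI allI impI)
    show "0 \<in> ?R" by (intro CollectI exI[of _ "\<lambda>_. 0"]) auto
    fix x y assume "x \<in> ?R" "y \<in> ?R"
    then obtain c d where "x = (\<Sum>s\<in>S. c s *\<^sub>R s)" "y = (\<Sum>s\<in>S. d s *\<^sub>R s)" "\<forall>s\<in>S. 0 \<le> c s" "\<forall>s\<in>S. 0 \<le> d s" by auto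
    then show "x + y \<in> ?R"
      by (intro CollectI exI[of _ "\<lambda>s. c s + d s"]) (auto simp: sum.distrib scaleR_left_distrib)
  next
    fix x and k :: real assume "x \<in> ?R" "0 \<le> k"
    then obtain c where "x = (\<Sum>s\<in>S. c s *\<^sub>R s)" "\<forall>s\<in>S. 0 \<le> c s" by auto
    then show "k *\<^sub>R x \<in> ?R"
      using \<open>0 \<le> k\<close> by (intro CollectI exI[of _ "\<lambda>s. k * c s"]) (auto simp: scaleR_sum_right)
  qed
  fix T assume T: "S \<subseteq> T" "convex_cone T"
  show "?R \<subseteq> T"
  proof clarify
    fix c assume c: "\<forall>s\<in>S. 0 \<le> (c s :: real)"
    have "(\<Sum>s\<in>U. c s *\<^sub>R s) \<in> T" if "U \<subseteq> S" for U
      using finite_subset[OF that assms] that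
    proof (induction U rule: finite_induct)
      case empty
      then show ?case using convex_cone_contains_0[OF T(2)] by simp
    next
      case (insert s U)
      then show ?case using T c by (auto intro!: convex_cone_add convex_cone_scaleR)
    qed
    then show "(\<Sum>s\<in>S. c s *\<^sub>R s) \<in> T" by blast
  qed
qed

lemma hull_nonneg:
  assumes "linear u" "\<And>s. s \<in> S \<Longrightarrow> 0 \<le> u s" "v \<in> convex_cone hull S"
  shows "0 \<le> (u v :: real)"
proof -
  have "convex_cone hull S \<subseteq> {v. 0 \<le> u v}"
    using assms(1,2) by (intro hull_minimal)
      (auto simp: convex_cone_iff linear_add linear_scale linear_0)
  then show ?thesis using assms(3) by blast
qed

text \<open>A functional that is nonnegative on \<open>S\<close> vanishes at a nonnegative
  combination exactly when it vanishes at every generator with positive coefficient. A face is thus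
  known from the generators on it, and a real functional may be exchanged for an integral one with
  the same zeros in \<open>S\<close>.\<close>

lemma face_eq:
  assumes "finite S" and u: "linear u" "\<And>s. s \<in> S \<Longrightarrow> 0 \<le> (u s :: real)"
    and w: "linear w" "\<And>s. s \<in> S \<Longrightarrow> 0 \<le> (w s :: real)"
    and eq: "\<And>s. s \<in> S \<Longrightarrow> u s = 0 \<longleftrightarrow> w s = 0"
  shows "{v \<in> convex_cone hull S. u v = 0} = {v \<in> convex_cone hull S. w v = 0}"
proof -
  have "u (\<Sum>s\<in>S. c s *\<^sub>R s) = 0 \<longleftrightarrow> (\<forall>s\<in>S. c s = 0 \<or> u s = 0)"
    if "linear u" "\<And>s. s \<in> S \<Longrightarrow> 0 \<le> (u s :: real)" "\<forall>s\<in>S. 0 \<le> c s" for u c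
  proof -
    have "u (\<Sum>s\<in>S. c s *\<^sub>R s) = (\<Sum>s\<in>S. c s * u s)"
      by (simp add: linear_sum[OF that(1)] linear_scale[OF that(1)])
    then show ?thesis using that assms(1) by (simp add: sum_nonneg_eq_0_iff)
  qed
  from this[OF u] this[OF w] show ?thesis
    unfolding convex_cone_hull_finite[OF assms(1)] using eq by auto
qed

lemma face_of_single:
  assumes "finite S" "s \<in> S" and u: "linear u" "u s = 0" "\<And>t. t \<in> S \<Longrightarrow> t \<noteq> s \<Longrightarrow> 0 < (u t :: real)"
  shows "{v \<in> convex_cone hull S. u v = 0} = convex_cone hull {s}"
proof
  show "convex_cone hull {s} \<subseteq> {v \<in> convex_cone hull S. u v = 0}"
    using assms(2) u by (auto simp: convex_cone_hull_finite linear_scale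
      intro: convex_cone_hull_mul hull_inc)
  show "{v \<in> convex_cone hull S. u v = 0} \<subseteq> convex_cone hull {s}"
  proof clarify
    fix v assume "v \<in> convex_cone hull S" "u v = 0"
    then obtain c where c: "v = (\<Sum>t\<in>S. c t *\<^sub>R t)" "\<forall>t\<in>S. 0 \<le> c t"
      by (auto simp: convex_cone_hull_finite[OF assms(1)])
    have nonneg: "0 \<le> u t" if "t \<in> S" for t using u that by (cases "t = s") (auto simp: less_imp_le)
    have "(\<Sum>t\<in>S. c t * u t) = 0"
      using \<open>u v = 0\<close> by (simp add: c linear_sum[OF u(1)] linear_scale[OF u(1)])
    then have "\<forall>t\<in>S. c t * u t = 0"
      using c(2) nonneg assms(1) by (simp add: sum_nonneg_eq_0_iff)
    then have "c t = 0" if "t \<in> S" "t \<noteq> s" for t using u(3)[OF that] that by auto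
    then have "v = (\<Sum>t\<in>{s}. c t *\<^sub>R t)"
      unfolding c(1) using assms(1,2) by (intro sum.mono_neutral_right) auto
    then show "v \<in> convex_cone hull {s}"
      using c(2) assms(2) convex_cone_hull_mul[OF hull_inc[of s "{s}"], of "c s"] by simp
  qed
qed

text \<open>On a generator with \<open>m s > 0\<close> a large multiple of \<open>m\<close>
  outweighs \<open>u\<close>, and one multiple serves all of the finitely many generators. For
  monomials this means that a power of \<open>x^m\<close> clears the denominator of
  \<open>x^u\<close> when \<open>x^u\<close> is regular on the chart of the face
  \<open>m = 0\<close>.\<close>

lemma nonneg_shift:
  assumes "finite S" and m: "linear m" "\<And>s. s \<in> S \<Longrightarrow> 0 \<le> (m s :: real)"
    and u: "linear u" "\<And>s. s \<in> S \<Longrightarrow> m s = 0 \<Longrightarrow> 0 \<le> (u s :: real)"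
  shows "\<exists>k::nat. \<forall>v\<in>convex_cone hull S. 0 \<le> of_nat k * m v + u v"
proof -
  have "\<exists>k::nat. 0 \<le> of_nat k * m s + u s" if "s \<in> S" for s
  proof (cases "m s = 0")
    case False
    then have "0 < m s" using m(2)[OF that] by simp
    then obtain k :: nat where "- u s < of_nat k * m s" using reals_Archimedean3 by blast
    then show ?thesis by (intro exI[of _ k]) simp
  qed (use u that in simp)
  then obtain k :: "'a \<Rightarrow> nat" where k: "\<And>s. s \<in> S \<Longrightarrow> 0 \<le> of_nat (k s) * m s + u s" by metis
  let ?k = "Max (k ` S)"
  have "0 \<le> of_nat ?k * m s + u s" if "s \<in> S" for s
  proof -
    have "of_nat (k s) * m s \<le> of_nat ?k * m s"
      using that assms(1) m(2) by (intro mult_right_mono) auto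
    then show ?thesis using k[OF that] by linarith
  qed
  moreover have "linear (\<lambda>v. of_nat ?k * m v + u v)"
    using m(1) u(1) by (intro linear_compose_add linear_compose_scale_right[of m "of_nat ?k", simplified])
  ultimately have "0 \<le> of_nat ?k * m v + u v" if "v \<in> convex_cone hull S" for v
    using hull_nonneg[OF _ _ that, of "\<lambda>v. of_nat ?k * m v + u v"] by simp
  then show ?thesis by blast
qed

lemma common_denominator:
  fixes f :: "'a \<Rightarrow> rat"
  assumes "finite A"
  shows "\<exists>d>0. \<forall>x\<in>A. of_int d * f x \<in> \<int>"
  using assms
proof (induction A rule: finite_induct)
  case empty
  then show ?case by (intro exI[of _ 1]) simp
next
  case (insert y A)
  then obtain d where d: "d > 0" "\<forall>x\<in>A. of_int d * f x \<in> \<int>" by blast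
  obtain a b where ab: "quotient_of (f y) = (a, b)" by fastforce
  then have b: "b > 0" "f y = of_int a / of_int b"
    using quotient_of_denom_pos quotient_of_div by blast+
  have "of_int (d * b) * f y \<in> \<int>" using b by simp
  moreover have "of_int (d * b) * f x \<in> \<int>" if "x \<in> A" for x
    using Ints_mult[OF Ints_of_int[of b] d(2)[rule_format, OF that]] by (simp add: mult_ac)
  ultimately show ?case using b d by (intro exI[of _ "d * b"]) auto
qed

section \<open>Full lattices and integral functionals\<close>

lemma full_latticeE:
  assumes "full_lattice N"
  obtains B where "finite B" "independent B" "span B = UNIV" "N = int_span B"
  using assms unfolding full_lattice_def by blast

lemma int_span_zero: "0 \<in> int_span B"
  unfolding int_span_def by (intro CollectI exI[of _ "{}"]) simp

lemma int_span_uminus: "v \<in> int_span B \<Longrightarrow> - v \<in> int_span B"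
proof -
  assume "v \<in> int_span B"
  then obtain T c where "v = (\<Sum>b\<in>T. of_int (c b) *\<^sub>R b)" "finite T" "T \<subseteq> B"
    unfolding int_span_def by blast
  then show ?thesis
    unfolding int_span_def by (intro CollectI exI[of _ T] exI[of _ "\<lambda>b. - c b"]) (simp add: sum_negf)
qed

lemma integral_on_int_span:
  assumes "linear m" "\<And>b. b \<in> B \<Longrightarrow> m b \<in> (\<int> :: real set)" "v \<in> int_span B"
  shows "m v \<in> \<int>"
proof -
  obtain T c where T: "v = (\<Sum>b\<in>T. of_int (c b) *\<^sub>R b)" "finite T" "T \<subseteq> B"
    using assms(3) unfolding int_span_def by blast
  then have "m v = (\<Sum>b\<in>T. of_int (c b) * m b)"
    by (simp add: linear_sum[OF assms(1)] linear_scale[OF assms(1)])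
  also have "\<dots> \<in> \<int>" using T assms(2) by (intro Ints_sum Ints_mult) auto
  finally show ?thesis .
qed

text \<open>Farkas' lemma is applied over the rationals, to the real vector space regarded as a rational one; the
  real functional \<open>u\<close> excludes the alternative.\<close>

lemma rational_supporting_functional:
  fixes N :: "'v::real_vector set"
  assumes N: "full_lattice N" and S: "finite S" "S \<subseteq> N"
    and u: "linear u" "\<And>s. s \<in> S \<Longrightarrow> 0 \<le> (u s :: real)"
  obtains m where "m \<in> dual_lattice N" "\<And>s. s \<in> S \<Longrightarrow> 0 \<le> m s" "\<And>s. s \<in> S \<Longrightarrow> m s = 0 \<longleftrightarrow> u s = 0"
proof -
  define sc :: "rat \<Rightarrow> 'v \<Rightarrow> 'v" where "sc q v = of_rat q *\<^sub>R v" for q v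
  have vs: "vector_space sc"
    by unfold_locales (simp_all add: sc_def scaleR_right_distrib scaleR_left_distrib of_rat_add of_rat_mult)
  \<comment> \<open>Generators at which \<open>u\<close> vanishes enter with both signs, so that
    nonnegativity makes the functional vanish there.\<close>
  let ?a = "\<lambda>(s, pos). if pos then s else - s"
  let ?I = "S \<times> {True} \<union> {s \<in> S. u s = 0} \<times> {False}"
  have ua: "0 \<le> u (?a i)" if "i \<in> ?I" for i
    using that u by (auto simp: linear_neg)
  \<comment> \<open>For each generator \<open>t\<close> with \<open>u t \<noteq> 0\<close> a
    functional positive at \<open>t\<close> is found. The sum of these has the same zeros in
    \<open>S\<close> as \<open>u\<close>, because no summand is negative on
    \<open>S\<close>.\<close>
  define S\<^sub>1 where "S\<^sub>1 = {t \<in> S. u t \<noteq> 0}"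
  define Q where "Q t f \<longleftrightarrow> (\<forall>x y. f (x + y) = f x + f y) \<and> (\<forall>c x. f (sc c x) = c * f x) \<and>
      (\<forall>s\<in>S. 0 \<le> f s) \<and> (\<forall>s\<in>S. u s = 0 \<longrightarrow> f s = 0) \<and> 0 < f t" for t and f :: "'v \<Rightarrow> rat"
  have "\<exists>f. Q t f" if "t \<in> S\<^sub>1" for t
  proof -
    have t: "t \<in> S" "u t \<noteq> 0" using that by (auto simp: S\<^sub>1_def)
    have fin: "finite ?I" using S by simp
    have no: "\<not> (\<exists>c. (\<forall>i\<in>?I. 0 \<le> c i) \<and> - t = (\<Sum>i\<in>?I. sc (c i) (?a i)))"
    proof clarify
      fix c assume c: "\<forall>i\<in>?I. 0 \<le> c i" "- t = (\<Sum>i\<in>?I. sc (c i) (?a i))"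
      have "- u t = u (- t)" by (simp add: linear_neg[OF u(1)])
      also have "\<dots> = (\<Sum>i\<in>?I. of_rat (c i) * u (?a i))"
        unfolding c(2) by (simp add: linear_sum[OF u(1)] linear_scale[OF u(1)] sc_def)
      also have "\<dots> \<ge> 0" using c(1) ua by (intro sum_nonneg mult_nonneg_nonneg) auto
      finally show False using u(2)[OF t(1)] t(2) by linarith
    qed
    obtain f where f: "\<forall>x y. f (x + y) = f x + f y" "\<forall>c x. f (sc c x) = c * f x"
      "\<forall>i\<in>?I. 0 \<le> f (?a i)" "f (- t) < 0"
      using farkas[OF vs fin, of "- t" ?a] no by blast
    have neg: "f (- x) = - f x" for x
    proof -
      have "f 0 = 0" using f(1)[rule_format, of 0 0] by simp
      then show ?thesis using f(1)[rule_format, of x "- x"] by simp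
    qed
    have "0 \<le> f s" if "s \<in> S" for s using f(3)[rule_format, of "(s, True)"] that by simp
    moreover have "f s = 0" if "s \<in> S" "u s = 0" for s
      using f(3)[rule_format, of "(s, False)"] neg calculation[OF that(1)] that by simp
    ultimately show ?thesis using f neg unfolding Q_def by (intro exI[of _ f]) auto
  qed
  then have "\<forall>t\<in>S\<^sub>1. \<exists>f. Q t f" by blast
  then obtain F where Q: "\<forall>t\<in>S\<^sub>1. Q t (F t)" by (rule bchoice[THEN exE])
  have F: "F t (x + y) = F t x + F t y" "F t (sc c x) = c * F t x" "s \<in> S \<Longrightarrow> 0 \<le> F t s"
    "s \<in> S \<Longrightarrow> u s = 0 \<Longrightarrow> F t s = 0" "0 < F t t" if "t \<in> S\<^sub>1" for t x y c s
    using Q that unfolding Q_def by simp_all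
  define f where "f x = (\<Sum>t\<in>S\<^sub>1. F t x)" for x
  have f_add: "f (x + y) = f x + f y" and f_scale: "f (sc c x) = c * f x" for x y c
    by (simp_all add: f_def F sum.distrib sum_distrib_left)
  have f_nonneg: "0 \<le> f s" if "s \<in> S" for s
    unfolding f_def using that F(3) by (intro sum_nonneg) auto
  have f_zero: "f s = 0 \<longleftrightarrow> u s = 0" if s: "s \<in> S" for s
  proof
    assume "u s = 0"
    then show "f s = 0" unfolding f_def using F(4) s by (intro sum.neutral) auto
  next
    assume "f s = 0"
    moreover have "finite S\<^sub>1" using S(1) by (simp add: S\<^sub>1_def)
    ultimately have "\<forall>t\<in>S\<^sub>1. F t s = 0"
      unfolding f_def using F(3) s by (subst (asm) sum_nonneg_eq_0_iff) auto
    then have "s \<notin> S\<^sub>1" using F(5)[of s] by force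
    then show "u s = 0" using s by (simp add: S\<^sub>1_def)
  qed
  obtain B where B: "finite B" "independent B" "span B = UNIV" "N = int_span B"
    using N by (rule full_latticeE)
  obtain d :: int where d: "d > 0" "\<forall>b\<in>B. of_int d * f b \<in> \<int>"
    using common_denominator[OF B(1), of f] by blast
  obtain m :: "'v \<Rightarrow> real" where m: "linear m" "\<forall>b\<in>B. m b = of_rat (of_int d * f b)"
    using linear_independent_extend[OF B(2), of "\<lambda>b. of_rat (of_int d * f b) :: real"] by blast
  have f_sum: "f (\<Sum>b\<in>T. h b) = (\<Sum>b\<in>T. f (h b))" if "finite T" for T and h :: "'v \<Rightarrow> 'v"
    using that f_scale[of 0 0] by (induction T rule: finite_induct) (auto simp: f_add sc_def)
  \<comment> \<open>\<open>f\<close> is linear over the rationals only, whereas \<open>m\<close> is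
    the real-linear extension of the values of \<open>d * f\<close> on \<open>B\<close>. They agree
    on lattice vectors, whose coordinates are integers, and \<open>S\<close> consists of such
    vectors.\<close>
  have mf: "m v = of_rat (of_int d * f v)" if v: "v \<in> N" for v
  proof -
    obtain T c where T: "v = (\<Sum>b\<in>T. of_int (c b) *\<^sub>R b)" "finite T" "T \<subseteq> B"
      using v unfolding B(4) int_span_def by blast
    have "f v = (\<Sum>b\<in>T. of_int (c b) * f b)"
      unfolding T(1) f_sum[OF T(2)] using f_scale[of "of_int (c _)"] by (simp add: sc_def)
    moreover have "m v = (\<Sum>b\<in>T. of_int (c b) * m b)"
      unfolding T(1) by (simp add: linear_sum[OF m(1)] linear_scale[OF m(1)])
    moreover have "m b = of_rat (of_int d * f b)" if "b \<in> T" for b using m(2) T(3) that by blast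
    ultimately show ?thesis
      by (simp add: of_rat_sum of_rat_mult sum_distrib_left mult.left_commute)
  qed
  show ?thesis
  proof (rule that[of m])
    have "m b \<in> \<int>" if "b \<in> B" for b
    proof -
      have "of_int d * f b \<in> \<int>" using d(2) that by blast
      then obtain k :: int where "of_int d * f b = of_int k" by (rule Ints_cases)
      then have "m b = of_int k" using m(2) that by (metis of_rat_of_int_eq)
      then show ?thesis by simp
    qed
    then have "\<forall>v\<in>N. m v \<in> \<int>"
      using integral_on_int_span[OF m(1), of B] unfolding B(4) by blast
    then show "m \<in> dual_lattice N" using m(1) by (simp add: dual_lattice_def)
    show "0 \<le> m s" if "s \<in> S" for s
      using mf[of s] that S(2) f_nonneg[OF that] d(1) by auto
    show "m s = 0 \<longleftrightarrow> u s = 0" if "s \<in> S" for s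
      using mf[of s] that S(2) f_zero[OF that] d(1) by auto
  qed
qed

section \<open>Extremal rays and primitive generators\<close>

lemma minimal_generators:
  fixes S :: "'v::real_vector set"
  assumes "finite S"
  obtains T where "finite T" "T \<subseteq> S" "convex_cone hull T = convex_cone hull S"
    "\<And>s. s \<in> T \<Longrightarrow> s \<notin> convex_cone hull (T - {s})"
proof -
  let ?P = "\<lambda>T. T \<subseteq> S \<and> convex_cone hull T = convex_cone hull S"
  obtain T where T: "?P T" "\<And>T'. ?P T' \<Longrightarrow> card T \<le> card T'"
    using exists_least_iff[of "\<lambda>n. \<exists>T. ?P T \<and> card T = n"] by (metis not_less subset_refl)
  have fin: "finite T" using T(1) assms finite_subset by blast
  have "s \<notin> convex_cone hull (T - {s})" if s: "s \<in> T" for s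
  proof
    assume "s \<in> convex_cone hull (T - {s})"
    then have "convex_cone hull (insert s (T - {s})) = convex_cone hull (T - {s})"
      by (rule hull_redundant)
    then have "?P (T - {s})" using T(1) s by (auto simp: insert_absorb)
    then have "card T \<le> card (T - {s})" by (rule T(2))
    then show False using card_Diff1_less[OF fin s] by simp
  qed
  then show ?thesis using that T(1) fin by blast
qed

lemma vector_space_real: "vector_space (scaleR :: real \<Rightarrow> 'v::real_vector \<Rightarrow> 'v)"
  by unfold_locales (simp_all add: scaleR_right_distrib scaleR_left_distrib)

lemma farkas_real:
  fixes a :: "'i \<Rightarrow> 'v::real_vector"
  assumes "finite I" "\<nexists>c. (\<forall>i\<in>I. 0 \<le> c i) \<and> b = (\<Sum>i\<in>I. c i *\<^sub>R a i)"
  obtains f :: "'v \<Rightarrow> real" where "linear f" "\<And>i. i \<in> I \<Longrightarrow> 0 \<le> f (a i)" "f b < 0"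
proof -
  obtain f :: "'v \<Rightarrow> real" where f: "\<forall>x y. f (x + y) = f x + f y" "\<forall>c x. f (c *\<^sub>R x) = c * f x"
    "\<forall>i\<in>I. 0 \<le> f (a i)" "f b < 0"
    using farkas[OF vector_space_real assms(1), of b a] assms(2) by blast
  have "linear f" by (rule linearI) (use f in auto)
  then show ?thesis using that f by blast
qed

text \<open>It suffices to find, for each \<open>t \<noteq> s\<close>, a functional that is
  nonnegative on \<open>S\<close>, zero at \<open>s\<close> and positive at \<open>t\<close>, and to
  add these up. If there is none, Farkas' lemma yields \<open>k *\<^sub>R s = t + y\<close> with
  \<open>y\<close> generated by \<open>S - {s}\<close>. For \<open>k > 0\<close> this makes
  \<open>s\<close> redundant. Otherwise \<open>k *\<^sub>R s\<close> and its negative both lie in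
  the cone, hence vanish; then so do \<open>t\<close> and \<open>y = - t\<close>.\<close>

lemma extremal_ray_functional:
  fixes S :: "'v::real_vector set"
  assumes S: "finite S" and s: "s \<in> S" and min: "\<And>t. t \<in> S \<Longrightarrow> t \<notin> convex_cone hull (S - {t})"
    and pointed: "\<And>v. v \<in> convex_cone hull S \<Longrightarrow> - v \<in> convex_cone hull S \<Longrightarrow> v = 0"
  obtains u :: "'v \<Rightarrow> real" where "linear u" "u s = 0" "\<And>t. t \<in> S \<Longrightarrow> t \<noteq> s \<Longrightarrow> 0 < u t"
proof -
  let ?a = "\<lambda>(r, pos). if pos then r else - r"
  let ?I = "S \<times> {True} \<union> {s} \<times> {False}"
  have fin: "finite ?I" using S by simp
  have nz: "t \<noteq> 0" if "t \<in> S" for t using min[OF that] convex_cone_hull_contains_0 by metis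
  define Q where "Q t u \<longleftrightarrow> linear u \<and> u s = 0 \<and> (\<forall>r\<in>S. 0 \<le> u r) \<and> 0 < u t" for t and u :: "'v \<Rightarrow> real"
  have "\<exists>u. Q t u" if t: "t \<in> S - {s}" for t
  proof -
    have no: "\<nexists>c. (\<forall>i\<in>?I. 0 \<le> c i) \<and> - t = (\<Sum>i\<in>?I. c i *\<^sub>R ?a i)"
    proof clarify
      fix c assume c: "\<forall>i\<in>?I. 0 \<le> c i" "- t = (\<Sum>i\<in>?I. c i *\<^sub>R ?a i)"
      let ?c = "\<lambda>r. c (r, True)"
      let ?k = "c (s, False) - ?c s"
      let ?y = "\<Sum>r\<in>S - {s}. ?c r *\<^sub>R r"
      have 1: "(\<Sum>i\<in>?I. c i *\<^sub>R ?a i) = (\<Sum>i\<in>S \<times> {True}. c i *\<^sub>R ?a i) - c (s, False) *\<^sub>R s"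
        using S by (subst sum.union_disjoint) auto
      have 2: "(\<Sum>i\<in>S \<times> {True}. c i *\<^sub>R ?a i) = (\<Sum>r\<in>S. ?c r *\<^sub>R r)"
        by (rule sum.reindex_cong[of "\<lambda>r. (r, True)"]) (auto simp: inj_on_def)
      have 3: "(\<Sum>r\<in>S. ?c r *\<^sub>R r) = ?c s *\<^sub>R s + ?y" using S s by (simp add: sum.remove)
      have 4: "- t = (?c s *\<^sub>R s + ?y) - c (s, False) *\<^sub>R s" using c(2) unfolding 1 2 3 .
      have "t = c (s, False) *\<^sub>R s - (?c s *\<^sub>R s + ?y)"
        using arg_cong[OF 4, of uminus] by (simp only: minus_minus minus_diff_eq)
      then have eq: "?k *\<^sub>R s = t + ?y" by (simp add: scaleR_left_diff_distrib)
      have "?y \<in> convex_cone hull (S - {s})"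
        using c(1) S by (auto simp: convex_cone_hull_finite)
      moreover have tS: "t \<in> convex_cone hull (S - {s})" using t by (intro hull_inc)
      ultimately have mem: "?k *\<^sub>R s \<in> convex_cone hull (S - {s})" "?y \<in> convex_cone hull (S - {s})"
        unfolding eq by (auto intro: convex_cone_hull_add)
      have mono: "convex_cone hull (S - {s}) \<subseteq> convex_cone hull S" by (rule hull_mono) blast
      show False
      proof (cases "0 < ?k")
        case True
        then have "(1 / ?k) *\<^sub>R (?k *\<^sub>R s) \<in> convex_cone hull (S - {s})"
          using convex_cone_hull_mul[OF mem(1), of "1 / ?k"] by simp
        then show False using True min[OF s] by simp
      next
        case False
        have "(- ?k) *\<^sub>R s \<in> convex_cone hull S"
          using convex_cone_hull_mul[OF hull_inc[OF s], of "- ?k"] False by simp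
        then have "- (?k *\<^sub>R s) \<in> convex_cone hull S" by (simp only: scaleR_minus_left)
        then have "?k *\<^sub>R s = 0" using pointed[of "?k *\<^sub>R s"] mem(1) mono by blast
        then have "- t = ?y" using eq by (metis add.inverse_inverse add_eq_0_iff)
        then have "t = 0" using pointed[of t] mem(2) tS mono by auto
        then show False using nz t by blast
      qed
    qed
    obtain f :: "'v \<Rightarrow> real" where f: "linear f" "\<And>i. i \<in> ?I \<Longrightarrow> 0 \<le> f (?a i)" "f (- t) < 0"
      using farkas_real[OF fin no] by blast
    have "0 \<le> f r" if "r \<in> S" for r using f(2)[of "(r, True)"] that by simp
    moreover have "f s = 0"
      using f(2)[of "(s, True)"] f(2)[of "(s, False)"] s linear_neg[OF f(1), of s] by auto
    ultimately show ?thesis using f(1,3) linear_neg[OF f(1), of t] unfolding Q_def by (intro exI[of _ f]) auto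
  qed
  then have "\<forall>t\<in>S - {s}. \<exists>u. Q t u" by blast
  then obtain F where Q: "\<forall>t\<in>S - {s}. Q t (F t)" by (rule bchoice[THEN exE])
  show ?thesis
  proof (rule that[of "\<lambda>x. \<Sum>t\<in>S - {s}. F t x"])
    show "linear (\<lambda>x. \<Sum>t\<in>S - {s}. F t x)"
      using Q by (intro linear_compose_sum) (auto simp: Q_def)
    show "(\<Sum>t\<in>S - {s}. F t s) = 0" using Q by (intro sum.neutral) (auto simp: Q_def)
    show "0 < (\<Sum>t\<in>S - {s}. F t r)" if "r \<in> S" "r \<noteq> s" for r
      using Q that S by (intro sum_pos2[of _ r]) (auto simp: Q_def)
  qed
qed

lemma convex_cone_hull_single: "convex_cone hull {v} = {c *\<^sub>R v | c. 0 \<le> c}"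
  by (auto simp: convex_cone_hull_finite)

lemma convex_cone_hull_scale:
  assumes "0 < c"
  shows "convex_cone hull {c *\<^sub>R v} = convex_cone hull {v}"
proof (rule equalityI; rule hull_minimal)
  show "{c *\<^sub>R v} \<subseteq> convex_cone hull {v}"
    using convex_cone_hull_mul[OF hull_inc[of v "{v}"], of c] assms by simp
  show "{v} \<subseteq> convex_cone hull {c *\<^sub>R v}"
    using convex_cone_hull_mul[OF hull_inc[of "c *\<^sub>R v" "{c *\<^sub>R v}"], of "1 / c"] assms by simp
qed (rule convex_cone_convex_cone_hull)+

lemma primitive_generator:
  fixes N :: "'v::real_vector set"
  assumes N: "full_lattice N" and s: "s \<in> N" "s \<noteq> 0"
  obtains c v where "0 < c" "s = c *\<^sub>R v" "primitive N v"
proof -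
  obtain B where B: "finite B" "independent B" "span B = UNIV" "N = int_span B"
    using N by (rule full_latticeE)
  obtain T n where T: "s = (\<Sum>b\<in>T. of_int (n b) *\<^sub>R b)" "finite T" "T \<subseteq> B"
    using s(1) unfolding B(4) int_span_def by blast
  have "\<exists>b\<in>T. n b \<noteq> 0"
  proof (rule ccontr)
    assume "\<not> ?thesis"
    then have "s = 0" unfolding T(1) by (intro sum.neutral) auto
    then show False using s(2) by blast
  qed
  then obtain b where b: "b \<in> T" "n b \<noteq> 0" by blast
  obtain g :: "'v \<Rightarrow> real" where g: "linear g" "\<forall>x\<in>B. g x = (if x = b then 1 else 0)"
    using linear_independent_extend[OF B(2), of "\<lambda>x. if x = b then 1 else 0"] by blast
  have gint: "g v \<in> \<int>" if "v \<in> N" for v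
    using integral_on_int_span[OF g(1), of B v] g(2) that B(4) by auto
  have "g s = (\<Sum>x\<in>T. of_int (n x) * (if x = b then 1 else 0))"
    unfolding T(1) using g(2) T(3) by (simp add: linear_sum[OF g(1)] linear_scale[OF g(1)] subset_eq cong: sum.cong)
  also have "\<dots> = of_int (n b)" using T(2) b(1) by (simp add: if_distrib cong: if_cong)
  finally have gs: "g s = of_int (n b)" .
  \<comment> \<open>Divisibility of \<open>s\<close> by \<open>m\<close> in \<open>N\<close> makes
    \<open>m\<close> a divisor of the nonzero integer \<open>g s\<close>, so there is a greatest
    such \<open>m\<close>.\<close>
  let ?P = "\<lambda>m::nat. 0 < m \<and> (1 / of_nat m) *\<^sub>R s \<in> N"
  have bound: "m \<le> nat \<bar>n b\<bar>" if m: "?P m" for m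
  proof -
    obtain k :: int where k: "g ((1 / of_nat m) *\<^sub>R s) = of_int k" using gint m Ints_cases by metis
    then have "of_int (n b) = (of_int (int m * k) :: real)"
      using m by (simp add: linear_scale[OF g(1)] gs field_simps)
    then have nb: "n b = int m * k" by (simp only: of_int_eq_iff)
    then have "k \<noteq> 0" using b(2) by auto
    then have "int m * 1 \<le> int m * \<bar>k\<bar>" by (intro mult_left_mono) auto
    then show ?thesis by (simp add: nb abs_mult)
  qed
  have "?P 1" using s(1) by simp
  then obtain m where m: "?P m" "\<And>k. ?P k \<Longrightarrow> k \<le> m"
    using Nat.ex_has_greatest_nat[of ?P 1 "nat \<bar>n b\<bar>"] bound by blast
  let ?v = "(1 / of_nat m) *\<^sub>R s"
  have "primitive N ?v"
    unfolding primitive_def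
  proof (intro conjI ballI allI impI)
    show "?v \<in> N" "?v \<noteq> 0" using m(1) s(2) by auto
    fix w k assume w: "w \<in> N" "?v = of_int k *\<^sub>R w"
    have k: "k \<noteq> 0" using w(2) m(1) s(2) by auto
    have sw: "s = (of_nat m * of_int k) *\<^sub>R w"
      using arg_cong[OF w(2), of "\<lambda>x. of_nat m *\<^sub>R x"] m(1) by simp
    \<comment> \<open>The sign is moved into the vector, because maximality of \<open>m\<close>
      concerns positive divisors only: \<open>s\<close> is also divisible by
      \<open>m * \<bar>k\<bar>\<close>.\<close>
    let ?w = "of_int (sgn k) *\<^sub>R w"
    have "?w \<in> N" using w(1) int_span_uminus[of w B] int_span_zero B(4)
      by (cases "0 < k") (use k in \<open>auto simp: sgn_if\<close>)
    moreover have "(1 / of_nat (m * nat \<bar>k\<bar>)) *\<^sub>R s = ?w"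
      unfolding sw using m(1) k by (cases "0 < k") (auto simp: sgn_if)
    ultimately have "m * nat \<bar>k\<bar> \<le> m" using m(1) k by (intro m(2)) auto
    then show "\<bar>k\<bar> = 1" using m(1) k by auto
  qed
  moreover have "s = of_nat m *\<^sub>R ?v" using m(1) by simp
  ultimately show ?thesis using that[of "of_nat m" ?v] m(1) by simp
qed

text \<open>A minimal set of generators of the cone spans rays that are faces, hence members of the
  fan, and each of these generators is a positive multiple of an element of
  \<open>ray_generators N \<Sigma>\<close>. Testing \<open>u\<close> on these elements is therefore
  enough.\<close>

lemma nonneg_on_cone:
  fixes N :: "'v::real_vector set"
  assumes N: "full_lattice N" and fan: "is_fan N \<Sigma>" and \<sigma>: "\<sigma> \<in> \<Sigma>"
    and u: "linear u" "\<And>v. v \<in> ray_generators N \<Sigma> \<Longrightarrow> v \<in> \<sigma> \<Longrightarrow> 0 \<le> (u v :: real)"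
  shows "u \<in> dual_cone \<sigma>"
proof -
  have "rational_pointed_cone N \<sigma>" using fan \<sigma> by (simp add: is_fan_def)
  then obtain S where S: "finite S" "S \<subseteq> N" "\<sigma> = convex_cone hull S"
    and pointed: "\<And>v. v \<in> \<sigma> \<Longrightarrow> - v \<in> \<sigma> \<Longrightarrow> v = 0"
    unfolding rational_pointed_cone_def by blast
  obtain T where T: "finite T" "T \<subseteq> S" "convex_cone hull T = convex_cone hull S"
    "\<And>s. s \<in> T \<Longrightarrow> s \<notin> convex_cone hull (T - {s})"
    using minimal_generators[OF S(1)] by metis
  have \<sigma>T: "\<sigma> = convex_cone hull T" using S T by simp
  have "0 \<le> u s" if s: "s \<in> T" for s
  proof -
    have "s \<noteq> 0" using T(4)[OF s] convex_cone_hull_contains_0 by metis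
    moreover have "s \<in> N" using s T S by blast
    ultimately obtain c v where v: "0 < c" "s = c *\<^sub>R v" "primitive N v"
      using primitive_generator[OF N] by metis
    obtain w :: "'v \<Rightarrow> real" where w: "linear w" "w s = 0" "\<And>t. t \<in> T \<Longrightarrow> t \<noteq> s \<Longrightarrow> 0 < w t"
      using extremal_ray_functional[OF T(1) s T(4)] pointed unfolding \<sigma>T by metis
    have "0 \<le> w t" if "t \<in> T" for t using w(2) w(3)[OF that] by (cases "t = s") auto
    then have "w \<in> dual_cone \<sigma>"
      using w(1) hull_nonneg[OF w(1)] unfolding \<sigma>T dual_cone_def by blast
    then have "cone_face {v \<in> \<sigma>. w v = 0} \<sigma>" unfolding cone_face_def by blast
    then have "{v \<in> \<sigma>. w v = 0} \<in> \<Sigma>" using fan \<sigma> unfolding is_fan_def by blast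
    moreover have "{v \<in> \<sigma>. w v = 0} = convex_cone hull {s}"
      unfolding \<sigma>T by (rule face_of_single[OF T(1) s w])
    ultimately have "convex_cone hull {v} \<in> \<Sigma>"
      using convex_cone_hull_scale[OF v(1), of v] v(2) by simp
    then have "v \<in> ray_generators N \<Sigma>" using v(3) by (simp add: ray_generators_def)
    moreover have "v \<in> \<sigma>"
    proof -
      have "(1 / c) *\<^sub>R s \<in> convex_cone hull T"
        using v(1) s by (intro convex_cone_hull_mul hull_inc) auto
      then show ?thesis using v(1,2) \<sigma>T by simp
    qed
    ultimately have "0 \<le> u v" by (rule u(2))
    then show ?thesis using v(1) by (simp add: v(2) linear_scale[OF u(1)])
  qed
  then show ?thesis using hull_nonneg[OF u(1)] u(1) unfolding \<sigma>T dual_cone_def by blast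
qed

section \<open>Consequences of unimodularity\<close>

lemma unimodularD:
  assumes "unimodular N R" "B \<subseteq> R" "independent B" "R \<subseteq> span B"
  shows "int_span B = N"
proof -
  have max: "B' = B" if "B \<subseteq> B'" "B' \<subseteq> R" "independent B'" for B'
  proof (rule ccontr)
    assume "B' \<noteq> B"
    then obtain x where x: "x \<in> B'" "x \<notin> B" using \<open>B \<subseteq> B'\<close> by blast
    have "x \<in> span (B' - {x})"
      using x that assms(4) span_mono[of B "B' - {x}"] by blast
    then show False using x(1) that(3) by (auto simp: dependent_def)
  qed
  show ?thesis
    using assms(1)[unfolded unimodular_def, THEN spec, of B, THEN mp] assms(2,3) max by simp
qed

text \<open>The fan has finitely many rays, and each carries one generator: if
  \<open>w = c *\<^sub>R v\<close>, then \<open>v\<close> extends to a subset of the generators that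
  is a basis of \<open>N\<close>, where \<open>c\<close> is a coordinate of \<open>w\<close> and so
  an integer. Primitivity leaves \<open>c = 1\<close>.\<close>

lemma finite_ray_generators:
  fixes N :: "'v::real_vector set"
  assumes fan: "is_fan N \<Sigma>" and uni: "unimodular N (ray_generators N \<Sigma>)"
  shows "finite (ray_generators N \<Sigma>)"
proof (rule inj_on_finite[of "\<lambda>v. convex_cone hull {v}"])
  show "(\<lambda>v. convex_cone hull {v}) ` ray_generators N \<Sigma> \<subseteq> \<Sigma>" by (auto simp: ray_generators_def)
  show "finite \<Sigma>" using fan by (simp add: is_fan_def)
  show "inj_on (\<lambda>v. convex_cone hull {v}) (ray_generators N \<Sigma>)"
  proof (rule inj_onI)
    fix v w assume vw: "v \<in> ray_generators N \<Sigma>" "w \<in> ray_generators N \<Sigma>" "convex_cone hull {v} = convex_cone hull {w}"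
    then have prim: "primitive N v" "primitive N w" by (simp_all add: ray_generators_def)
    then have nz: "v \<noteq> 0" "w \<noteq> 0" by (simp_all add: primitive_def)
    have "w \<in> convex_cone hull {v}" using vw(3) hull_inc[of w "{w}"] by simp
    then obtain c where c: "0 \<le> c" "w = c *\<^sub>R v" unfolding convex_cone_hull_single by blast
    obtain B where B: "{v} \<subseteq> B" "B \<subseteq> ray_generators N \<Sigma>" "independent B" "ray_generators N \<Sigma> \<subseteq> span B"
      using maximal_independent_subset_extend[of "{v}" "ray_generators N \<Sigma>"] vw(1) nz(1) by auto
    obtain g :: "'v \<Rightarrow> real" where g: "linear g" "\<forall>x\<in>B. g x = (if x = v then 1 else 0)"
      using linear_independent_extend[OF B(3), of "\<lambda>x. if x = v then 1 else 0"] by blast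
    have "w \<in> int_span B" using unimodularD[OF uni B(2-4)] prim(2) by (simp add: primitive_def)
    then have "g w \<in> \<int>" using integral_on_int_span[OF g(1), of B w] g(2) by auto
    moreover have "g w = c" using g B(1) by (simp add: c(2) linear_scale[OF g(1)])
    ultimately obtain k :: int where k: "c = of_int k" by (auto elim: Ints_cases)
    then have "\<bar>k\<bar> = 1" using prim c(2) by (auto simp: primitive_def)
    then have "c = 1" using k c(1) by auto
    then show "v = w" using c(2) by simp
  qed
qed

text \<open>A vertex of the polytope of all \<open>m\<close> with \<open>\<lfloor>u v\<rfloor> \<le> m v \<le> \<lceil>u v\<rceil>\<close> for all \<open>v\<close> in \<open>R\<close> is integral on a basis
  contained in \<open>R\<close>, and hence lies in the dual lattice by unimodularity.\<close>

lemma unimodular_rounding: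
  fixes N R :: "'v::real_vector set"
  assumes uni: "unimodular N R" and fin: "finite R" and u: "linear u"
  obtains m where "m \<in> dual_lattice N" "\<And>v. v \<in> R \<Longrightarrow> \<bar>u v - m v\<bar> < 1"
proof -
  let ?T = "\<lambda>m. {v \<in> R. m v \<in> (\<int> :: real set)}"
  let ?P = "\<lambda>m. linear m \<and> (\<forall>v\<in>R. of_int \<lfloor>u v\<rfloor> \<le> m v \<and> m v \<le> of_int \<lceil>u v\<rceil>)"
  have "?P u" using u by simp
  moreover have "\<forall>m. ?P m \<longrightarrow> card (?T m) < Suc (card R)"
    using fin by (intro allI impI le_imp_less_Suc card_mono) auto
  \<comment> \<open>A point of the polytope with the greatest number of integral values on
    \<open>R\<close> takes the role of the vertex.\<close>
  ultimately have "\<exists>m. ?P m \<and> (\<forall>m'. ?P m' \<longrightarrow> card (?T m') \<le> card (?T m))"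
    by (rule Lattices_Big.ex_has_greatest_nat)
  then obtain m where m: "?P m" "\<And>m'. ?P m' \<Longrightarrow> card (?T m') \<le> card (?T m)" by blast
  have "R \<subseteq> span (?T m)"
  proof (rule ccontr)
    assume "\<not> R \<subseteq> span (?T m)"
    then obtain v\<^sub>0 where v\<^sub>0: "v\<^sub>0 \<in> R" "v\<^sub>0 \<notin> span (?T m)" by blast
    obtain B where B: "B \<subseteq> ?T m" "independent B" "?T m \<subseteq> span B"
      using maximal_independent_subset[of "?T m"] by blast
    have sB: "span B = span (?T m)" using B by (metis span_eq span_mono subset_trans span_superset)
    have indep: "independent (insert v\<^sub>0 B)"
      using B(2) v\<^sub>0(2) sB by (simp add: independent_insert)
    \<comment> \<open>The direction in which \<open>m\<close> is moved: it vanishes wherever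
      \<open>m\<close> is already integral, so that no integral value is lost, but not at
      \<open>v\<^sub>0\<close>.\<close>
    obtain w :: "'v \<Rightarrow> real" where w: "linear w" "\<forall>x\<in>insert v\<^sub>0 B. w x = (if x = v\<^sub>0 then 1 else 0)"
      using linear_independent_extend[OF indep, of "\<lambda>x. if x = v\<^sub>0 then 1 else 0"] by blast
    have "v\<^sub>0 \<notin> B" using v\<^sub>0(2) sB span_base by blast
    then have "w x = 0" if "x \<in> B" for x using w(2) that by auto
    then have w0: "w x = 0" if "x \<in> span B" for x using linear_eq_0_on_span[OF w(1) _ that] by blast
    define A where "A = {v \<in> R. w v \<noteq> 0}"
    have A: "finite A" "A \<noteq> {}" using fin v\<^sub>0(1) w(2) by (auto simp: A_def)
    have notint: "m v \<notin> \<int>" if "v \<in> A" for v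
      using that w0 B(3) by (auto simp: A_def)
    \<comment> \<open>The time at which \<open>m v + t * w v\<close> reaches the next integer in its
      direction of motion. At the least of these times one more value has become integral, and none
      has moved past an integer.\<close>
    define \<theta> where "\<theta> v = (if 0 < w v then (of_int \<lceil>m v\<rceil> - m v) / w v else (of_int \<lfloor>m v\<rfloor> - m v) / w v)" for v
    have strict: "of_int \<lfloor>m v\<rfloor> < m v" "m v < of_int \<lceil>m v\<rceil>" if "v \<in> A" for v
      using notint[OF that] of_int_floor_le[of "m v"] le_of_int_ceiling[of "m v"]
      by (metis Ints_of_int order_le_less)+
    have \<theta>_pos: "0 < \<theta> v" if "v \<in> A" for v
      using strict[OF that] that by (auto simp: \<theta>_def A_def divide_neg_neg)
    define t where "t = Min (\<theta> ` A)"
    have t_le: "t \<le> \<theta> v" if "v \<in> A" for v using A that by (simp add: t_def)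
    have "t \<in> \<theta> ` A" unfolding t_def using A by (intro Min_in) auto
    then obtain v\<^sub>1 where v\<^sub>1: "v\<^sub>1 \<in> A" "t = \<theta> v\<^sub>1" by blast
    have t: "0 < t" using v\<^sub>1 \<theta>_pos by simp
    define m' where "m' v = m v + t * w v" for v
    have between: "of_int \<lfloor>m v\<rfloor> \<le> m' v \<and> m' v \<le> of_int \<lceil>m v\<rceil>" if v: "v \<in> R" for v
    proof (cases "w v = 0")
      case True
      then show ?thesis by (simp add: m'_def)
    next
      case False
      then have vA: "v \<in> A" using v by (simp add: A_def)
      show ?thesis
      proof (cases "0 < w v")
        case True
        then have "t * w v \<le> of_int \<lceil>m v\<rceil> - m v" using t_le[OF vA] by (simp add: \<theta>_def field_simps)
        moreover have "0 \<le> t * w v" using t True by simp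
        ultimately show ?thesis using strict[OF vA] unfolding m'_def by linarith
      next
        case neg: False
        then have "w v < 0" using False by simp
        then have "of_int \<lfloor>m v\<rfloor> - m v \<le> t * w v" using t_le[OF vA] by (simp add: \<theta>_def field_simps)
        moreover have "t * w v \<le> 0" using t \<open>w v < 0\<close> by (simp add: mult_le_0_iff)
        ultimately show ?thesis using strict[OF vA] unfolding m'_def by linarith
      qed
    qed
    have "?P m'"
    proof (intro conjI ballI)
      have "linear (\<lambda>v. m v + t *\<^sub>R w v)"
        using m(1) w(1) by (intro linear_compose_add linear_compose_scale_right) auto
      then show "linear m'" by (simp add: m'_def[abs_def])
      fix v assume v: "v \<in> R"
      \<comment> \<open>The bounds of the polytope are integers, so values that stay between the
        floor and the ceiling of \<open>m v\<close> do not leave it.\<close>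
      have "\<lfloor>u v\<rfloor> \<le> \<lfloor>m v\<rfloor>" "\<lceil>m v\<rceil> \<le> \<lceil>u v\<rceil>"
        using m(1) v by (auto simp: le_floor_iff ceiling_le_iff)
      then have "(of_int \<lfloor>u v\<rfloor> :: real) \<le> of_int \<lfloor>m v\<rfloor>" "(of_int \<lceil>m v\<rceil> :: real) \<le> of_int \<lceil>u v\<rceil>"
        by simp_all
      then show "of_int \<lfloor>u v\<rfloor> \<le> m' v" "m' v \<le> of_int \<lceil>u v\<rceil>"
        using between[OF v] by linarith+
    qed
    then have le: "card (?T m') \<le> card (?T m)" by (rule m(2))
    have "m' v\<^sub>1 \<in> \<int>"
      using v\<^sub>1 by (auto simp: m'_def \<theta>_def A_def)
    moreover have "m' v = m v" if "v \<in> ?T m" for v using w0 B(3) that by (auto simp: m'_def)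
    ultimately have "insert v\<^sub>1 (?T m) \<subseteq> ?T m'" using v\<^sub>1(1) by (auto simp: A_def)
    then have "card (insert v\<^sub>1 (?T m)) \<le> card (?T m')" using fin by (intro card_mono) auto
    moreover have "v\<^sub>1 \<notin> ?T m" using notint[OF v\<^sub>1(1)] by simp
    ultimately show False using le fin by simp
  qed
  moreover obtain B where B: "B \<subseteq> ?T m" "independent B" "?T m \<subseteq> span B"
    using maximal_independent_subset[of "?T m"] by blast
  ultimately have "R \<subseteq> span B" using span_mono[of "?T m" "span B"] by (metis span_span subset_trans)
  then have "int_span B = N" using unimodularD[OF uni _ B(2)] B(1) by blast
  then have "m \<in> dual_lattice N"
    using integral_on_int_span[of m B] m(1) B(1) unfolding dual_lattice_def by blast
  moreover have "\<bar>u v - m v\<bar> < 1" if v: "v \<in> R" for v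
  \<comment> \<open>For integral \<open>u v\<close> both bounds equal \<open>u v\<close> and force
    \<open>m v = u v\<close>. Otherwise \<open>u v\<close> is an interior point of an interval of
    length one that contains \<open>m v\<close>, which makes the inequality strict.\<close>
  proof (cases "u v \<in> \<int>")
    case True
    then show ?thesis using m(1) v by (auto elim!: Ints_cases)
  next
    case False
    then have "of_int \<lfloor>u v\<rfloor> < u v" "u v < of_int \<lceil>u v\<rceil>"
      using of_int_floor_le[of "u v"] le_of_int_ceiling[of "u v"]
      by (metis Ints_of_int order_le_less)+
    moreover have "of_int \<lceil>u v\<rceil> \<le> of_int \<lfloor>u v\<rfloor> + (1 :: real)"
      by (metis ceiling_diff_floor_le_1 add.commute diff_le_eq of_int_1 of_int_add of_int_le_iff)
    moreover have "of_int \<lfloor>u v\<rfloor> \<le> m v" "m v \<le> of_int \<lceil>u v\<rceil>" using m(1) v by auto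
    ultimately show ?thesis by linarith
  qed
  ultimately show ?thesis using that by blast
qed

section \<open>Spectra and structure sheaves of domains\<close>

text \<open>The coordinate rings of all charts of a variety lie in one type of Laurent polynomials.
  A ring is thus given by its carrier, and restriction to a smaller chart is
  \<open>id\<close>.\<close>

definition ring_on :: "'a::comm_ring_1 set \<Rightarrow> 'a ring" where
  "ring_on C = \<lparr>carrier = C, mult = (*), one = 1, zero = 0, add = (+)\<rparr>"

lemma ring_on_simps [simp]:
  "carrier (ring_on C) = C" "mult (ring_on C) = (*)" "one (ring_on C) = 1"
  "zero (ring_on C) = 0" "add (ring_on C) = (+)"
  by (simp_all add: ring_on_def)

text \<open>Cancellation, assumed for elements of \<open>C\<close>, reduces equality of fractions to
  equality of cross products and makes \<open>{0}\<close> a generic point of the spectrum.\<close>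

locale subdomain =
  fixes C :: "'a::comm_ring_1 set"
  assumes zero_closed [simp, intro]: "0 \<in> C"
    and one_closed [simp, intro]: "1 \<in> C"
    and add_closed [simp, intro]: "a \<in> C \<Longrightarrow> b \<in> C \<Longrightarrow> a + b \<in> C"
    and mult_closed [simp, intro]: "a \<in> C \<Longrightarrow> b \<in> C \<Longrightarrow> a * b \<in> C"
    and uminus_closed [simp, intro]: "a \<in> C \<Longrightarrow> - a \<in> C"
    and no_zero_div: "a \<in> C \<Longrightarrow> b \<in> C \<Longrightarrow> a * b = 0 \<Longrightarrow> a = 0 \<or> b = 0"
begin

lemma diff_closed [simp, intro]: "a \<in> C \<Longrightarrow> b \<in> C \<Longrightarrow> a - b \<in> C"
  using add_closed[of a "- b"] by simp

lemma power_closed [simp, intro]: "a \<in> C \<Longrightarrow> a ^ n \<in> C"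
  by (induction n) auto

lemma mult_right_cancel: "a \<in> C \<Longrightarrow> b \<in> C \<Longrightarrow> c \<in> C \<Longrightarrow> c \<noteq> 0 \<Longrightarrow> a * c = b * c \<longleftrightarrow> a = b"
  using no_zero_div[of "a - b" c] by (auto simp: algebra_simps)

lemma power_nonzero: "a \<in> C \<Longrightarrow> a \<noteq> 0 \<Longrightarrow> a ^ n \<noteq> 0"
  by (induction n) (use no_zero_div in auto)

lemma cring: "cring (ring_on C)"
proof (rule cringI)
  show "abelian_group (ring_on C)"
    by (rule abelian_groupI) (auto simp: algebra_simps intro: bexI[of _ "- _"])
  show "comm_monoid (ring_on C)"
    by (rule comm_monoidI) (auto simp: algebra_simps)
qed (auto simp: algebra_simps)

lemma a_minus_eq [simp]:
  assumes "a \<in> C" "b \<in> C"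
  shows "a \<ominus>\<^bsub>ring_on C\<^esub> b = a - b"
proof -
  interpret cring "ring_on C" by (rule cring)
  have "\<ominus>\<^bsub>ring_on C\<^esub> b = - b"
    using minus_equality[of "- b" b] assms by simp
  then show ?thesis by (simp add: a_minus_def)
qed

section \<open>Prime ideals and fractions\<close>

lemma Spec_iff:
  "p \<in> Spec (ring_on C) \<longleftrightarrow>
     p \<subseteq> C \<and> 0 \<in> p \<and> (\<forall>a\<in>p. \<forall>b\<in>p. a + b \<in> p) \<and> (\<forall>a\<in>p. \<forall>c\<in>C. c * a \<in> p) \<and> 1 \<notin> p \<and>
     (\<forall>a\<in>C. \<forall>b\<in>C. a * b \<in> p \<longrightarrow> a \<in> p \<or> b \<in> p)" (is "_ \<longleftrightarrow> ?R")
proof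
  assume "p \<in> Spec (ring_on C)"
  then interpret primeideal p "ring_on C" by (simp add: Spec_def)
  have 1: "p \<subseteq> C" using a_subset by simp
  have 2: "0 \<in> p" using additive_subgroup.zero_closed[OF additive_subgroup_axioms] by simp
  have 3: "a + b \<in> p" if "a \<in> p" "b \<in> p" for a b using additive_subgroup.a_closed[OF additive_subgroup_axioms, of a b] that by simp
  have 4: "c * a \<in> p" if "a \<in> p" "c \<in> C" for a c using I_l_closed[of a c] that by simp
  have 5: "1 \<notin> p" using I_notcarr one_imp_carrier by auto
  have 6: "a \<in> p \<or> b \<in> p" if "a \<in> C" "b \<in> C" "a * b \<in> p" for a b using I_prime[of a b] that by simp
  show ?R using 1 2 5 by (intro conjI ballI impI) (simp_all add: 3 4 6)
next
  assume R: ?R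
  then have neg: "- a \<in> p" if "a \<in> p" for a
    using that uminus_closed[OF one_closed] by (metis mult_minus1)
  have "primeideal p (ring_on C)"
  proof (rule primeidealI[OF idealI[OF cring.axioms(1)[OF cring]] cring])
    show "subgroup p (add_monoid (ring_on C))"
    proof (rule group.subgroupI)
      show "Group.group (add_monoid (ring_on C))"
        using abelian_group.a_group[OF ring.is_abelian_group[OF cring.axioms(1)[OF cring]]] .
      show "inv\<^bsub>add_monoid (ring_on C)\<^esub> a \<in> p" if "a \<in> p" for a
      proof -
        have "\<ominus>\<^bsub>ring_on C\<^esub> a = - a"
          using a_minus_eq[of 0 a] that R cring.cring_simprules(14)[OF cring, of 0]
            abelian_group.minus_equality[OF ring.is_abelian_group[OF cring.axioms(1)[OF cring]], of "- a" a]
          by auto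
        then show ?thesis using neg[OF that] by (simp add: a_inv_def)
      qed
    qed (use R in auto)
  qed (use R in \<open>auto simp: mult.commute\<close>)
  then show "p \<in> Spec (ring_on C)" by (simp add: Spec_def)
qed

lemma
  assumes "p \<in> Spec (ring_on C)"
  shows Spec_subset: "p \<subseteq> C" and Spec_zero: "0 \<in> p"
    and Spec_add: "a \<in> p \<Longrightarrow> b \<in> p \<Longrightarrow> a + b \<in> p"
    and Spec_mult: "a \<in> p \<Longrightarrow> c \<in> C \<Longrightarrow> c * a \<in> p"
    and Spec_one: "1 \<notin> p"
    and Spec_prime: "a \<in> C \<Longrightarrow> b \<in> C \<Longrightarrow> a * b \<in> p \<longleftrightarrow> a \<in> p \<or> b \<in> p"
  using assms unfolding Spec_iff by (blast, blast, blast, blast, blast, metis mult.commute)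

lemma Spec_power:
  assumes "p \<in> Spec (ring_on C)" "a \<in> C" "a \<notin> p"
  shows "a ^ n \<notin> p"
  by (induction n) (use assms Spec_one Spec_prime in auto)

lemma generic [simp, intro]: "{0} \<in> Spec (ring_on C)"
  using no_zero_div by (auto simp: Spec_iff)

lemma fraction_eq:
  assumes "p \<in> Spec (ring_on C)" "a \<in> C" "s \<in> C" "s \<notin> p"
  shows "fraction (ring_on C) p a s = {(b, t). b \<in> C \<and> t \<in> C - p \<and> a * t = b * s}"
proof -
  have "(\<exists>w\<in>C - p. w * (a * t \<ominus>\<^bsub>ring_on C\<^esub> b * s) = 0) \<longleftrightarrow> a * t = b * s"
    if "b \<in> C" "t \<in> C" "t \<notin> p" for b t
  proof -
    have "w * (a * t - b * s) = 0 \<longleftrightarrow> a * t = b * s" if "w \<in> C" "w \<notin> p" for w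
      using no_zero_div[of w "a * t - b * s"] Spec_zero[OF assms(1)] that \<open>b \<in> C\<close> \<open>t \<in> C\<close> assms by auto
    moreover have "1 \<in> C - p" using Spec_one[OF assms(1)] by simp
    ultimately show ?thesis using that assms by (metis Diff_iff a_minus_eq mult_closed)
  qed
  then show ?thesis unfolding fraction_def ring_on_simps by blast
qed

lemma fraction_memI:
  assumes "p \<in> Spec (ring_on C)" "a \<in> C" "s \<in> C" "s \<notin> p"
  shows "(a, s) \<in> fraction (ring_on C) p a s"
  using assms by (simp add: fraction_eq)

text \<open>The right-hand side does not depend on \<open>p\<close>. Fractions that agree at
  \<open>{0}\<close> hence agree at every prime that avoids both denominators, which is why sections
  can be compared at the generic point.\<close>

lemma fraction_eq_iff:
  assumes p: "p \<in> Spec (ring_on C)" and "a \<in> C" "s \<in> C" "s \<notin> p" "b \<in> C" "t \<in> C" "t \<notin> p"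
  shows "fraction (ring_on C) p a s = fraction (ring_on C) p b t \<longleftrightarrow> a * t = b * s"
proof
  assume "fraction (ring_on C) p a s = fraction (ring_on C) p b t"
  then have "(b, t) \<in> fraction (ring_on C) p a s" using fraction_memI[of p b t] assms by simp
  then show "a * t = b * s" using assms by (simp add: fraction_eq)
next
  assume eq: "a * t = b * s"
  have nz: "s \<noteq> 0" "t \<noteq> 0" using Spec_zero[OF p] assms by auto
  have "a * y = x * s \<longleftrightarrow> b * y = x * t" if "x \<in> C" "y \<in> C" for x y
  proof -
    have "a * y = x * s \<longleftrightarrow> a * y * t = x * s * t"
      using mult_right_cancel[of "a * y" "x * s" t] that assms nz by auto
    also have "\<dots> \<longleftrightarrow> b * y * s = x * t * s"
      using eq by (metis mult.assoc mult.commute)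
    also have "\<dots> \<longleftrightarrow> b * y = x * t"
      using mult_right_cancel[of "b * y" "x * t" s] that assms nz by auto
    finally show ?thesis .
  qed
  then show "fraction (ring_on C) p a s = fraction (ring_on C) p b t"
    using assms by (auto simp: fraction_eq)
qed

text \<open>The operations of \<open>localization\<close> and the map \<open>spec_pullback\<close>
  are unions over all representatives of a fraction. Such a union collapses once its members are
  seen to be independent of the representative.\<close>

lemma fraction_UN:
  assumes p: "p \<in> Spec (ring_on C)" and "a \<in> C" "s \<in> C" "s \<notin> p"
    and "\<And>b t. b \<in> C \<Longrightarrow> t \<in> C \<Longrightarrow> t \<notin> p \<Longrightarrow> a * t = b * s \<Longrightarrow> G b t = G a s"
  shows "(\<Union>(b, t)\<in>fraction (ring_on C) p a s. G b t) = G a s"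
proof (rule SUP_eq_const)
  show "fraction (ring_on C) p a s \<noteq> {}" using fraction_memI[OF assms(1-4)] by blast
  show "(case x of (b, t) \<Rightarrow> G b t) = G a s" if "x \<in> fraction (ring_on C) p a s" for x
    using that assms(5) unfolding fraction_eq[OF assms(1-4)] by (cases x) simp
qed

lemma fraction_mult:
  assumes p: "p \<in> Spec (ring_on C)" and ab: "a \<in> C" "s \<in> C" "s \<notin> p" "b \<in> C" "t \<in> C" "t \<notin> p"
  shows "fraction (ring_on C) p a s \<otimes>\<^bsub>localization (ring_on C) p\<^esub> fraction (ring_on C) p b t =
     fraction (ring_on C) p (a * b) (s * t)"
proof -
  have inner: "(\<Union>(b', t')\<in>fraction (ring_on C) p b t. fraction (ring_on C) p (a' * b') (s' * t')) =
      fraction (ring_on C) p (a' * b) (s' * t)" if "a' \<in> C" "s' \<in> C" "s' \<notin> p" for a' s'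
  proof (rule fraction_UN[OF p ab(4-6)])
    fix b' t' assume h: "b' \<in> C" "t' \<in> C" "t' \<notin> p" "b * t' = b' * t"
    have "(a' * b') * (s' * t) = (a' * b) * (s' * t')" using h(4) by (metis mult.assoc mult.commute)
    then show "fraction (ring_on C) p (a' * b') (s' * t') = fraction (ring_on C) p (a' * b) (s' * t)"
      using h that p ab by (simp add: fraction_eq_iff Spec_prime)
  qed
  have "fraction (ring_on C) p a s \<otimes>\<^bsub>localization (ring_on C) p\<^esub> fraction (ring_on C) p b t =
    (\<Union>(a', s')\<in>fraction (ring_on C) p a s. \<Union>(b', t')\<in>fraction (ring_on C) p b t.
       fraction (ring_on C) p (a' * b') (s' * t'))"
    by (simp add: localization_def)
  also have "\<dots> = (\<Union>(b', t')\<in>fraction (ring_on C) p b t. fraction (ring_on C) p (a * b') (s * t'))"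
  proof (rule fraction_UN[OF p ab(1-3)])
    fix a' s' assume h: "a' \<in> C" "s' \<in> C" "s' \<notin> p" "a * s' = a' * s"
    have "(a' * b) * (s * t) = (a * b) * (s' * t)" using h(4) by (metis mult.assoc mult.commute)
    then have "fraction (ring_on C) p (a' * b) (s' * t) = fraction (ring_on C) p (a * b) (s * t)"
      using h p ab by (simp add: fraction_eq_iff Spec_prime)
    then show "(\<Union>(b', t')\<in>fraction (ring_on C) p b t. fraction (ring_on C) p (a' * b') (s' * t')) =
        (\<Union>(b', t')\<in>fraction (ring_on C) p b t. fraction (ring_on C) p (a * b') (s * t'))"
      using inner h ab by simp
  qed
  also have "\<dots> = fraction (ring_on C) p (a * b) (s * t)" using inner ab by simp
  finally show ?thesis .
qed

lemma fraction_add: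
  assumes p: "p \<in> Spec (ring_on C)" and ab: "a \<in> C" "s \<in> C" "s \<notin> p" "b \<in> C" "t \<in> C" "t \<notin> p"
  shows "fraction (ring_on C) p a s \<oplus>\<^bsub>localization (ring_on C) p\<^esub> fraction (ring_on C) p b t =
     fraction (ring_on C) p (a * t + b * s) (s * t)"
proof -
  have inner: "(\<Union>(b', t')\<in>fraction (ring_on C) p b t. fraction (ring_on C) p (a' * t' + b' * s') (s' * t')) =
      fraction (ring_on C) p (a' * t + b * s') (s' * t)" if "a' \<in> C" "s' \<in> C" "s' \<notin> p" for a' s'
  proof (rule fraction_UN[OF p ab(4-6)])
    fix b' t' assume h: "b' \<in> C" "t' \<in> C" "t' \<notin> p" "b * t' = b' * t"
    have "(a' * t' + b' * s') * (s' * t) = a' * t * (s' * t') + s' * s' * (b' * t)"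
      by (simp add: algebra_simps)
    also have "\<dots> = (a' * t + b * s') * (s' * t')"
      unfolding h(4)[symmetric] by (simp add: algebra_simps)
    finally show "fraction (ring_on C) p (a' * t' + b' * s') (s' * t') =
        fraction (ring_on C) p (a' * t + b * s') (s' * t)"
      using h that p ab by (simp add: fraction_eq_iff Spec_prime)
  qed
  have "fraction (ring_on C) p a s \<oplus>\<^bsub>localization (ring_on C) p\<^esub> fraction (ring_on C) p b t =
    (\<Union>(a', s')\<in>fraction (ring_on C) p a s. \<Union>(b', t')\<in>fraction (ring_on C) p b t.
       fraction (ring_on C) p (a' * t' + b' * s') (s' * t'))"
    by (simp add: localization_def)
  also have "\<dots> = (\<Union>(b', t')\<in>fraction (ring_on C) p b t. fraction (ring_on C) p (a * t' + b' * s) (s * t'))"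
  proof (rule fraction_UN[OF p ab(1-3)])
    fix a' s' assume h: "a' \<in> C" "s' \<in> C" "s' \<notin> p" "a * s' = a' * s"
    have "(a' * t + b * s') * (s * t) = t * t * (a' * s) + b * s' * (s * t)" by (simp add: algebra_simps)
    also have "\<dots> = (a * t + b * s) * (s' * t)" unfolding h(4)[symmetric] by (simp add: algebra_simps)
    finally have "fraction (ring_on C) p (a' * t + b * s') (s' * t) = fraction (ring_on C) p (a * t + b * s) (s * t)"
      using h p ab by (simp add: fraction_eq_iff Spec_prime)
    then show "(\<Union>(b', t')\<in>fraction (ring_on C) p b t. fraction (ring_on C) p (a' * t' + b' * s') (s' * t')) =
        (\<Union>(b', t')\<in>fraction (ring_on C) p b t. fraction (ring_on C) p (a * t' + b' * s) (s * t'))"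
      using inner h ab by simp
  qed
  also have "\<dots> = fraction (ring_on C) p (a * t + b * s) (s * t)" using inner ab by simp
  finally show ?thesis .
qed

lemma localization_zero: "\<zero>\<^bsub>localization (ring_on C) p\<^esub> = fraction (ring_on C) p 0 1"
  by (simp add: localization_def)

lemma fraction_in_localization:
  "a \<in> C \<Longrightarrow> s \<in> C \<Longrightarrow> s \<notin> p \<Longrightarrow> fraction (ring_on C) p a s \<in> carrier (localization (ring_on C) p)"
  by (auto simp: localization_def)

text \<open>Ideals maximal among those containing \<open>J\<close> and avoiding the powers of \<open>g\<close> are prime.\<close>

lemma prime_avoiding_powers:
  assumes J: "J \<subseteq> C" "0 \<in> J" "\<And>a b. a \<in> J \<Longrightarrow> b \<in> J \<Longrightarrow> a + b \<in> J" "\<And>a c. a \<in> J \<Longrightarrow> c \<in> C \<Longrightarrow> c * a \<in> J"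
    and g: "g \<in> C" "\<And>n. g ^ n \<notin> J"
  obtains p where "p \<in> Spec (ring_on C)" "J \<subseteq> p" "g \<notin> p"
proof -
  define \<A> where "\<A> = {I. I \<subseteq> C \<and> J \<subseteq> I \<and> (\<forall>a\<in>I. \<forall>b\<in>I. a + b \<in> I) \<and> (\<forall>a\<in>I. \<forall>c\<in>C. c * a \<in> I) \<and>
     (\<forall>n. g ^ n \<notin> I)}"
  have \<A>I: "I \<in> \<A>" if "I \<subseteq> C" "J \<subseteq> I" "\<And>a b. a \<in> I \<Longrightarrow> b \<in> I \<Longrightarrow> a + b \<in> I"
    "\<And>a c. a \<in> I \<Longrightarrow> c \<in> C \<Longrightarrow> c * a \<in> I" "\<And>n. g ^ n \<notin> I" for I
    using that unfolding \<A>_def by simp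
  have "\<exists>p\<in>\<A>. \<forall>I\<in>\<A>. p \<subseteq> I \<longrightarrow> I = p"
  proof (rule subset_Zorn_nonempty)
    show "\<A> \<noteq> {}" using \<A>I[OF J(1) subset_refl J(3,4) g(2)] by blast
    fix \<C> assume ne: "\<C> \<noteq> {}" and ch: "subset.chain \<A> \<C>"
    have sub: "\<C> \<subseteq> \<A>" and lin: "\<And>X Y. X \<in> \<C> \<Longrightarrow> Y \<in> \<C> \<Longrightarrow> X \<subseteq> Y \<or> Y \<subseteq> X"
      using ch by (auto simp: subset.chain_def)
    show "\<Union>\<C> \<in> \<A>"
    proof (rule \<A>I)
      show "a + b \<in> \<Union>\<C>" if ab: "a \<in> \<Union>\<C>" "b \<in> \<Union>\<C>" for a b
    proof -
      obtain X Y where "a \<in> X" "b \<in> Y" "X \<in> \<C>" "Y \<in> \<C>" using ab by blast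
      then obtain Z where "a \<in> Z" "b \<in> Z" "Z \<in> \<C>" using lin[of X Y] by blast
      moreover have "Z \<in> \<A>" using calculation sub by blast
      ultimately show ?thesis unfolding \<A>_def by blast
    qed
      show "\<Union>\<C> \<subseteq> C" "J \<subseteq> \<Union>\<C>" "\<And>n. g ^ n \<notin> \<Union>\<C>"
        "\<And>a c. a \<in> \<Union>\<C> \<Longrightarrow> c \<in> C \<Longrightarrow> c * a \<in> \<Union>\<C>"
        using sub ne unfolding \<A>_def by blast+
    qed
  qed
  then obtain p where p: "p \<in> \<A>" and max: "\<And>I. I \<in> \<A> \<Longrightarrow> p \<subseteq> I \<Longrightarrow> I = p" by blast
  have p': "p \<subseteq> C" "J \<subseteq> p" "\<And>a b. a \<in> p \<Longrightarrow> b \<in> p \<Longrightarrow> a + b \<in> p"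
    "\<And>a c. a \<in> p \<Longrightarrow> c \<in> C \<Longrightarrow> c * a \<in> p" "\<And>n. g ^ n \<notin> p"
    using p unfolding \<A>_def by simp_all
  \<comment> \<open>Here maximality enters: the ideal generated by \<open>p\<close> and
    \<open>a\<close> is strictly larger than \<open>p\<close>, hence contains a power of
    \<open>g\<close>.\<close>
  have sum_avoids: "\<exists>n c i. i \<in> p \<and> c \<in> C \<and> g ^ n = i + c * a" if a: "a \<in> C" "a \<notin> p" for a
  proof (rule ccontr)
    assume neg: "\<nexists>n c i. i \<in> p \<and> c \<in> C \<and> g ^ n = i + c * a"
    define I where "I = {i + c * a | i c. i \<in> p \<and> c \<in> C}"
    have pI: "p \<subseteq> I"
    proof
      fix i assume "i \<in> p"
      then have "i = i + 0 * a \<and> i \<in> p \<and> 0 \<in> C" by simp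
      then show "i \<in> I" unfolding I_def by blast
    qed
    have "I \<in> \<A>"
    proof (rule \<A>I)
      show "x + y \<in> I" if xy: "x \<in> I" "y \<in> I" for x y
      proof -
        obtain i c j d where "i \<in> p" "c \<in> C" "x = i + c * a" "j \<in> p" "d \<in> C" "y = j + d * a"
          using xy unfolding I_def by blast
        then have "x + y = (i + j) + (c + d) * a \<and> i + j \<in> p \<and> c + d \<in> C"
          using p' by (simp add: algebra_simps)
        then show ?thesis unfolding I_def by blast
      qed
      show "c * x \<in> I" if xc: "x \<in> I" "c \<in> C" for x c
      proof -
        obtain i d where "i \<in> p" "d \<in> C" "x = i + d * a" using xc unfolding I_def by blast
        then have "c * x = (c * i) + (c * d) * a \<and> c * i \<in> p \<and> c * d \<in> C"
          using p' xc by (simp add: distrib_left mult.assoc)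
        then show ?thesis unfolding I_def by blast
      qed
      show "I \<subseteq> C" using p'(1) a unfolding I_def by blast
      show "J \<subseteq> I" using p'(2) pI by blast
      show "g ^ n \<notin> I" for n using neg unfolding I_def by blast
    qed
    then have "I = p" using max pI by blast
    moreover have "a \<in> I"
    proof -
      have "a = 0 + 1 * a \<and> 0 \<in> p \<and> 1 \<in> C" using p'(2) J(2) by auto
      then show ?thesis unfolding I_def by blast
    qed
    ultimately show False using a by blast
  qed
  have "a \<in> p \<or> b \<in> p" if ab: "a \<in> C" "b \<in> C" "a * b \<in> p" for a b
  proof (rule ccontr)
    assume "\<not> (a \<in> p \<or> b \<in> p)"
    then obtain m c i n d j where e: "i \<in> p" "c \<in> C" "g ^ m = i + c * a" "j \<in> p" "d \<in> C" "g ^ n = j + d * b"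
      using sum_avoids ab by metis
    have iC: "i \<in> C" using e p' by blast
    \<comment> \<open>In the product of the two expressions every term has a factor
      \<open>i\<close>, \<open>j\<close> or \<open>a * b\<close>, and these lie in
      \<open>p\<close>.\<close>
    have "g ^ (m + n) = (j + d * b) * i + (c * a) * j + (c * d) * (a * b)"
      unfolding power_add e(3,6) by (simp add: algebra_simps)
    also have "\<dots> \<in> p"
      using e iC p'(3)[OF p'(3)] p'(4) add_closed mult_closed ab
        subsetD[OF p'(1) e(4)] by simp
    finally show False using p'(5) by blast
  qed
  moreover have "1 \<notin> p" using p'(5) by (metis power_0)
  moreover have "0 \<in> p" using p'(2) J(2) by blast
  ultimately have "p \<in> Spec (ring_on C)"
    unfolding Spec_iff using p'(1,3,4) by simp
  moreover have "g \<notin> p" using p'(5) by (metis power_one_right)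
  ultimately show ?thesis using that p'(2) by blast
qed

section \<open>Open sets and sections of the structure sheaf\<close>

lemma zariski_openE:
  assumes "zariski_open (ring_on C) W" "p \<in> W"
  obtains g where "g \<in> C" "g \<notin> p" "\<And>p'. p' \<in> Spec (ring_on C) \<Longrightarrow> g \<notin> p' \<Longrightarrow> p' \<in> W"
  using assms unfolding zariski_open_def by (auto 4 4)

lemma zariski_open_subset: "zariski_open (ring_on C) W \<Longrightarrow> W \<subseteq> Spec (ring_on C)"
  unfolding zariski_open_def by blast

lemma zariski_open_basic: "g \<in> C \<Longrightarrow> zariski_open (ring_on C) {p \<in> Spec (ring_on C). g \<notin> p}"
  unfolding zariski_open_def by (intro exI[of _ "{g}"]) auto

lemma zariski_open_generization:
  assumes "zariski_open (ring_on C) W" "p \<in> W" "p' \<in> Spec (ring_on C)" "p' \<subseteq> p"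
  shows "p' \<in> W"
  using assms unfolding zariski_open_def by blast

abbreviation sections :: "'a set set \<Rightarrow> ('a set \<Rightarrow> ('a \<times> 'a) set) set" where
  "sections W \<equiv> carrier (spec_sheaf (ring_on C) W)"

text \<open>Open sets are stable under generization, so the neighbourhood of \<open>p\<close> on
  which \<open>s\<close> is one fraction contains every prime inside \<open>p\<close>.\<close>

lemma section_fraction:
  assumes "s \<in> sections W" "p \<in> W" "p' \<in> Spec (ring_on C)" "p' \<subseteq> p"
  obtains a f where "a \<in> C" "f \<in> C" "f \<notin> p" "s p = fraction (ring_on C) p a f" "p' \<in> W"
    "s p' = fraction (ring_on C) p' a f"
proof -
  obtain V a f where "zariski_open (ring_on C) V" "p \<in> V" "V \<subseteq> W" "a \<in> C" "f \<in> C"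
    "\<forall>p'\<in>V. f \<notin> p' \<and> s p' = fraction (ring_on C) p' a f"
    using assms unfolding spec_sheaf_def by auto
  moreover from this have "p' \<in> V" using zariski_open_generization assms by blast
  ultimately show ?thesis by (intro that[of a f]) auto
qed

lemma section_at_generic:
  assumes s: "s \<in> sections W" and W: "W \<subseteq> Spec (ring_on C)" and p: "p \<in> W"
  obtains a f where "a \<in> C" "f \<in> C" "f \<notin> p" "s p = fraction (ring_on C) p a f"
    "{0} \<in> W" "s {0} = fraction (ring_on C) {0} a f"
proof -
  have "p \<in> Spec (ring_on C)" using W p by blast
  then have "{0} \<subseteq> p" using Spec_zero by blast
  then show thesis using section_fraction[OF s p generic] that by blast
qed

text \<open>The local fraction of \<open>s\<close> at \<open>p\<close> agrees with
  \<open>a / f\<close> at \<open>p'\<close>, and equality of cross products carries over to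
  \<open>p\<close>. This moves a fraction known at \<open>{0}\<close> to the generic point of the
  diagonal.\<close>

lemma section_from_generic:
  assumes s: "s \<in> sections W" and W: "W \<subseteq> Spec (ring_on C)" and p: "p \<in> W" "p' \<in> Spec (ring_on C)" "p' \<subseteq> p"
    and a: "a \<in> C" "f \<in> C" "f \<notin> p" "s p' = fraction (ring_on C) p' a f"
  shows "s p = fraction (ring_on C) p a f"
proof -
  have pS: "p \<in> Spec (ring_on C)" using W p by blast
  obtain b g where b: "b \<in> C" "g \<in> C" "g \<notin> p" "s p = fraction (ring_on C) p b g"
    "p' \<in> W" "s p' = fraction (ring_on C) p' b g"
    by (rule section_fraction[OF s p])
  then show ?thesis
    using fraction_eq_iff[OF p(2), of a f b g] fraction_eq_iff[OF pS, of a f b g] a p by auto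
qed

lemma section_denominator:
  assumes s: "s \<in> sections W" and W: "W \<subseteq> Spec (ring_on C)"
    and g: "g \<in> C" "g \<noteq> 0" "\<And>p. p \<in> Spec (ring_on C) \<Longrightarrow> g \<notin> p \<Longrightarrow> p \<in> W"
  obtains a n where "a \<in> C" "s {0} = fraction (ring_on C) {0} a (g ^ n)"
proof -
  have "{0} \<in> W" using g by auto
  then obtain a\<^sub>0 f\<^sub>0 where f\<^sub>0: "a\<^sub>0 \<in> C" "f\<^sub>0 \<in> C" "f\<^sub>0 \<notin> {0}" "s {0} = fraction (ring_on C) {0} a\<^sub>0 f\<^sub>0"
    by (rule section_at_generic[OF s W])
  \<comment> \<open>The ideal of denominators of the generic value. Every point of \<open>W\<close>
    has a local denominator of \<open>s\<close> outside it, which belongs to \<open>J\<close>; hence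
    no prime in \<open>W\<close> contains \<open>J\<close>.\<close>
  define J where "J = {h \<in> C. \<exists>b\<in>C. a\<^sub>0 * h = b * f\<^sub>0}"
  have "\<exists>n. g ^ n \<in> J"
  proof (rule ccontr)
    assume "\<not> (\<exists>n. g ^ n \<in> J)"
    then have "\<And>n. g ^ n \<notin> J" by blast
    moreover have "0 \<in> J" unfolding J_def by (auto intro: bexI[of _ 0])
    moreover have "x + y \<in> J" if xy: "x \<in> J" "y \<in> J" for x y
    proof -
      obtain b c where "x \<in> C" "y \<in> C" "b \<in> C" "c \<in> C" "a\<^sub>0 * x = b * f\<^sub>0" "a\<^sub>0 * y = c * f\<^sub>0"
        using xy unfolding J_def by blast
      then show ?thesis unfolding J_def by (auto intro!: bexI[of _ "b + c"] simp: algebra_simps)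
    qed
    moreover have "c * x \<in> J" if xc: "x \<in> J" "c \<in> C" for x c
    proof -
      obtain b where "x \<in> C" "b \<in> C" "a\<^sub>0 * x = b * f\<^sub>0" using xc unfolding J_def by blast
      then show ?thesis using xc unfolding J_def
        by (auto intro!: bexI[of _ "c * b"] simp: mult.assoc mult.left_commute[of a\<^sub>0])
    qed
    moreover have "J \<subseteq> C" unfolding J_def by blast
    ultimately obtain p where p: "p \<in> Spec (ring_on C)" "J \<subseteq> p" "g \<notin> p"
      using prime_avoiding_powers[of J g] g(1) by metis
    then have "p \<in> W" using g by blast
    then obtain a f where "a \<in> C" "f \<in> C" "f \<notin> p" "s {0} = fraction (ring_on C) {0} a f"
      by (rule section_at_generic[OF s W])
    then have "a\<^sub>0 * f = a * f\<^sub>0" "f \<in> C" "a \<in> C" "f \<notin> p"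
      using f\<^sub>0 fraction_eq_iff[of "{0}" a\<^sub>0 f\<^sub>0 a f] p Spec_zero[OF p(1)] by auto
    then show False using p unfolding J_def by blast
  qed
  then obtain n b where "b \<in> C" "a\<^sub>0 * g ^ n = b * f\<^sub>0" unfolding J_def by blast
  then have "s {0} = fraction (ring_on C) {0} b (g ^ n)"
    using f\<^sub>0 fraction_eq_iff[of "{0}" a\<^sub>0 f\<^sub>0 b "g ^ n"] g power_nonzero[of g n] by auto
  then show ?thesis using that \<open>b \<in> C\<close> by blast
qed

end

section \<open>Splittings on affine charts\<close>

locale subdomain_hom = dom: subdomain C + cod: subdomain D
  for C :: "'a::comm_ring_1 set" and D :: "'b::comm_ring_1 set" +
  fixes \<phi> :: "'a \<Rightarrow> 'b"
  assumes hom_closed [simp, intro]: "a \<in> C \<Longrightarrow> \<phi> a \<in> D"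
    and hom_add: "a \<in> C \<Longrightarrow> b \<in> C \<Longrightarrow> \<phi> (a + b) = \<phi> a + \<phi> b"
    and hom_mult: "a \<in> C \<Longrightarrow> b \<in> C \<Longrightarrow> \<phi> (a * b) = \<phi> a * \<phi> b"
    and hom_one [simp]: "\<phi> 1 = 1"
begin

lemma hom_zero [simp]: "\<phi> 0 = 0"
  using hom_add[of 0 0] by simp

lemma hom_power: "a \<in> C \<Longrightarrow> \<phi> (a ^ n) = \<phi> a ^ n"
  by (induction n) (auto simp: hom_mult)

lemma spec_map_eq: "spec_map (ring_on C) \<phi> P = {a \<in> C. \<phi> a \<in> P}"
  by (simp add: spec_map_def)

lemma spec_map_in_Spec:
  assumes P: "P \<in> Spec (ring_on D)"
  shows "spec_map (ring_on C) \<phi> P \<in> Spec (ring_on C)"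
  using cod.Spec_zero[OF P] cod.Spec_one[OF P]
  by (auto simp: dom.Spec_iff spec_map_eq hom_add hom_mult cod.Spec_prime[OF P] cod.Spec_add[OF P]
      intro: cod.Spec_mult[OF P])

lemma spec_map_mono: "P \<subseteq> P' \<Longrightarrow> spec_map (ring_on C) \<phi> P \<subseteq> spec_map (ring_on C) \<phi> P'"
  by (auto simp: spec_map_eq)

lemma spec_pullback_fraction:
  assumes P: "P \<in> Spec (ring_on D)" "P \<in> W"
    and af: "a \<in> C" "f \<in> C" "f \<notin> spec_map (ring_on C) \<phi> P"
    and s: "s (spec_map (ring_on C) \<phi> P) = fraction (ring_on C) (spec_map (ring_on C) \<phi> P) a f"
  shows "spec_pullback (ring_on C) (ring_on D) \<phi> W s P = fraction (ring_on D) P (\<phi> a) (\<phi> f)"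
proof -
  have "spec_pullback (ring_on C) (ring_on D) \<phi> W s P =
      (\<Union>(a, f)\<in>fraction (ring_on C) (spec_map (ring_on C) \<phi> P) a f. fraction (ring_on D) P (\<phi> a) (\<phi> f))"
    using P s by (simp add: spec_pullback_def)
  also have "\<dots> = fraction (ring_on D) P (\<phi> a) (\<phi> f)"
  proof (rule dom.fraction_UN[OF spec_map_in_Spec[OF P(1)] af])
    fix b t assume bt: "b \<in> C" "t \<in> C" "t \<notin> spec_map (ring_on C) \<phi> P" "a * t = b * f"
    have "\<phi> a * \<phi> t = \<phi> b * \<phi> f"
      using af bt by (metis hom_mult)
    then show "fraction (ring_on D) P (\<phi> b) (\<phi> t) = fraction (ring_on D) P (\<phi> a) (\<phi> f)"
      using af bt P by (subst cod.fraction_eq_iff) (auto simp: spec_map_eq)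
  qed
  finally show ?thesis .
qed

end

text \<open>The extension of \<open>\<pi>\<close> to fractions by \<open>a / F f \<mapsto> \<pi> a / f\<close>. As the ring is a domain, a section is
  determined by its value at the generic point \<open>{0}\<close>. The choice of \<open>a\<close> and \<open>f\<close> is meaningful only if this
  value has such a form, which it does for sections over preimages.\<close>

definition transfer ::
  "'a::comm_ring_1 set \<Rightarrow> ('a \<Rightarrow> 'a) \<Rightarrow> ('a \<Rightarrow> 'a) \<Rightarrow> 'a set set \<Rightarrow>
     ('a set \<Rightarrow> ('a \<times> 'a) set) \<Rightarrow> ('a set \<Rightarrow> ('a \<times> 'a) set)" where
  "transfer C F \<pi> W s = (\<lambda>p\<in>W.
     let (a, f) = SOME (a, f). a \<in> C \<and> f \<in> C \<and> f \<notin> p \<and> s {0} = fraction (ring_on C) {0} a (F f)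
     in fraction (ring_on C) p (\<pi> a) f)"

lemma transfer_cong: "s {0} = t {0} \<Longrightarrow> p \<in> W \<Longrightarrow> p \<in> V \<Longrightarrow> transfer C F \<pi> W s p = transfer C F \<pi> V t p"
  by (simp add: transfer_def)

text \<open>This is a \<open>C\<close>-linear map from \<open>C\<close>, with scalars acting through
  \<open>F\<close>, to \<open>C\<close>. As \<open>F\<close> is injective, the induced map of
  spectra fixes the generic point \<open>{0}\<close>.\<close>

locale semilinear_map = subdomain_hom C C F for C :: "'a::comm_ring_1 set" and F +
  fixes \<pi> :: "'a \<Rightarrow> 'a"
  assumes hom_inj: "a \<in> C \<Longrightarrow> F a = 0 \<Longrightarrow> a = 0"
    and map_closed [simp, intro]: "a \<in> C \<Longrightarrow> \<pi> a \<in> C"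
    and map_add: "a \<in> C \<Longrightarrow> b \<in> C \<Longrightarrow> \<pi> (a + b) = \<pi> a + \<pi> b"
    and semilinear: "a \<in> C \<Longrightarrow> b \<in> C \<Longrightarrow> \<pi> (F a * b) = a * \<pi> b"
begin

abbreviation preimage :: "'a set set \<Rightarrow> 'a set set" where
  "preimage W \<equiv> {P \<in> Spec (ring_on C). spec_map (ring_on C) F P \<in> W}"

lemma hom_nonzero: "f \<in> C \<Longrightarrow> p \<in> Spec (ring_on C) \<Longrightarrow> f \<notin> p \<Longrightarrow> F f \<noteq> 0"
  using hom_inj dom.Spec_zero by blast

lemma spec_map_generic [simp]: "spec_map (ring_on C) F {0} = {0}"
  using hom_inj by (auto simp: spec_map_eq)

text \<open>Two forms \<open>a / F f\<close> and \<open>b / F g\<close> of the generic value satisfy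
  \<open>a * F g = b * F f\<close>. Applying \<pi> turns this into
  \<open>g * \<pi> a = f * \<pi> b\<close>, so the choice made in \<open>transfer\<close> does not
  affect the result.\<close>

lemma transfer_fraction:
  assumes p: "p \<in> Spec (ring_on C)" "p \<in> W"
    and af: "a \<in> C" "f \<in> C" "f \<notin> p" "s {0} = fraction (ring_on C) {0} a (F f)"
  shows "transfer C F \<pi> W s p = fraction (ring_on C) p (\<pi> a) f"
proof -
  let ?P = "\<lambda>(a, f). a \<in> C \<and> f \<in> C \<and> f \<notin> p \<and> s {0} = fraction (ring_on C) {0} a (F f)"
  obtain b g where bg: "(SOME x. ?P x) = (b, g)" by fastforce
  have "?P (SOME x. ?P x)" using af by (intro someI[of ?P "(a, f)"]) simp
  then have b: "b \<in> C" "g \<in> C" "g \<notin> p" "s {0} = fraction (ring_on C) {0} b (F g)"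
    unfolding bg by simp_all
  have "fraction (ring_on C) {0} a (F f) = fraction (ring_on C) {0} b (F g)" using b af by simp
  then have eq: "a * F g = b * F f"
    using af b hom_nonzero[OF _ p(1)] by (subst (asm) dom.fraction_eq_iff) auto
  have "g * \<pi> a = \<pi> (F g * a)" using semilinear b af by simp
  also have "\<dots> = \<pi> (F f * b)" using eq by (simp add: mult.commute)
  also have "\<dots> = f * \<pi> b" using semilinear b af by simp
  finally have "fraction (ring_on C) p (\<pi> b) g = fraction (ring_on C) p (\<pi> a) f"
    using af b p by (subst dom.fraction_eq_iff) (auto simp: mult.commute)
  then show ?thesis using p by (simp add: transfer_def bg)
qed

lemma section_over_preimage:
  assumes W: "zariski_open (ring_on C) W" and s: "s \<in> dom.sections (preimage W)" and p: "p \<in> W"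
  obtains a f where "a \<in> C" "f \<in> C" "f \<notin> p" "s {0} = fraction (ring_on C) {0} a (F f)"
    "\<forall>p'\<in>Spec (ring_on C). f \<notin> p' \<longrightarrow> p' \<in> W"
proof -
  obtain g where g: "g \<in> C" "g \<notin> p" "\<And>p'. p' \<in> Spec (ring_on C) \<Longrightarrow> g \<notin> p' \<Longrightarrow> p' \<in> W"
    using dom.zariski_openE[OF W p] by blast
  have pS: "p \<in> Spec (ring_on C)" using dom.zariski_open_subset[OF W] p by blast
  have sub: "preimage W \<subseteq> Spec (ring_on C)" by blast
  have gs: "P \<in> preimage W" if P: "P \<in> Spec (ring_on C)" "F g \<notin> P" for P
    using g(3)[OF spec_map_in_Spec[OF P(1)]] P by (simp add: spec_map_eq)
  obtain a n where a: "a \<in> C" "s {0} = fraction (ring_on C) {0} a (F g ^ n)"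
    by (rule dom.section_denominator[OF s sub hom_closed[OF g(1)] hom_nonzero[OF g(1) pS g(2)] gs])
  \<comment> \<open>The fraction is expanded by \<open>F g\<close> so that the exponent is positive:
    for \<open>n = 0\<close> the denominator \<open>g ^ n\<close> would be \<open>1\<close>, whose
    basic open set need not lie in \<open>W\<close>.\<close>
  show ?thesis
  proof (rule that[of "a * F g" "g ^ Suc n"])
    have "F g ^ n \<noteq> 0" "F g ^ Suc n \<noteq> 0"
      using dom.power_nonzero[OF hom_closed[OF g(1)] hom_nonzero[OF g(1) pS g(2)]] by blast+
    then show "s {0} = fraction (ring_on C) {0} (a * F g) (F (g ^ Suc n))"
      unfolding a(2) hom_power[OF g(1)] using a(1) g(1) hom_closed[OF g(1)]
      by (subst dom.fraction_eq_iff) (auto simp: mult.assoc)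
    show "g ^ Suc n \<notin> p" using dom.Spec_power[OF pS g(1,2)] .
    show "\<forall>p'\<in>Spec (ring_on C). g ^ Suc n \<notin> p' \<longrightarrow> p' \<in> W"
      using g(1) by (auto intro: g(3) simp: dom.Spec_prime)
  qed (use a g in auto)
qed

lemma transfer_section:
  assumes W: "zariski_open (ring_on C) W" and s: "s \<in> dom.sections (preimage W)"
  shows "transfer C F \<pi> W s \<in> dom.sections W"
proof -
  have WS: "W \<subseteq> Spec (ring_on C)" using dom.zariski_open_subset[OF W] .
  have loc: "\<exists>V a f. zariski_open (ring_on C) V \<and> p \<in> V \<and> V \<subseteq> W \<and> a \<in> C \<and> f \<in> C \<and>
         (\<forall>p'\<in>V. f \<notin> p' \<and> transfer C F \<pi> W s p' = fraction (ring_on C) p' a f)" if p: "p \<in> W" for p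
  proof -
    obtain a f where a: "a \<in> C" "f \<in> C" "f \<notin> p" "s {0} = fraction (ring_on C) {0} a (F f)"
      "\<forall>p'\<in>Spec (ring_on C). f \<notin> p' \<longrightarrow> p' \<in> W"
      by (rule section_over_preimage[OF W s p])
    let ?V = "{p' \<in> Spec (ring_on C). f \<notin> p'}"
    have "\<forall>p'\<in>?V. f \<notin> p' \<and> transfer C F \<pi> W s p' = fraction (ring_on C) p' (\<pi> a) f"
      using a(5) by (simp add: transfer_fraction[where a = a and f = f] a(1,2,4))
    moreover have "zariski_open (ring_on C) ?V" "p \<in> ?V" "?V \<subseteq> W"
      using dom.zariski_open_basic[OF a(2)] p WS a by auto
    ultimately show ?thesis using a(1,2) map_closed by blast
  qed
  have "transfer C F \<pi> W s p \<in> carrier (localization (ring_on C) p)" if p: "p \<in> W" for p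
  proof -
    obtain V a f where "p \<in> V" "a \<in> C" "f \<in> C"
      "\<forall>p'\<in>V. f \<notin> p' \<and> transfer C F \<pi> W s p' = fraction (ring_on C) p' a f" using loc[OF p] by blast
    then show ?thesis by (auto intro: dom.fraction_in_localization)
  qed
  moreover have "transfer C F \<pi> W s \<in> extensional W" by (simp add: transfer_def)
  ultimately show ?thesis using loc by (auto simp: spec_sheaf_def PiE_iff)
qed

lemma generic_preimage:
  assumes W: "zariski_open (ring_on C) W" "p \<in> W"
  shows "{0} \<in> W" "{0} \<in> preimage W"
proof -
  have "p \<in> Spec (ring_on C)" using dom.zariski_open_subset W by blast
  then show "{0} \<in> W" using dom.zariski_open_generization[OF W] dom.Spec_zero by blast
  then show "{0} \<in> preimage W" by simp
qed

lemma transfer_add: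
  assumes W: "zariski_open (ring_on C) W"
    and s: "s \<in> dom.sections (preimage W)" and t: "t \<in> dom.sections (preimage W)"
  shows "transfer C F \<pi> W (s \<oplus>\<^bsub>spec_sheaf (ring_on C) (preimage W)\<^esub> t) =
    transfer C F \<pi> W s \<oplus>\<^bsub>spec_sheaf (ring_on C) W\<^esub> transfer C F \<pi> W t"
proof
  fix p
  show "transfer C F \<pi> W (s \<oplus>\<^bsub>spec_sheaf (ring_on C) (preimage W)\<^esub> t) p =
    (transfer C F \<pi> W s \<oplus>\<^bsub>spec_sheaf (ring_on C) W\<^esub> transfer C F \<pi> W t) p"
  proof (cases "p \<in> W")
    case p: True
    have pS: "p \<in> Spec (ring_on C)" using dom.zariski_open_subset[OF W] p by blast
    obtain a f where a: "a \<in> C" "f \<in> C" "f \<notin> p" "s {0} = fraction (ring_on C) {0} a (F f)"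
      by (rule section_over_preimage[OF W s p])
    obtain b g where b: "b \<in> C" "g \<in> C" "g \<notin> p" "t {0} = fraction (ring_on C) {0} b (F g)"
      by (rule section_over_preimage[OF W t p])
    note nz = hom_nonzero[OF a(2) pS a(3)] hom_nonzero[OF b(2) pS b(3)]
    have fg: "f * g \<notin> p" using a b pS by (simp add: dom.Spec_prime)
    have "(s \<oplus>\<^bsub>spec_sheaf (ring_on C) (preimage W)\<^esub> t) {0} =
        fraction (ring_on C) {0} (a * F g + b * F f) (F (f * g))"
      using generic_preimage(1)[OF W p] a b nz
      by (simp add: spec_sheaf_def dom.fraction_add hom_mult)
    then have "transfer C F \<pi> W (s \<oplus>\<^bsub>spec_sheaf (ring_on C) (preimage W)\<^esub> t) p =
        fraction (ring_on C) p (\<pi> (a * F g + b * F f)) (f * g)"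
      using a b fg p pS by (intro transfer_fraction) auto
    also have "\<pi> (a * F g + b * F f) = \<pi> a * g + \<pi> b * f"
      using a b semilinear[of g a] semilinear[of f b] by (simp add: map_add mult.commute)
    also have "fraction (ring_on C) p \<dots> (f * g) = 
       (transfer C F \<pi> W s \<oplus>\<^bsub>spec_sheaf (ring_on C) W\<^esub> transfer C F \<pi> W t) p"
      using transfer_fraction[of p W a f s] transfer_fraction[of p W b g t] a b p pS
      by (simp add: spec_sheaf_def dom.fraction_add)
    finally show ?thesis .
  qed (simp add: transfer_def spec_sheaf_def)
qed

lemma transfer_mult:
  assumes W: "zariski_open (ring_on C) W"
    and x: "x \<in> dom.sections W" and s: "s \<in> dom.sections (preimage W)"
  shows "transfer C F \<pi> W (spec_pullback (ring_on C) (ring_on C) F (preimage W) x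
      \<otimes>\<^bsub>spec_sheaf (ring_on C) (preimage W)\<^esub> s) =
    x \<otimes>\<^bsub>spec_sheaf (ring_on C) W\<^esub> transfer C F \<pi> W s"
proof
  fix p
  show "transfer C F \<pi> W (spec_pullback (ring_on C) (ring_on C) F (preimage W) x
      \<otimes>\<^bsub>spec_sheaf (ring_on C) (preimage W)\<^esub> s) p =
    (x \<otimes>\<^bsub>spec_sheaf (ring_on C) W\<^esub> transfer C F \<pi> W s) p"
  proof (cases "p \<in> W")
    case p: True
    have WS: "W \<subseteq> Spec (ring_on C)" using dom.zariski_open_subset[OF W] .
    then have pS: "p \<in> Spec (ring_on C)" using p by blast
    obtain a f where a: "a \<in> C" "f \<in> C" "f \<notin> p" "s {0} = fraction (ring_on C) {0} a (F f)"
      by (rule section_over_preimage[OF W s p])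
    obtain b g where b: "b \<in> C" "g \<in> C" "g \<notin> p" "x p = fraction (ring_on C) p b g"
      "{0} \<in> W" "x {0} = fraction (ring_on C) {0} b g"
      by (rule dom.section_at_generic[OF x WS p])
    note nz = hom_nonzero[OF a(2) pS a(3)] hom_nonzero[OF b(2) pS b(3)]
    have fg: "g * f \<notin> p" using a b pS by (simp add: dom.Spec_prime)
    have "spec_pullback (ring_on C) (ring_on C) F (preimage W) x {0} = fraction (ring_on C) {0} (F b) (F g)"
      using generic_preimage(2)[OF W p] b nz by (intro spec_pullback_fraction) auto
    then have "(spec_pullback (ring_on C) (ring_on C) F (preimage W) x
          \<otimes>\<^bsub>spec_sheaf (ring_on C) (preimage W)\<^esub> s) {0} =
        fraction (ring_on C) {0} (F b * a) (F (g * f))"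
      using generic_preimage(1)[OF W p] a b nz
      by (simp add: spec_sheaf_def dom.fraction_mult hom_mult)
    then have "transfer C F \<pi> W (spec_pullback (ring_on C) (ring_on C) F (preimage W) x
          \<otimes>\<^bsub>spec_sheaf (ring_on C) (preimage W)\<^esub> s) p =
        fraction (ring_on C) p (\<pi> (F b * a)) (g * f)"
      using a b fg p pS by (intro transfer_fraction) auto
    also have "\<dots> = (x \<otimes>\<^bsub>spec_sheaf (ring_on C) W\<^esub> transfer C F \<pi> W s) p"
      using transfer_fraction[of p W a f s] a b p pS
      by (simp add: spec_sheaf_def dom.fraction_mult semilinear)
    finally show ?thesis .
  qed (simp add: transfer_def spec_sheaf_def)
qed

lemma transfer_pullback:
  assumes W: "zariski_open (ring_on C) W" and x: "x \<in> dom.sections W" and one: "\<pi> 1 = 1"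
  shows "transfer C F \<pi> W (spec_pullback (ring_on C) (ring_on C) F (preimage W) x) = x"
proof
  fix p
  show "transfer C F \<pi> W (spec_pullback (ring_on C) (ring_on C) F (preimage W) x) p = x p"
  proof (cases "p \<in> W")
    case p: True
    have WS: "W \<subseteq> Spec (ring_on C)" using dom.zariski_open_subset[OF W] .
    then have pS: "p \<in> Spec (ring_on C)" using p by blast
    obtain b g where b: "b \<in> C" "g \<in> C" "g \<notin> p" "x p = fraction (ring_on C) p b g"
      "{0} \<in> W" "x {0} = fraction (ring_on C) {0} b g"
      by (rule dom.section_at_generic[OF x WS p])
    have "spec_pullback (ring_on C) (ring_on C) F (preimage W) x {0} = fraction (ring_on C) {0} (F b) (F g)"
      using generic_preimage(2)[OF W p] b hom_nonzero[OF b(2) pS b(3)] dom.Spec_zero[OF pS]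
      by (intro spec_pullback_fraction) auto
    then have "transfer C F \<pi> W (spec_pullback (ring_on C) (ring_on C) F (preimage W) x) p =
        fraction (ring_on C) p (\<pi> (F b)) g"
      using b p pS by (intro transfer_fraction) auto
    then show ?thesis using semilinear[of b 1] b one by simp
  next
    case False
    then show ?thesis using x by (auto simp: transfer_def spec_sheaf_def PiE_iff extensional_def)
  qed
qed

text \<open>A fraction \<open>a / F f\<close> over \<open>C\<close> representing the generic value
  of \<open>s\<close> has the same form over the larger ring \<open>D\<close>, so both sides are the
  fraction \<open>\<pi> a / f\<close> over \<open>D\<close>.\<close>

lemma transfer_localize:
  assumes D: "semilinear_map D F \<pi>" and CD: "C \<subseteq> D"
    and W: "zariski_open (ring_on C) W" and V: "zariski_open (ring_on D) V"
    and VW: "\<And>p. p \<in> V \<Longrightarrow> spec_map (ring_on C) id p \<in> W"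
    and s: "s \<in> dom.sections (preimage W)"
  shows "transfer D F \<pi> V (spec_pullback (ring_on C) (ring_on D) id (semilinear_map.preimage D F V) s) =
    spec_pullback (ring_on C) (ring_on D) id V (transfer C F \<pi> W s)"
proof
  interpret D: semilinear_map D F \<pi> by fact
  interpret i: subdomain_hom C D id
    using CD by unfold_locales auto
  fix p
  show "transfer D F \<pi> V (spec_pullback (ring_on C) (ring_on D) id (D.preimage V) s) p =
    spec_pullback (ring_on C) (ring_on D) id V (transfer C F \<pi> W s) p"
  proof (cases "p \<in> V")
    case p: True
    have pS: "p \<in> Spec (ring_on D)" using D.dom.zariski_open_subset[OF V] p by blast
    let ?q = "spec_map (ring_on C) id p"
    have q: "?q \<in> W" "?q \<in> Spec (ring_on C)" using VW p i.spec_map_in_Spec[OF pS] by auto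
    obtain a f where a: "a \<in> C" "f \<in> C" "f \<notin> ?q" "s {0} = fraction (ring_on C) {0} a (F f)"
      by (rule section_over_preimage[OF W s q(1)])
    have fp: "f \<notin> p" using a by (simp add: i.spec_map_eq)
    have i0: "spec_map (ring_on C) id {0} = {0}" by (auto simp: i.spec_map_eq)
    have "spec_pullback (ring_on C) (ring_on D) id (D.preimage V) s {0} = fraction (ring_on D) {0} (id a) (id (F f))"
      using D.generic_preimage(2)[OF V p] a hom_nonzero[OF a(2) q(2) a(3)]
      by (intro i.spec_pullback_fraction) (auto simp: i0)
    then have "transfer D F \<pi> V (spec_pullback (ring_on C) (ring_on D) id (D.preimage V) s) p =
        fraction (ring_on D) p (\<pi> a) f"
      using a fp p pS CD by (intro D.transfer_fraction) auto
    moreover have "spec_pullback (ring_on C) (ring_on D) id V (transfer C F \<pi> W s) p =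
        fraction (ring_on D) p (id (\<pi> a)) (id f)"
      using a p pS q by (intro i.spec_pullback_fraction) (auto simp: transfer_fraction[of _ W a f s])
    ultimately show ?thesis by simp
  qed (simp add: transfer_def spec_pullback_def)
qed

text \<open>At the generic point of the closed subscheme, which is the kernel of \<open>\<delta>\<close>, the numerator of the
  fraction is seen to vanish on the subscheme.\<close>

lemma transfer_vanishing:
  assumes \<delta>: "subdomain_hom C D \<delta>" and G: "semilinear_map D G \<rho>"
    and hom_commute: "\<And>a. a \<in> C \<Longrightarrow> \<delta> (F a) = G (\<delta> a)"
    and map_commute: "\<And>a. a \<in> C \<Longrightarrow> \<delta> (\<pi> a) = \<rho> (\<delta> a)"
    and W: "zariski_open (ring_on C) W" and s: "s \<in> dom.sections (preimage W)"
    and p: "p \<in> Spec (ring_on D)" "spec_map (ring_on C) \<delta> p \<in> W" "p \<in> V"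
    and U: "\<And>P. P \<in> Spec (ring_on D) \<Longrightarrow> spec_map (ring_on C) \<delta> P \<in> preimage W \<Longrightarrow> P \<in> U"
    and van: "\<And>P. P \<in> U \<Longrightarrow> spec_pullback (ring_on C) (ring_on D) \<delta> U s P = fraction (ring_on D) P 0 1"
  shows "spec_pullback (ring_on C) (ring_on D) \<delta> V (transfer C F \<pi> W s) p = fraction (ring_on D) p 0 1"
proof -
  interpret \<delta>: subdomain_hom C D \<delta> by fact
  interpret G: semilinear_map D G \<rho> by fact
  let ?q = "spec_map (ring_on C) \<delta> p"
  let ?K = "spec_map (ring_on C) \<delta> {0}"
  have q: "?q \<in> Spec (ring_on C)" using \<delta>.spec_map_in_Spec[OF p(1)] .
  have K: "?K \<in> Spec (ring_on C)" using \<delta>.spec_map_in_Spec by blast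
  \<comment> \<open>To evaluate \<open>s\<close> at \<open>?K\<close>, this prime must lie in
    \<open>preimage W\<close>: it is a generization of \<open>?q\<close>, and \<open>F\<close> fixes
    it because \<open>G\<close> is injective.\<close>
  have "?K \<subseteq> ?q" using \<delta>.cod.Spec_zero[OF p(1)] by (intro \<delta>.spec_map_mono) simp
  then have "?K \<in> W" using dom.zariski_open_generization[OF W p(2) K] by blast
  moreover have "\<delta> (F a) = 0 \<longleftrightarrow> \<delta> a = 0" if "a \<in> C" for a
    using G.hom_inj[of "\<delta> a"] hom_commute[OF that] that by auto
  then have "spec_map (ring_on C) F ?K = ?K"
    by (auto simp: spec_map_eq \<delta>.spec_map_eq)
  ultimately have KW: "?K \<in> preimage W" using K by simp
  obtain a f where a: "a \<in> C" "f \<in> C" "f \<notin> ?q" "s {0} = fraction (ring_on C) {0} a (F f)"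
    by (rule section_over_preimage[OF W s p(2)])
  have fp: "\<delta> f \<notin> p" "\<delta> f \<noteq> 0" using a \<delta>.cod.Spec_zero[OF p(1)] by (auto simp: \<delta>.spec_map_eq)
  then have nz: "\<delta> (F f) \<noteq> 0" using G.hom_inj[of "\<delta> f"] a by (auto simp: hom_commute)
  then have "F f \<notin> ?K" by (simp add: \<delta>.spec_map_eq)
  moreover have "s ?K = fraction (ring_on C) ?K a (F f)"
  proof (rule dom.section_from_generic[OF s _ KW dom.generic])
    show "{0} \<subseteq> ?K" by (simp add: \<delta>.spec_map_eq)
  qed (use a \<open>F f \<notin> ?K\<close> in auto)
  ultimately have "spec_pullback (ring_on C) (ring_on D) \<delta> U s {0} = fraction (ring_on D) {0} (\<delta> a) (\<delta> (F f))"
    using a U KW by (intro \<delta>.spec_pullback_fraction) auto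
  then have "fraction (ring_on D) {0} (\<delta> a) (\<delta> (F f)) = fraction (ring_on D) {0} 0 1"
    using van[OF U[OF _ KW]] by auto
  then have "\<delta> a = 0" using a nz by (subst (asm) \<delta>.cod.fraction_eq_iff) auto
  moreover have "\<rho> 0 = 0" using G.map_add[of 0 0] by simp
  ultimately have "\<delta> (\<pi> a) = 0" using a map_commute by simp
  have "spec_pullback (ring_on C) (ring_on D) \<delta> V (transfer C F \<pi> W s) p =
      fraction (ring_on D) p (\<delta> (\<pi> a)) (\<delta> f)"
    using a p q by (intro \<delta>.spec_pullback_fraction) (auto simp: transfer_fraction[of _ W a f s])
  also have "\<dots> = fraction (ring_on D) p 0 1"
    using p a fp \<delta>.cod.Spec_one[OF p(1)] \<open>\<delta> (\<pi> a) = 0\<close> by (subst \<delta>.cod.fraction_eq_iff) auto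
  finally show ?thesis .
qed

end

section \<open>Localization at one element\<close>

lemma spec_map_id: "spec_map (ring_on C) id r = C \<inter> r"
  by (auto simp: spec_map_def)

text \<open>\<open>D\<close> is the localization of \<open>C\<close> at \<open>x\<close>, realized
  inside the same ambient ring with \<open>y\<close> as the inverse of \<open>x\<close>.\<close>

locale principal_localization = base: subdomain C + loc: subdomain D for C D :: "'a::comm_ring_1 set" +
  fixes x y :: 'a
  assumes subring: "C \<subseteq> D"
    and x_in: "x \<in> C" and y_in: "y \<in> D" and inverse: "x * y = 1"
    and denominator: "d \<in> D \<Longrightarrow> \<exists>n. x ^ n * d \<in> C"
begin

lemma x_notin: "r \<in> Spec (ring_on D) \<Longrightarrow> x \<notin> r"
  using loc.Spec_mult[of r x y] loc.Spec_one[of r] inverse y_in by (auto simp: mult.commute)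

lemma power_mult_mem_iff:
  "r \<in> Spec (ring_on D) \<Longrightarrow> d \<in> D \<Longrightarrow> x ^ n * d \<in> r \<longleftrightarrow> d \<in> r"
  using loc.Spec_prime[of r "x ^ n" d] loc.Spec_power[of r x n] x_notin x_in subring by auto

lemma Spec_eqI:
  assumes r: "r \<in> Spec (ring_on D)" and s: "s \<in> Spec (ring_on D)" and eq: "C \<inter> r = C \<inter> s"
  shows "r = s"
proof -
  have "d \<in> r \<longleftrightarrow> d \<in> s" if d: "d \<in> D" for d
  proof -
    obtain n where "x ^ n * d \<in> C" using denominator[OF d] by blast
    then have "x ^ n * d \<in> r \<longleftrightarrow> x ^ n * d \<in> s" using eq by blast
    then show ?thesis using power_mult_mem_iff[OF r d] power_mult_mem_iff[OF s d] by blast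
  qed
  then show ?thesis using loc.Spec_subset[OF r] loc.Spec_subset[OF s] by blast
qed

text \<open>The prime sought consists of the elements that some power of \<open>x\<close> carries
  into \<open>p\<close>. Together with \<open>Spec_eqI\<close> this identifies the spectrum of
  \<open>D\<close> with the set of primes of \<open>C\<close> that avoid \<open>x\<close>.\<close>

lemma Spec_lift:
  assumes p: "p \<in> Spec (ring_on C)" and xp: "x \<notin> p"
  obtains r where "r \<in> Spec (ring_on D)" "C \<inter> r = p"
proof
  let ?r = "{d \<in> D. \<exists>n. x ^ n * d \<in> p}"
  have xn: "x ^ n \<in> C" "x ^ n \<notin> p" for n
    using x_in base.Spec_power[OF p x_in xp] by auto
  have up: "x ^ m * (x ^ n * d) \<in> p" if "x ^ n * d \<in> p" for m n d
    using base.Spec_mult[OF p that] xn by blast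
  show "C \<inter> ?r = p"
  proof (intro equalityI subsetI)
    fix d assume "d \<in> C \<inter> ?r"
    then obtain n where "d \<in> C" "x ^ n * d \<in> p" by blast
    then show "d \<in> p" using base.Spec_prime[OF p xn(1)] xn(2) by blast
  next
    fix d assume d: "d \<in> p"
    then have "x ^ 0 * d \<in> p" by simp
    then show "d \<in> C \<inter> ?r" using d base.Spec_subset[OF p] subring by blast
  qed
  show "?r \<in> Spec (ring_on D)"
    unfolding loc.Spec_iff
  proof (intro conjI ballI impI)
    show "0 \<in> ?r" using base.Spec_zero[OF p] by simp
    show "1 \<notin> ?r" using xn by simp
    show "a + b \<in> ?r" if ab: "a \<in> ?r" "b \<in> ?r" for a b
    proof -
      obtain m n where mn: "x ^ m * a \<in> p" "x ^ n * b \<in> p" using ab by blast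
      have "x ^ n * (x ^ m * a) + x ^ m * (x ^ n * b) \<in> p"
        using up mn base.Spec_add[OF p] by blast
      then have "x ^ (n + m) * (a + b) \<in> p" by (simp add: power_add algebra_simps)
      then show ?thesis using ab by blast
    qed
    show "c * a \<in> ?r" if ac: "a \<in> ?r" "c \<in> D" for a c
    proof -
      obtain m n where mn: "x ^ m * a \<in> p" "x ^ n * c \<in> C" using ac denominator by blast
      have "(x ^ n * c) * (x ^ m * a) \<in> p" using base.Spec_mult[OF p mn] .
      then have "x ^ (n + m) * (c * a) \<in> p" by (simp add: power_add mult_ac)
      then show ?thesis using ac by blast
    qed
    show "a \<in> ?r \<or> b \<in> ?r" if ab: "a \<in> D" "b \<in> D" "a * b \<in> ?r" for a b
    proof -
      obtain l where l: "x ^ l * (a * b) \<in> p" using ab(3) by blast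
      obtain m n where *: "x ^ m * a \<in> C" "x ^ n * b \<in> C"
        using denominator[OF ab(1)] denominator[OF ab(2)] by blast
      have "x ^ (m + n) * (x ^ l * (a * b)) \<in> p" using up[OF l] .
      then have "x ^ l * ((x ^ m * a) * (x ^ n * b)) \<in> p" by (simp add: power_add mult_ac)
      then have "(x ^ m * a) * (x ^ n * b) \<in> p"
        using base.Spec_prime[OF p xn(1), of "(x ^ m * a) * (x ^ n * b)"] xn(2) * base.mult_closed by blast
      then have "x ^ m * a \<in> p \<or> x ^ n * b \<in> p" using base.Spec_prime[OF p *] by blast
      then show ?thesis using ab by blast
    qed
  qed blast
qed

end

section \<open>Monomial maps of Laurent polynomials\<close>

lemma additive_zero:
  fixes \<phi> :: "'a::ab_group_add \<Rightarrow> 'b::ab_group_add"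
  assumes "\<And>f g. \<phi> (f + g) = \<phi> f + \<phi> g"
  shows "\<phi> 0 = 0"
  using assms[of 0 0] by simp

lemma poly_mapping_keys_induct [consumes 1, case_names zero single add]:
  fixes f :: "'a \<Rightarrow>\<^sub>0 'b::ab_group_add"
  assumes "Poly_Mapping.keys f \<subseteq> S"
    and zero: "P 0"
    and single: "\<And>u c. u \<in> S \<Longrightarrow> P (Poly_Mapping.single u c)"
    and add: "\<And>g h. P g \<Longrightarrow> P h \<Longrightarrow> P (g + h)"
  shows "P f"
  using assms(1)
proof (induction "card (Poly_Mapping.keys f)" arbitrary: f)
  case 0
  then have "f = 0" by simp
  then show ?case using zero by simp
next
  case (Suc n)
  then obtain u where u: "u \<in> Poly_Mapping.keys f" by fastforce
  define g where "g = f - Poly_Mapping.single u (Poly_Mapping.lookup f u)"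
  have "Poly_Mapping.keys g = Poly_Mapping.keys f - {u}"
    by (auto simp: g_def in_keys_iff lookup_minus lookup_single when_def split: if_splits)
  then have "P g" using Suc.hyps(2) Suc.prems u by (intro Suc.hyps(1)) auto
  then have "P (g + Poly_Mapping.single u (Poly_Mapping.lookup f u))"
    using add single u Suc.prems by blast
  then show ?case by (simp add: g_def)
qed

text \<open>Identities are checked on monomials; \<open>S\<close> makes membership of the exponents
  in the dual lattice available there.\<close>

lemma additive_eqI:
  fixes \<phi> \<psi> :: "('a \<Rightarrow>\<^sub>0 'k::ab_group_add) \<Rightarrow> 'b::ab_group_add"
  assumes "Poly_Mapping.keys f \<subseteq> S"
    and "\<And>f g. \<phi> (f + g) = \<phi> f + \<phi> g" "\<And>f g. \<psi> (f + g) = \<psi> f + \<psi> g"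
    and "\<And>u c. u \<in> S \<Longrightarrow> \<phi> (Poly_Mapping.single u c) = \<psi> (Poly_Mapping.single u c)"
  shows "\<phi> f = \<psi> f"
  using assms(1)
proof (induction rule: poly_mapping_keys_induct)
  case zero
  show ?case using additive_zero[of \<phi>] additive_zero[of \<psi>] assms(2,3) by simp
qed (use assms in auto)

text \<open>The value \<open>None\<close> marks exponents whose monomials are sent to zero. Ring
  homomorphisms \<open>comonomial L\<close> and semilinear maps are both of this form.\<close>

definition monomial_map :: "('a \<Rightarrow> 'b option) \<Rightarrow> ('a \<Rightarrow>\<^sub>0 'k::comm_monoid_add) \<Rightarrow> ('b \<Rightarrow>\<^sub>0 'k)" where
  "monomial_map E f = (\<Sum>u\<in>Poly_Mapping.keys f.
     case E u of None \<Rightarrow> 0 | Some w \<Rightarrow> Poly_Mapping.single w (Poly_Mapping.lookup f u))"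

lemma monomial_map_zero [simp]: "monomial_map E 0 = 0"
  by (simp add: monomial_map_def)

lemma monomial_map_superset:
  assumes "finite S" "Poly_Mapping.keys f \<subseteq> S"
  shows "monomial_map E f = (\<Sum>u\<in>S. case E u of None \<Rightarrow> 0 | Some w \<Rightarrow> Poly_Mapping.single w (Poly_Mapping.lookup f u))"
  unfolding monomial_map_def using assms
  by (intro sum.mono_neutral_left) (auto simp: in_keys_iff split: option.splits)

lemma monomial_map_add: "monomial_map E (f + g) = monomial_map E f + monomial_map E g"
proof -
  let ?S = "Poly_Mapping.keys f \<union> Poly_Mapping.keys g"
  have *: "Poly_Mapping.keys (f + g) \<subseteq> ?S" using keys_add .
  show ?thesis
    by (subst (1 2 3) monomial_map_superset[of ?S])
      (use * in \<open>auto simp: sum.distrib[symmetric] lookup_add single_add split: option.splits intro!: sum.cong\<close>)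
qed

lemma monomial_map_single:
  "monomial_map E (Poly_Mapping.single u c) =
     (case E u of None \<Rightarrow> 0 | Some w \<Rightarrow> Poly_Mapping.single w c)"
  by (subst monomial_map_superset[of "{u}"]) (auto split: option.splits)

lemma keys_monomial_map:
  assumes "w \<in> Poly_Mapping.keys (monomial_map E f)"
  obtains u where "u \<in> Poly_Mapping.keys f" "E u = Some w"
proof -
  obtain u where u: "u \<in> Poly_Mapping.keys f"
    "w \<in> Poly_Mapping.keys (case E u of None \<Rightarrow> 0 | Some w \<Rightarrow> Poly_Mapping.single w (Poly_Mapping.lookup f u))"
  proof -
    have "Poly_Mapping.lookup (monomial_map E f) w \<noteq> 0" using assms by (simp add: in_keys_iff)
    then have "(\<Sum>u\<in>Poly_Mapping.keys f. Poly_Mapping.lookup (case E u of None \<Rightarrow> 0 | Some w \<Rightarrow> Poly_Mapping.single w (Poly_Mapping.lookup f u)) w) \<noteq> 0"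
      by (simp add: monomial_map_def lookup_sum)
    then show thesis using that by (metis (no_types, lifting) in_keys_iff sum.neutral)
  qed
  then show ?thesis using that by (auto split: option.splits if_splits)
qed

lemma comonomial_eq: "comonomial L = monomial_map (\<lambda>u. Some (u \<circ> L))"
  by (simp add: fun_eq_iff comonomial_def monomial_map_def)

lemma comonomial_add: "comonomial L (f + g) = comonomial L f + comonomial L g"
  by (simp add: comonomial_eq monomial_map_add)

lemma comonomial_single [simp]:
  "comonomial L (Poly_Mapping.single u c) = Poly_Mapping.single (u \<circ> L) c"
  by (simp add: comonomial_eq monomial_map_single)

lemma comonomial_one [simp]:
  fixes L :: "'v \<Rightarrow> 'w"
  shows "comonomial L 1 = 1"
proof -
  have "(0 :: 'w \<Rightarrow> real) \<circ> L = 0" by (simp add: fun_eq_iff)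
  then show ?thesis by (simp flip: single_one)
qed

lemma comonomial_mult: "comonomial L (f * g) = comonomial L f * comonomial L g"
proof (rule additive_eqI[of f UNIV])
  fix u c
  show "comonomial L (Poly_Mapping.single u c * g) = comonomial L (Poly_Mapping.single u c) * comonomial L g"
  proof (rule additive_eqI[of g UNIV])
    fix w d
    have "(u + w) \<circ> L = (u \<circ> L) + (w \<circ> L)" by (simp add: fun_eq_iff)
    then show "comonomial L (Poly_Mapping.single u c * Poly_Mapping.single w d) =
        comonomial L (Poly_Mapping.single u c) * comonomial L (Poly_Mapping.single w d)"
      by (simp add: mult_single)
  qed (simp_all add: comonomial_add distrib_left distrib_right)
qed (simp_all add: comonomial_add distrib_left distrib_right)

text \<open>For surjective \<open>L\<close> the map \<open>u \<mapsto> u \<circ> L\<close> is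
  injective, so distinct monomials stay distinct and no coefficients are merged.\<close>

lemma comonomial_eq_zero:
  fixes L :: "'v \<Rightarrow> 'w" and f :: "('w, 'k::field) laurent"
  assumes "surj L" "comonomial L f = 0"
  shows "f = 0"
proof (rule poly_mapping_eqI)
  fix u :: "'w \<Rightarrow> real"
  have inj: "w \<circ> L = u \<circ> L \<longleftrightarrow> w = u" for w :: "'w \<Rightarrow> real"
    using assms(1) by (metis fun.inj_map_strong comp_surj surj_fun_eq)
  have "0 = Poly_Mapping.lookup (comonomial L f) (u \<circ> L)" using assms by simp
  also have "\<dots> = (\<Sum>w\<in>Poly_Mapping.keys f. if w = u then Poly_Mapping.lookup f w else 0)"
    by (simp add: comonomial_def lookup_sum lookup_single when_def inj)
  also have "\<dots> = Poly_Mapping.lookup f u" by (simp add: in_keys_iff)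
  finally show "Poly_Mapping.lookup f u = Poly_Mapping.lookup 0 u" by simp
qed

text \<open>The pair \<open>a\<close>, \<open>b\<close> is found by maximizing the values at one point of \<open>X\<close> after the other.\<close>

lemma unique_sum_on:
  fixes A B :: "('v \<Rightarrow> real) set"
  assumes "finite X" "finite A" "finite B" "A \<noteq> {}" "B \<noteq> {}"
  shows "\<exists>a\<in>A. \<exists>b\<in>B. \<forall>a'\<in>A. \<forall>b'\<in>B. a + b = a' + b' \<longrightarrow> (\<forall>x\<in>X. a x = a' x \<and> b x = b' x)"
  using assms
proof (induction X arbitrary: A B)
  case empty
  then show ?case by auto
next
  case (insert x X)
  define A' where "A' = {a \<in> A. \<forall>a'\<in>A. a' x \<le> a x}"
  define B' where "B' = {b \<in> B. \<forall>b'\<in>B. b' x \<le> b x}"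
  have "\<exists>a\<in>A. \<forall>a'\<in>A. a' x \<le> a x" if A: "finite A" "A \<noteq> {}" for A :: "('v \<Rightarrow> real) set"
  proof -
    have "Max ((\<lambda>a. a x) ` A) \<in> (\<lambda>a. a x) ` A" using A by (intro Max_in) auto
    then obtain a where "a \<in> A" "a x = Max ((\<lambda>a. a x) ` A)" by auto
    moreover from this have "a' x \<le> a x" if "a' \<in> A" for a' using that A by simp
    ultimately show ?thesis by blast
  qed
  then have "A' \<noteq> {}" "B' \<noteq> {}" "finite A'" "finite B'" using insert.prems by (auto simp: A'_def B'_def)
  then obtain a b where ab: "a \<in> A'" "b \<in> B'"
    "\<forall>a'\<in>A'. \<forall>b'\<in>B'. a + b = a' + b' \<longrightarrow> (\<forall>x\<in>X. a x = a' x \<and> b x = b' x)"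
    using insert.IH[of A' B'] by blast
  have agree: "\<forall>y\<in>insert x X. a y = a' y \<and> b y = b' y" if h: "a' \<in> A" "b' \<in> B" "a + b = a' + b'" for a' b'
  proof -
    \<comment> \<open>Both \<open>a x\<close> and \<open>b x\<close> are maximal, so equality of the
      sums forces equality of the summands at \<open>x\<close>.\<close>
    have "a x + b x = a' x + b' x" using h(3) by (metis plus_fun_apply)
    moreover have "a' x \<le> a x" "b' x \<le> b x" using ab h by (auto simp: A'_def B'_def)
    ultimately have x: "a' x = a x" "b' x = b x" by linarith+
    then have "a' \<in> A'" "b' \<in> B'" using ab h by (auto simp: A'_def B'_def)
    then show ?thesis using ab(3) h(3) x by auto
  qed
  have "a \<in> A" "b \<in> B" using ab(1,2) by (simp_all add: A'_def B'_def)
  then show ?case by (intro bexI[of _ a] bexI[of _ b] ballI impI agree)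
qed

lemma unique_sum:
  fixes A B :: "('v \<Rightarrow> real) set"
  assumes "finite A" "finite B" "A \<noteq> {}" "B \<noteq> {}"
  obtains a b where "a \<in> A" "b \<in> B" "\<And>a' b'. a' \<in> A \<Longrightarrow> b' \<in> B \<Longrightarrow> a + b = a' + b' \<Longrightarrow> a = a' \<and> b = b'"
proof -
  \<comment> \<open>One point for each pair of distinct functions, at which they differ. Agreement
    on the finite set of these points is equality on \<open>A \<union> B\<close>.\<close>
  define pt where "pt = (\<lambda>(u, w). SOME x. (u :: 'v \<Rightarrow> real) x \<noteq> w x)"
  define X where "X = pt ` ((A \<union> B) \<times> (A \<union> B))"
  have sep: "u = w" if "u \<in> A \<union> B" "w \<in> A \<union> B" "\<forall>x\<in>X. u x = w x" for u w
  proof (rule ccontr)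
    assume "u \<noteq> w"
    then have "\<exists>x. u x \<noteq> w x" by auto
    then have "u (pt (u, w)) \<noteq> w (pt (u, w))" unfolding pt_def prod.case by (rule someI_ex)
    moreover have "pt (u, w) \<in> X" using that by (auto simp: X_def)
    ultimately show False using that by blast
  qed
  have "finite X" using assms by (simp add: X_def)
  from unique_sum_on[OF this assms] obtain a b where "a \<in> A" "b \<in> B"
    "\<forall>a'\<in>A. \<forall>b'\<in>B. a + b = a' + b' \<longrightarrow> (\<forall>x\<in>X. a x = a' x \<and> b x = b' x)" by blast
  then show ?thesis using that[of a b] sep by blast
qed

text \<open>Some exponent \<open>a + b\<close> arises from a single pair of exponents of
  \<open>f\<close> and \<open>g\<close>. Its coefficient in the product is then a product of two
  nonzero coefficients.\<close>

lemma laurent_no_zero_divisors: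
  fixes f g :: "('v \<Rightarrow> real) \<Rightarrow>\<^sub>0 'k::field"
  assumes "f * g = 0"
  shows "f = 0 \<or> g = 0"
proof (rule ccontr)
  assume "\<not> (f = 0 \<or> g = 0)"
  then have "Poly_Mapping.keys f \<noteq> {}" "Poly_Mapping.keys g \<noteq> {}" by auto
  then obtain a b where ab: "a \<in> Poly_Mapping.keys f" "b \<in> Poly_Mapping.keys g"
    "\<And>a' b'. a' \<in> Poly_Mapping.keys f \<Longrightarrow> b' \<in> Poly_Mapping.keys g \<Longrightarrow> a + b = a' + b' \<Longrightarrow> a = a' \<and> b = b'"
    using unique_sum[OF finite_keys finite_keys] by metis
  have "Poly_Mapping.lookup (f * g) (a + b) =
      (\<Sum>(u, w). Poly_Mapping.lookup f u * Poly_Mapping.lookup g w when a + b = u + w)"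
    by (simp add: times_poly_mapping.rep_eq prod_fun_unfold_prod)
  also have "\<dots> = (\<Sum>p. Poly_Mapping.lookup f a * Poly_Mapping.lookup g b when p = (a, b))"
  proof (rule Sum_any.cong)
    fix p :: "('v \<Rightarrow> real) \<times> ('v \<Rightarrow> real)"
    obtain u w where p: "p = (u, w)" by fastforce
    show "(case p of (u, w) \<Rightarrow> Poly_Mapping.lookup f u * Poly_Mapping.lookup g w when a + b = u + w) =
        (Poly_Mapping.lookup f a * Poly_Mapping.lookup g b when p = (a, b))"
    proof (cases "u \<in> Poly_Mapping.keys f \<and> w \<in> Poly_Mapping.keys g")
      case True
      then show ?thesis using ab(3)[of u w] by (auto simp: p when_def)
    next
      case False
      then show ?thesis using ab(1,2) by (auto simp: p when_def in_keys_iff)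
    qed
  qed
  also have "\<dots> = Poly_Mapping.lookup f a * Poly_Mapping.lookup g b" by simp
  also have "\<dots> \<noteq> 0" using ab(1,2) by (simp add: in_keys_iff)
  finally show False using assms by simp
qed

section \<open>Gluing of toric charts\<close>

definition chart_carrier :: "'v::real_vector set \<Rightarrow> 'v set \<Rightarrow> ('v, 'k::field) laurent set" where
  "chart_carrier N \<sigma> = {f. Poly_Mapping.keys f \<subseteq> dual_cone \<sigma> \<inter> dual_lattice N}"

lemma chart_ring_eq: "chart_ring N \<sigma> = ring_on (chart_carrier N \<sigma>)"
  by (simp add: chart_ring_def ring_on_def chart_carrier_def)

lemma dual_cone_zero [simp]: "0 \<in> dual_cone \<sigma>"
  by (simp add: dual_cone_def linear_zero zero_fun_def)

lemma dual_cone_add: "u \<in> dual_cone \<sigma> \<Longrightarrow> w \<in> dual_cone \<sigma> \<Longrightarrow> u + w \<in> dual_cone \<sigma>"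
  by (simp add: dual_cone_def plus_fun_def linear_compose_add)

lemma dual_lattice_zero [simp]: "0 \<in> dual_lattice N"
  by (simp add: dual_lattice_def linear_zero zero_fun_def)

lemma dual_lattice_add: "u \<in> dual_lattice N \<Longrightarrow> w \<in> dual_lattice N \<Longrightarrow> u + w \<in> dual_lattice N"
  by (simp add: dual_lattice_def plus_fun_def linear_compose_add)

lemma dual_lattice_uminus: "u \<in> dual_lattice N \<Longrightarrow> - u \<in> dual_lattice N"
  by (simp add: dual_lattice_def fun_Compl_def linear_compose_neg)

lemma dual_lattice_diff: "u \<in> dual_lattice N \<Longrightarrow> w \<in> dual_lattice N \<Longrightarrow> u - w \<in> dual_lattice N"
  using dual_lattice_add[OF _ dual_lattice_uminus, of u N w] by simp

lemma dual_latticeD: "u \<in> dual_lattice N \<Longrightarrow> linear u"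
  by (simp add: dual_lattice_def)

lemma dual_cone_antimono: "\<tau> \<subseteq> \<sigma> \<Longrightarrow> dual_cone \<sigma> \<subseteq> dual_cone \<tau>"
  by (auto simp: dual_cone_def)

lemma chart_carrier_single:
  "u \<in> dual_cone \<sigma> \<Longrightarrow> u \<in> dual_lattice N \<Longrightarrow> Poly_Mapping.single u c \<in> chart_carrier N \<sigma>"
  by (simp add: chart_carrier_def)

lemma chart_carrier_antimono: "\<tau> \<subseteq> \<sigma> \<Longrightarrow> chart_carrier N \<sigma> \<subseteq> chart_carrier N \<tau>"
  using dual_cone_antimono unfolding chart_carrier_def by blast

lemma subdomain_chart: "subdomain (chart_carrier N \<sigma> :: ('v::real_vector, 'k::field) laurent set)"
proof
  fix f g :: "('v, 'k) laurent"
  assume f: "f \<in> chart_carrier N \<sigma>" and g: "g \<in> chart_carrier N \<sigma>"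
  show "f + g \<in> chart_carrier N \<sigma>"
    using f g keys_add[of f g] unfolding chart_carrier_def by blast
  show "f * g \<in> chart_carrier N \<sigma>"
    using f g keys_mult[of f g] dual_cone_add dual_lattice_add unfolding chart_carrier_def by blast
  show "f = 0 \<or> g = 0" if "f * g = 0"
    using laurent_no_zero_divisors that .
next
  fix f :: "('v, 'k) laurent"
  assume "f \<in> chart_carrier N \<sigma>"
  moreover have "Poly_Mapping.keys (- f) = Poly_Mapping.keys f" by (auto simp: in_keys_iff)
  ultimately show "- f \<in> chart_carrier N \<sigma>" by (simp add: chart_carrier_def)
qed (simp_all add: chart_carrier_def)

interpretation chart: subdomain "chart_carrier N \<sigma> :: ('v::real_vector, 'k::field) laurent set" for N \<sigma>
  by (rule subdomain_chart)

lemma restrict_hom: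
  "\<tau> \<subseteq> \<sigma> \<Longrightarrow> subdomain_hom (chart_carrier N \<sigma>) (chart_carrier N \<tau> :: ('v::real_vector, 'k::field) laurent set) id"
  by unfold_locales (auto dest: subsetD[OF chart_carrier_antimono])

lemma restrict_Spec:
  assumes "r \<in> Spec (ring_on (chart_carrier N \<tau> :: ('v::real_vector, 'k::field) laurent set))" "\<tau> \<subseteq> \<sigma>"
  shows "chart_carrier N \<sigma> \<inter> r \<in> Spec (ring_on (chart_carrier N \<sigma>))"
  using subdomain_hom.spec_map_in_Spec[OF restrict_hom[OF assms(2)] assms(1)] by (simp add: spec_map_id)

text \<open>The properties of a fan on which the gluing of the charts rests. They pass to products of fans
  without recourse to generators of the cones.\<close>

locale toric =
  fixes N :: "'v::real_vector set" and \<Sigma> :: "'v set set"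
  assumes inter: "\<sigma> \<in> \<Sigma> \<Longrightarrow> \<tau> \<in> \<Sigma> \<Longrightarrow> \<sigma> \<inter> \<tau> \<in> \<Sigma>"
    and separating: "\<sigma> \<in> \<Sigma> \<Longrightarrow> \<tau> \<in> \<Sigma> \<Longrightarrow>
      \<exists>m\<in>dual_cone \<sigma> \<inter> dual_lattice N. \<sigma> \<inter> \<tau> = {v \<in> \<sigma>. m v = 0}"
    and shift: "\<sigma> \<in> \<Sigma> \<Longrightarrow> m \<in> dual_cone \<sigma> \<Longrightarrow> linear u \<Longrightarrow> (\<And>v. v \<in> \<sigma> \<Longrightarrow> m v = 0 \<Longrightarrow> 0 \<le> u v) \<Longrightarrow>
      \<exists>k::nat. \<forall>v\<in>\<sigma>. 0 \<le> of_nat k * m v + u v"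
    and zero_mem: "\<sigma> \<in> \<Sigma> \<Longrightarrow> 0 \<in> \<sigma>"
    and scaling: "\<sigma> \<in> \<Sigma> \<Longrightarrow> v \<in> \<sigma> \<Longrightarrow> 0 \<le> c \<Longrightarrow> c *\<^sub>R v \<in> \<sigma>"
begin

text \<open>On the face \<open>m\<close> vanishes, so the inverse of \<open>x^m\<close> is regular
  there. By \<open>shift\<close> a power of \<open>x^m\<close> clears the denominator of each
  monomial, and these powers are multiplied for a sum.\<close>

lemma face_localization:
  assumes \<sigma>: "\<sigma> \<in> \<Sigma>" and m: "m \<in> dual_cone \<sigma>" "m \<in> dual_lattice N"
  shows "principal_localization (chart_carrier N \<sigma>) (chart_carrier N {v \<in> \<sigma>. m v = 0})
    (Poly_Mapping.single m (1::'k::field)) (Poly_Mapping.single (- m) 1)"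
proof
  let ?F = "{v \<in> \<sigma>. m v = 0}"
  show "chart_carrier N \<sigma> \<subseteq> chart_carrier N ?F"
    by (rule chart_carrier_antimono) blast
  show "Poly_Mapping.single m 1 \<in> chart_carrier N \<sigma>"
    using m by (rule chart_carrier_single)
  have "- m \<in> dual_cone ?F"
    using dual_latticeD[OF m(2)] by (auto simp: dual_cone_def fun_Compl_def intro: linear_compose_neg)
  then show "Poly_Mapping.single (- m) 1 \<in> chart_carrier N ?F"
    using dual_lattice_uminus[OF m(2)] by (rule chart_carrier_single)
  show "Poly_Mapping.single m 1 * Poly_Mapping.single (- m) 1 = (1 :: ('v, 'k) laurent)"
    by (simp add: mult_single)
  fix f :: "('v, 'k) laurent"
  assume "f \<in> chart_carrier N ?F"
  then have "Poly_Mapping.keys f \<subseteq> dual_cone ?F \<inter> dual_lattice N" by (simp add: chart_carrier_def)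
  then show "\<exists>n. Poly_Mapping.single m 1 ^ n * f \<in> chart_carrier N \<sigma>"
  proof (induction rule: poly_mapping_keys_induct)
    case (single u c)
    then have u: "linear u" "\<And>v. v \<in> \<sigma> \<Longrightarrow> m v = 0 \<Longrightarrow> 0 \<le> u v" "u \<in> dual_lattice N"
      by (auto simp: dual_cone_def)
    obtain k :: nat where k: "\<forall>v\<in>\<sigma>. 0 \<le> of_nat k * m v + u v"
      using shift[OF \<sigma> m(1) u(1,2)] by blast
    have pow: "Poly_Mapping.single m (1::'k) ^ k * Poly_Mapping.single u c = Poly_Mapping.single ((\<lambda>v. of_nat k * m v) + u) c"
      for k
    proof (induction k)
      case 0
      have "(\<lambda>v. of_nat 0 * m v) + u = u" by (simp add: fun_eq_iff)
      then show ?case by simp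
    next
      case (Suc k)
      have "m + ((\<lambda>v. of_nat k * m v) + u) = (\<lambda>v. of_nat (Suc k) * m v) + u"
        by (simp add: fun_eq_iff algebra_simps)
      then show ?case by (simp only: power_Suc mult.assoc Suc mult_single mult_1_left)
    qed
    have kl: "(\<lambda>v. of_nat k * m v) \<in> dual_lattice N"
      using m(2) by (auto simp: dual_lattice_def intro: linear_compose_scale_right[of m "of_nat k", simplified])
    have "(\<lambda>v. of_nat k * m v) + u \<in> dual_cone \<sigma>"
      using k dual_latticeD[OF dual_lattice_add[OF kl u(3)]] by (simp add: dual_cone_def)
    then have "Poly_Mapping.single m 1 ^ k * Poly_Mapping.single u c \<in> chart_carrier N \<sigma>"
      unfolding pow using dual_lattice_add[OF kl u(3)] by (rule chart_carrier_single)
    then show ?case by blast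
  next
    case (add g h)
    then obtain n n' where n: "Poly_Mapping.single m 1 ^ n * g \<in> chart_carrier N \<sigma>"
      "Poly_Mapping.single m 1 ^ n' * h \<in> chart_carrier N \<sigma>" by blast
    have x: "Poly_Mapping.single m (1::'k) ^ j \<in> chart_carrier N \<sigma>" for j
      using chart_carrier_single[OF m] by (rule chart.power_closed)
    have "Poly_Mapping.single m 1 ^ (n + n') * (g + h) =
        Poly_Mapping.single m 1 ^ n' * (Poly_Mapping.single m 1 ^ n * g) +
        Poly_Mapping.single m 1 ^ n * (Poly_Mapping.single m 1 ^ n' * h)"
      by (simp add: power_add algebra_simps)
    also have "\<dots> \<in> chart_carrier N \<sigma>" using n x by blast
    finally show ?case by blast
  qed simp
qed

lemma glue_iff:
  "((\<sigma>, p), (\<tau>, p')) \<in> glue N \<Sigma> \<longleftrightarrow> \<sigma> \<in> \<Sigma> \<and> \<tau> \<in> \<Sigma> \<and>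
     (\<exists>r\<in>Spec (chart_ring N (\<sigma> \<inter> \<tau>)). p = chart_carrier N \<sigma> \<inter> r \<and> p' = chart_carrier N \<tau> \<inter> r)"
  using restrict_Spec[of _ N "\<sigma> \<inter> \<tau>" \<sigma>] restrict_Spec[of _ N "\<sigma> \<inter> \<tau>" \<tau>]
  unfolding glue_def chart_points_def by (auto simp: chart_ring_eq spec_map_id)

text \<open>Transitivity is the point that needs faces. In the middle chart \<tau>, the prime
  \<open>p'\<close> avoids the monomials of both overlaps, hence their product, and lifts to a prime
  \<open>t\<close> over the triple intersection. Primes of a localization are determined by their
  traces, so \<open>t\<close> restricts to both given primes \<open>r\<close> and \<open>s\<close>
  and connects the outer charts.\<close>

lemma equiv_glue: "equiv (chart_points N \<Sigma>) (glue N \<Sigma> :: ('v set \<times> ('v, 'k::field) laurent set) rel)"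
proof (rule equivI)
  show "(glue N \<Sigma> :: ('v set \<times> ('v, 'k) laurent set) rel) \<subseteq> chart_points N \<Sigma> \<times> chart_points N \<Sigma>"
    by (auto simp: glue_def)
  show "refl_on (chart_points N \<Sigma>) (glue N \<Sigma> :: ('v set \<times> ('v, 'k::field) laurent set) rel)"
  proof (rule refl_onI)
    fix x :: "'v set \<times> ('v, 'k) laurent set" assume "x \<in> chart_points N \<Sigma>"
    then obtain \<sigma> p where x: "x = (\<sigma>, p)" "\<sigma> \<in> \<Sigma>" "p \<in> Spec (chart_ring N \<sigma>)"
      by (auto simp: chart_points_def)
    moreover have "p = chart_carrier N \<sigma> \<inter> p" using x(3) chart.Spec_subset by (auto simp: chart_ring_eq)
    ultimately show "(x, x) \<in> glue N \<Sigma>" by (auto simp: glue_iff)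
  qed
  show "sym (glue N \<Sigma> :: ('v set \<times> ('v, 'k) laurent set) rel)"
  proof (rule symI)
    fix x y :: "'v set \<times> ('v, 'k) laurent set" assume "(x, y) \<in> glue N \<Sigma>"
    then show "(y, x) \<in> glue N \<Sigma>" by (cases x; cases y) (auto simp: glue_iff Int_commute)
  qed
  show "trans (glue N \<Sigma> :: ('v set \<times> ('v, 'k) laurent set) rel)"
  proof (rule transI)
    fix x y z :: "'v set \<times> ('v, 'k) laurent set"
    assume xy: "(x, y) \<in> glue N \<Sigma>" "(y, z) \<in> glue N \<Sigma>"
    obtain \<sigma> p \<tau> p' \<rho> p'' where xyz: "x = (\<sigma>, p)" "y = (\<tau>, p')" "z = (\<rho>, p'')"
      by (cases x; cases y; cases z)
    obtain r s where c: "\<sigma> \<in> \<Sigma>" "\<tau> \<in> \<Sigma>" "\<rho> \<in> \<Sigma>"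
      and r: "r \<in> Spec (chart_ring N (\<sigma> \<inter> \<tau>))" "p = chart_carrier N \<sigma> \<inter> r" "p' = chart_carrier N \<tau> \<inter> r"
      and s: "s \<in> Spec (chart_ring N (\<tau> \<inter> \<rho>))" "p' = chart_carrier N \<tau> \<inter> s" "p'' = chart_carrier N \<rho> \<inter> s"
      using xy unfolding xyz glue_iff by blast
    let ?R = "\<lambda>\<sigma>. chart_carrier N \<sigma> :: ('v, 'k) laurent set"
    obtain m where m: "m \<in> dual_cone \<tau>" "m \<in> dual_lattice N" "\<tau> \<inter> \<sigma> = {v \<in> \<tau>. m v = 0}"
      using separating[OF c(2,1)] by blast
    obtain m' where m': "m' \<in> dual_cone \<tau>" "m' \<in> dual_lattice N" "\<tau> \<inter> \<rho> = {v \<in> \<tau>. m' v = 0}"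
      using separating[OF c(2,3)] by blast
    interpret A: principal_localization "?R \<tau>" "?R (\<tau> \<inter> \<sigma>)" "Poly_Mapping.single m 1" "Poly_Mapping.single (- m) 1"
      unfolding m(3) by (rule face_localization[OF c(2) m(1,2)])
    interpret B: principal_localization "?R \<tau>" "?R (\<tau> \<inter> \<rho>)" "Poly_Mapping.single m' 1" "Poly_Mapping.single (- m') 1"
      unfolding m'(3) by (rule face_localization[OF c(2) m'(1,2)])
    \<comment> \<open>Both functionals are nonnegative on \<tau>, so their sum vanishes exactly
      where both do and cuts out the triple intersection.\<close>
    have m'': "m + m' \<in> dual_cone \<tau>" "m + m' \<in> dual_lattice N" "\<tau> \<inter> \<sigma> \<inter> \<rho> = {v \<in> \<tau>. (m + m') v = 0}"
      using dual_cone_add[OF m(1) m'(1)] dual_lattice_add[OF m(2) m'(2)]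
    proof -
      have "(m + m') v = 0 \<longleftrightarrow> m v = 0 \<and> m' v = 0" if "v \<in> \<tau>" for v
        using m(1) m'(1) that by (auto simp: dual_cone_def add_nonneg_eq_0_iff)
      then show "\<tau> \<inter> \<sigma> \<inter> \<rho> = {v \<in> \<tau>. (m + m') v = 0}" using m(3) m'(3) by blast
    qed
    interpret C: principal_localization "?R \<tau>" "?R (\<tau> \<inter> \<sigma> \<inter> \<rho>)" "Poly_Mapping.single (m + m') 1" "Poly_Mapping.single (- (m + m')) 1"
      unfolding m''(3) by (rule face_localization[OF c(2) m''(1,2)])
    have p': "p' \<in> Spec (ring_on (?R \<tau>))"
      using r(1) unfolding r(3) chart_ring_eq by (rule restrict_Spec) blast
    have "Poly_Mapping.single m 1 \<notin> p'" "Poly_Mapping.single m' 1 \<notin> p'"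
      using A.x_notin[of r] B.x_notin[of s] r s by (auto simp: chart_ring_eq Int_commute)
    moreover have "Poly_Mapping.single (m + m') 1 = Poly_Mapping.single m 1 * Poly_Mapping.single m' (1::'k)"
      by (simp add: mult_single)
    ultimately have "Poly_Mapping.single (m + m') 1 \<notin> p'"
      using chart.Spec_prime[OF p' A.x_in B.x_in] by simp
    then obtain t where t: "t \<in> Spec (ring_on (?R (\<tau> \<inter> \<sigma> \<inter> \<rho>)))" "?R \<tau> \<inter> t = p'"
      using C.Spec_lift[OF p'] by blast
    have "?R (\<tau> \<inter> \<sigma>) \<inter> t = r"
    proof (rule A.Spec_eqI)
      show "?R (\<tau> \<inter> \<sigma>) \<inter> t \<in> Spec (ring_on (?R (\<tau> \<inter> \<sigma>)))" using t(1) by (rule restrict_Spec) blast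
      show "?R \<tau> \<inter> (?R (\<tau> \<inter> \<sigma>) \<inter> t) = ?R \<tau> \<inter> r"
        using t(2) r(3) A.subring by blast
    qed (use r(1) in \<open>simp add: chart_ring_eq Int_commute\<close>)
    moreover have "?R (\<tau> \<inter> \<rho>) \<inter> t = s"
    proof (rule B.Spec_eqI)
      show "?R (\<tau> \<inter> \<rho>) \<inter> t \<in> Spec (ring_on (?R (\<tau> \<inter> \<rho>)))" using t(1) by (rule restrict_Spec) blast
      show "?R \<tau> \<inter> (?R (\<tau> \<inter> \<rho>) \<inter> t) = ?R \<tau> \<inter> s"
        using t(2) s(2) B.subring by blast
    qed (use s(1) in \<open>simp add: chart_ring_eq\<close>)
    moreover have "?R (\<sigma> \<inter> \<rho>) \<inter> t \<in> Spec (ring_on (?R (\<sigma> \<inter> \<rho>)))" using t(1) by (rule restrict_Spec) blast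
    moreover have "?R \<sigma> \<subseteq> ?R (\<sigma> \<inter> \<rho>)" "?R \<rho> \<subseteq> ?R (\<sigma> \<inter> \<rho>)" "?R \<sigma> \<subseteq> ?R (\<tau> \<inter> \<sigma>)" "?R \<rho> \<subseteq> ?R (\<tau> \<inter> \<rho>)"
      by (simp_all add: chart_carrier_antimono)
    ultimately have "p = ?R \<sigma> \<inter> (?R (\<sigma> \<inter> \<rho>) \<inter> t)" "p'' = ?R \<rho> \<inter> (?R (\<sigma> \<inter> \<rho>) \<inter> t)"
      "?R (\<sigma> \<inter> \<rho>) \<inter> t \<in> Spec (chart_ring N (\<sigma> \<inter> \<rho>))"
      using r(2) s(3) by (auto simp: chart_ring_eq)
    then show "(x, z) \<in> glue N \<Sigma>" unfolding xyz glue_iff using c by blast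
  qed
qed

end

context toric begin

lemma chart_class_restrict:
  assumes "\<sigma> \<in> \<Sigma>" "\<tau> \<in> \<Sigma>" "\<tau> \<subseteq> \<sigma>"
    and p: "p \<in> Spec (ring_on (chart_carrier N \<tau> :: ('v, 'k::field) laurent set))"
  shows "glue N \<Sigma> `` {(\<tau>, p)} = glue N \<Sigma> `` {(\<sigma>, chart_carrier N \<sigma> \<inter> p)}"
proof (rule equiv_class_eq[OF equiv_glue])
  have "\<tau> \<inter> \<sigma> = \<tau>" using assms by blast
  moreover have "p = chart_carrier N \<tau> \<inter> p" using chart.Spec_subset[OF p] by blast
  ultimately show "((\<tau>, p), (\<sigma>, chart_carrier N \<sigma> \<inter> p)) \<in> glue N \<Sigma>"
    using assms by (auto simp: glue_iff chart_ring_eq intro!: bexI[of _ p])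
qed

lemma on_chart_restrict:
  assumes "\<sigma> \<in> \<Sigma>" "\<tau> \<in> \<Sigma>" "\<tau> \<subseteq> \<sigma>" "p \<in> on_chart N \<Sigma> U \<tau>"
  shows "chart_carrier N \<sigma> \<inter> p \<in> on_chart N \<Sigma> U \<sigma>"
  using assms chart_class_restrict[OF assms(1-3), of p] restrict_Spec[of p N \<tau> \<sigma>]
  by (simp add: on_chart_def chart_ring_eq)

lemma class_in_points:
  "\<sigma> \<in> \<Sigma> \<Longrightarrow> p \<in> Spec (chart_ring N \<sigma>) \<Longrightarrow> glue N \<Sigma> `` {(\<sigma>, p)} \<in> toric_points N \<Sigma>"
  unfolding toric_points_def by (intro quotientI) (auto simp: chart_points_def)

end

section \<open>Toric morphisms on glued charts\<close>

lemma image_cone_mono: "\<tau> \<subseteq> \<sigma> \<Longrightarrow> image_cone \<Sigma>' L \<tau> \<subseteq> image_cone \<Sigma>' L \<sigma>"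
  unfolding image_cone_def by (rule Inter_anti_mono) auto

lemma image_cone_superset: "L ` \<sigma> \<subseteq> image_cone \<Sigma>' L \<sigma>"
  unfolding image_cone_def by blast

lemma image_cone_eqI:
  assumes "\<sigma>' \<in> \<Sigma>'" "L ` \<sigma> \<subseteq> \<sigma>'" "\<And>\<tau>. \<tau> \<in> \<Sigma>' \<Longrightarrow> L ` \<sigma> \<subseteq> \<tau> \<Longrightarrow> \<sigma>' \<subseteq> \<tau>"
  shows "image_cone \<Sigma>' L \<sigma> = \<sigma>'"
  unfolding image_cone_def using assms by blast

locale toric_morphism = src: toric N \<Sigma> + tgt: toric N' \<Sigma>'
  for N :: "'v::real_vector set" and \<Sigma> and N' :: "'w::real_vector set" and \<Sigma>' +
  fixes L :: "'v \<Rightarrow> 'w"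
  assumes linear: "linear L"
    and dual_lattice_comp: "u \<in> dual_lattice N' \<Longrightarrow> u \<circ> L \<in> dual_lattice N"
    and image_cone_in: "\<sigma> \<in> \<Sigma> \<Longrightarrow> image_cone \<Sigma>' L \<sigma> \<in> \<Sigma>'"
begin

abbreviation target_cone :: "'v set \<Rightarrow> 'w set" where "target_cone \<equiv> image_cone \<Sigma>' L"

lemma comonomial_closed:
  assumes "f \<in> chart_carrier N' (target_cone \<sigma>)"
  shows "comonomial L f \<in> chart_carrier N \<sigma>"
proof -
  have "u \<circ> L \<in> dual_cone \<sigma>" if "u \<in> dual_cone (target_cone \<sigma>)" for u
    using that image_cone_superset[of L \<sigma> \<Sigma>'] linear
    by (auto simp: dual_cone_def intro: linear_compose)
  then show ?thesis
    using assms dual_lattice_comp unfolding chart_carrier_def comonomial_eq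
    by (auto elim!: keys_monomial_map)
qed

lemma hom: "subdomain_hom (chart_carrier N' (target_cone \<sigma>)) (chart_carrier N \<sigma> :: ('v, 'k::field) laurent set) (comonomial L)"
  by unfold_locales (auto simp: comonomial_closed comonomial_add comonomial_mult)

abbreviation point_map :: "'v set \<Rightarrow> ('v, 'k::field) laurent set \<Rightarrow> ('w, 'k) laurent set" where
  "point_map \<sigma> \<equiv> spec_map (ring_on (chart_carrier N' (target_cone \<sigma>))) (comonomial L)"

text \<open>Two representatives of a class come from one prime \<open>r\<close> over the
  intersection of their cones, and both images are glued to the image of \<open>r\<close>. The union
  in \<open>toric_map\<close> therefore consists of a single class.\<close>

lemma toric_map_class:
  assumes \<sigma>: "\<sigma> \<in> \<Sigma>" and p: "p \<in> Spec (ring_on (chart_carrier N \<sigma> :: ('v, 'k::field) laurent set))"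
  shows "toric_map N' \<Sigma>' L (glue N \<Sigma> `` {(\<sigma>, p)}) = glue N' \<Sigma>' `` {(target_cone \<sigma>, point_map \<sigma> p)}"
  unfolding toric_map_def
proof (rule SUP_eq_const)
  have "((\<sigma>, p), (\<sigma>, p)) \<in> glue N \<Sigma>"
    using \<sigma> p chart.Spec_subset[OF p] by (auto simp: src.glue_iff chart_ring_eq)
  then show "glue N \<Sigma> `` {(\<sigma>, p)} \<noteq> {}" by blast
  fix x assume x: "x \<in> glue N \<Sigma> `` {(\<sigma>, p)}"
  obtain \<tau> p' where xp: "x = (\<tau>, p')" by fastforce
  then obtain r where r: "r \<in> Spec (ring_on (chart_carrier N (\<sigma> \<inter> \<tau>)))" "\<tau> \<in> \<Sigma>"
    "p = chart_carrier N \<sigma> \<inter> r" "p' = chart_carrier N \<tau> \<inter> r"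
    using x by (auto simp: src.glue_iff chart_ring_eq)
  interpret h: subdomain_hom "chart_carrier N' (target_cone (\<sigma> \<inter> \<tau>))" "chart_carrier N (\<sigma> \<inter> \<tau>) :: ('v, 'k) laurent set" "comonomial L"
    by (rule hom)
  have pm: "chart_carrier N' (target_cone \<rho>) \<inter> point_map (\<sigma> \<inter> \<tau>) r = point_map \<rho> (chart_carrier N \<rho> \<inter> r)"
    if "\<sigma> \<inter> \<tau> \<subseteq> \<rho>" for \<rho>
    using chart_carrier_antimono[OF image_cone_mono[OF that, of \<Sigma>' L], of N'] comonomial_closed
    by (auto simp: spec_map_def)
  have "glue N' \<Sigma>' `` {(target_cone (\<sigma> \<inter> \<tau>), point_map (\<sigma> \<inter> \<tau>) r)} = glue N' \<Sigma>' `` {(target_cone \<rho>, point_map \<rho> (chart_carrier N \<rho> \<inter> r))}"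
    if "\<sigma> \<inter> \<tau> \<subseteq> \<rho>" "\<rho> \<in> \<Sigma>" for \<rho>
    using tgt.chart_class_restrict[OF image_cone_in[OF that(2)] image_cone_in[OF src.inter[OF \<sigma> r(2)]]
        image_cone_mono[OF that(1)] h.spec_map_in_Spec[OF r(1)]] pm[OF that(1)] by simp
  from this[of \<sigma>] this[of \<tau>] show "(case x of (\<sigma>, p) \<Rightarrow> glue N' \<Sigma>' `` {(target_cone \<sigma>, spec_map (chart_ring N' (target_cone \<sigma>)) (comonomial L) p)}) =
      glue N' \<Sigma>' `` {(target_cone \<sigma>, point_map \<sigma> p)}"
    using \<sigma> r by (simp add: xp chart_ring_eq)
qed

lemma on_chart_preimage:
  assumes "\<sigma> \<in> \<Sigma>"
  shows "on_chart N \<Sigma> (toric_preimage N \<Sigma> N' \<Sigma>' L U) \<sigma> =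
    {p \<in> Spec (ring_on (chart_carrier N \<sigma> :: ('v, 'k::field) laurent set)). point_map \<sigma> p \<in> on_chart N' \<Sigma>' U (target_cone \<sigma>)}"
proof -
  interpret h: subdomain_hom "chart_carrier N' (target_cone \<sigma>)" "chart_carrier N \<sigma> :: ('v, 'k) laurent set" "comonomial L"
    by (rule hom)
  show ?thesis
    using toric_map_class[OF assms] src.class_in_points[OF assms] h.spec_map_in_Spec
    by (auto simp: on_chart_def toric_preimage_def chart_ring_eq)
qed

end

section \<open>Splittings defined on monomials\<close>

definition toric_transfer ::
  "'v::real_vector set \<Rightarrow> 'v set set \<Rightarrow> nat \<Rightarrow> (('v \<Rightarrow> real) \<Rightarrow> ('v \<Rightarrow> real) option) \<Rightarrow>
     ('v, 'k::field) toric_point set \<Rightarrow> ('v, 'k) toric_section \<Rightarrow> ('v, 'k) toric_section" where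
  "toric_transfer N \<Sigma> q E U s = (\<lambda>\<sigma>\<in>\<Sigma>.
     transfer (chart_carrier N \<sigma>) (comonomial (mult_by q)) (monomial_map E) (on_chart N \<Sigma> U \<sigma>) (s \<sigma>))"

text \<open>In terms of \<open>monomial_map E\<close>, \<open>exponent_nonneg\<close> says that
  regular functions stay regular on every chart, \<open>exponent_shift\<close> is semilinearity, and
  \<open>exponent_zero\<close> is what makes it a splitting.\<close>

locale monomial_splitting = toric N \<Sigma>
  for N :: "'v::real_vector set" and \<Sigma> +
  fixes q :: nat and E :: "('v \<Rightarrow> real) \<Rightarrow> ('v \<Rightarrow> real) option"
  assumes q_pos: "0 < q"
    and exponent_closed: "u \<in> dual_lattice N \<Longrightarrow> E u = Some w \<Longrightarrow> w \<in> dual_lattice N"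
    and exponent_nonneg: "u \<in> dual_lattice N \<Longrightarrow> E u = Some w \<Longrightarrow> \<sigma> \<in> \<Sigma> \<Longrightarrow> u \<in> dual_cone \<sigma> \<Longrightarrow> w \<in> dual_cone \<sigma>"
    and exponent_shift: "u \<in> dual_lattice N \<Longrightarrow> w \<in> dual_lattice N \<Longrightarrow>
      E ((u \<circ> mult_by q) + w) = map_option ((+) u) (E w)"
    and exponent_zero: "E 0 = Some 0"
begin

text \<open>Cones are closed under division by \<open>q\<close>. The morphism thus maps each chart
  to itself and can be studied one chart at a time.\<close>

lemma image_cone_mult: "\<sigma> \<in> \<Sigma> \<Longrightarrow> image_cone \<Sigma> (mult_by q) \<sigma> = \<sigma>"
proof (rule image_cone_eqI)
  fix \<tau> assume \<sigma>: "\<sigma> \<in> \<Sigma>" and \<tau>: "\<tau> \<in> \<Sigma>" "mult_by q ` \<sigma> \<subseteq> \<tau>"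
  show "\<sigma> \<subseteq> \<tau>"
  proof
    fix v assume "v \<in> \<sigma>"
    then have "(1 / of_nat q) *\<^sub>R (of_nat q *\<^sub>R v) \<in> \<tau>" using \<tau> by - (rule scaling, auto)
    then show "v \<in> \<tau>" using q_pos by simp
  qed
qed (auto intro: scaling)

sublocale mult: toric_morphism N \<Sigma> N \<Sigma> "mult_by q"
proof (intro toric_morphism.intro toric_morphism_axioms.intro toric_axioms)
  show "linear (mult_by q :: 'v \<Rightarrow> 'v)" by (rule linear_scaleR)
  fix u assume u: "u \<in> dual_lattice N"
  have "u \<circ> mult_by q = (\<lambda>v. of_nat q * u v)"
    using linear_scale[OF dual_latticeD[OF u]] by (simp add: fun_eq_iff)
  then show "u \<circ> mult_by q \<in> dual_lattice N"
    using u by (auto simp: dual_lattice_def intro: linear_compose_scale_right[of u "of_nat q", simplified])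
qed (simp add: image_cone_mult)

lemma semilinear:
  assumes "\<sigma> \<in> \<Sigma>"
  shows "semilinear_map (chart_carrier N \<sigma> :: ('v, 'k::field) laurent set) (comonomial (mult_by q)) (monomial_map E)"
proof -
  interpret h: subdomain_hom "chart_carrier N \<sigma>" "chart_carrier N \<sigma> :: ('v, 'k) laurent set" "comonomial (mult_by q)"
    using mult.hom[of \<sigma>] unfolding image_cone_mult[OF assms] .
  have surj: "surj (mult_by q :: 'v \<Rightarrow> 'v)"
    by (rule surjI[of _ "\<lambda>v. (1 / of_nat q) *\<^sub>R v"]) (use q_pos in simp)
  show ?thesis
  proof
    fix f :: "('v, 'k) laurent" assume f: "f \<in> chart_carrier N \<sigma>"
    show "f = 0" if "comonomial (mult_by q) f = 0" using comonomial_eq_zero[OF surj that] .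
    have "w \<in> dual_cone \<sigma> \<inter> dual_lattice N" if w: "w \<in> Poly_Mapping.keys (monomial_map E f)" for w
    proof -
      obtain u where u: "u \<in> Poly_Mapping.keys f" "E u = Some w" using w by (rule keys_monomial_map)
      then have "u \<in> dual_cone \<sigma>" "u \<in> dual_lattice N" using f by (auto simp: chart_carrier_def)
      then show ?thesis using exponent_closed exponent_nonneg[OF _ _ assms] u(2) by blast
    qed
    then show "monomial_map E f \<in> chart_carrier N \<sigma>" unfolding chart_carrier_def by blast
    fix g :: "('v, 'k) laurent" assume g: "g \<in> chart_carrier N \<sigma>"
    show "monomial_map E (comonomial (mult_by q) f * g) = f * monomial_map E g"
    \<comment> \<open>Both sides are additive in \<open>f\<close> and in \<open>g\<close>, which
      leaves two monomials and \<open>exponent_shift\<close>.\<close>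
    proof (rule additive_eqI[of f "dual_lattice N"])
      fix u :: "'v \<Rightarrow> real" and c :: 'k assume u: "u \<in> dual_lattice N"
      show "monomial_map E (comonomial (mult_by q) (Poly_Mapping.single u c) * g) = Poly_Mapping.single u c * monomial_map E g"
      proof (rule additive_eqI[of g "dual_lattice N"])
        fix w :: "'v \<Rightarrow> real" and d :: 'k assume w: "w \<in> dual_lattice N"
        show "monomial_map E (comonomial (mult_by q) (Poly_Mapping.single u c) * Poly_Mapping.single w d) =
           Poly_Mapping.single u c * monomial_map E (Poly_Mapping.single w d)"
          using exponent_shift[OF u w]
          by (simp add: mult_single monomial_map_single split: option.split)
      qed (use g in \<open>auto simp: chart_carrier_def monomial_map_add distrib_left\<close>)
    qed (use f in \<open>auto simp: chart_carrier_def monomial_map_add comonomial_add distrib_right\<close>)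
  qed (simp add: monomial_map_add)
qed

lemma monomial_map_one: "monomial_map E 1 = (1 :: ('v, 'k::field) laurent)"
  by (simp add: monomial_map_single exponent_zero flip: single_one)

lemma on_chart_F_preimage:
  "\<sigma> \<in> \<Sigma> \<Longrightarrow> on_chart N \<Sigma> (F_preimage N \<Sigma> q U) \<sigma> =
     semilinear_map.preimage (chart_carrier N \<sigma> :: ('v, 'k::field) laurent set) (comonomial (mult_by q)) (on_chart N \<Sigma> U \<sigma>)"
  using mult.on_chart_preimage[of \<sigma> U] by (simp add: image_cone_mult)

lemma open_chart:
  "toric_open N \<Sigma> U \<Longrightarrow> \<sigma> \<in> \<Sigma> \<Longrightarrow> zariski_open (ring_on (chart_carrier N \<sigma>)) (on_chart N \<Sigma> U \<sigma>)"
  by (simp add: toric_open_def chart_ring_eq)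

lemma toric_sheaf_carrier:
  "s \<in> carrier (toric_sheaf N \<Sigma> U) \<longleftrightarrow>
     s \<in> (\<Pi>\<^sub>E \<sigma>\<in>\<Sigma>. carrier (spec_sheaf (chart_ring N \<sigma>) (on_chart N \<Sigma> U \<sigma>))) \<and>
     (\<forall>\<sigma>\<in>\<Sigma>. \<forall>\<tau>\<in>\<Sigma>. \<tau> \<subseteq> \<sigma> \<longrightarrow>
       s \<tau> = spec_pullback (chart_ring N \<sigma>) (chart_ring N \<tau>) id (on_chart N \<Sigma> U \<tau>) (s \<sigma>))"
  by (simp add: toric_sheaf_def)

lemma toric_sectionD:
  assumes "s \<in> carrier (toric_sheaf N \<Sigma> U)" "\<sigma> \<in> \<Sigma>"
  shows "s \<sigma> \<in> carrier (spec_sheaf (ring_on (chart_carrier N \<sigma>)) (on_chart N \<Sigma> U \<sigma>))"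
proof -
  have "s \<in> (\<Pi>\<^sub>E \<sigma>\<in>\<Sigma>. carrier (spec_sheaf (chart_ring N \<sigma>) (on_chart N \<Sigma> U \<sigma>)))"
    using assms(1) by (simp add: toric_sheaf_def)
  from PiE_mem[OF this assms(2)] show ?thesis by (simp add: chart_ring_eq)
qed

lemma section_on_preimage:
  assumes "s \<in> carrier (toric_sheaf N \<Sigma> (F_preimage N \<Sigma> q U))" "\<sigma> \<in> \<Sigma>"
  shows "s \<sigma> \<in> carrier (spec_sheaf (ring_on (chart_carrier N \<sigma> :: ('v, 'k::field) laurent set))
     (semilinear_map.preimage (chart_carrier N \<sigma>) (comonomial (mult_by q)) (on_chart N \<Sigma> U \<sigma>)))"
  using toric_sectionD[OF assms] by (simp add: on_chart_F_preimage assms)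

lemma toric_transfer_section:
  assumes U: "toric_open N \<Sigma> U" and s: "s \<in> carrier (toric_sheaf N \<Sigma> (F_preimage N \<Sigma> q U))"
  shows "toric_transfer N \<Sigma> q E U s \<in> carrier (toric_sheaf N \<Sigma> (U :: ('v, 'k::field) toric_point set))"
proof -
  have "toric_transfer N \<Sigma> q E U s \<tau> =
      spec_pullback (chart_ring N \<sigma>) (chart_ring N \<tau>) id (on_chart N \<Sigma> U \<tau>) (toric_transfer N \<Sigma> q E U s \<sigma>)"
    if h: "\<sigma> \<in> \<Sigma>" "\<tau> \<in> \<Sigma>" "\<tau> \<subseteq> \<sigma>" for \<sigma> \<tau>
  proof -
    have "s \<tau> = spec_pullback (ring_on (chart_carrier N \<sigma>)) (ring_on (chart_carrier N \<tau>)) id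
        (semilinear_map.preimage (chart_carrier N \<tau>) (comonomial (mult_by q)) (on_chart N \<Sigma> U \<tau>)) (s \<sigma>)"
      using s h unfolding toric_sheaf_carrier on_chart_F_preimage[OF h(2), symmetric] chart_ring_eq by blast
    moreover have "spec_map (ring_on (chart_carrier N \<sigma>)) id p \<in> on_chart N \<Sigma> U \<sigma>"
      if "p \<in> on_chart N \<Sigma> U \<tau>" for p
      using on_chart_restrict[OF h that] by (simp add: spec_map_id)
    ultimately show ?thesis
      using semilinear_map.transfer_localize[OF semilinear[OF h(1)] semilinear[OF h(2)]
          chart_carrier_antimono[OF h(3)] open_chart[OF U h(1)] open_chart[OF U h(2)] _ section_on_preimage[OF s h(1)]] h
      by (simp add: toric_transfer_def chart_ring_eq)
  qed
  moreover have "toric_transfer N \<Sigma> q E U s \<sigma> \<in> carrier (spec_sheaf (chart_ring N \<sigma>) (on_chart N \<Sigma> U \<sigma>))"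
    if "\<sigma> \<in> \<Sigma>" for \<sigma>
    using semilinear_map.transfer_section[OF semilinear[OF that] open_chart[OF U that] section_on_preimage[OF s that]] that
    by (simp add: toric_transfer_def chart_ring_eq)
  moreover have "toric_transfer N \<Sigma> q E U s \<in> extensional \<Sigma>" by (simp add: toric_transfer_def)
  ultimately show ?thesis unfolding toric_sheaf_carrier PiE_iff by blast
qed

lemma F_pullback_eq:
  "\<sigma> \<in> \<Sigma> \<Longrightarrow> F_pullback N \<Sigma> q U a \<sigma> = spec_pullback (ring_on (chart_carrier N \<sigma>))
     (ring_on (chart_carrier N \<sigma> :: ('v, 'k::field) laurent set)) (comonomial (mult_by q))
     (semilinear_map.preimage (chart_carrier N \<sigma>) (comonomial (mult_by q)) (on_chart N \<Sigma> U \<sigma>)) (a \<sigma>)"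
  by (simp add: toric_pullback_def image_cone_mult on_chart_F_preimage chart_ring_eq)

text \<open>\<open>transfer\<close> reads a section at \<open>{0}\<close> only, and this point lies
  in every nonempty open set of a chart.\<close>

lemma toric_transfer_restrict:
  assumes U: "toric_open N \<Sigma> U" and V: "toric_open N \<Sigma> V" "V \<subseteq> U"
  shows "restrict_section N \<Sigma> V (toric_transfer N \<Sigma> q E U s) =
    toric_transfer N \<Sigma> q E V (restrict_section N \<Sigma> (F_preimage N \<Sigma> q V) (s :: ('v, 'k::field) toric_section))"
proof (intro ext)
  fix \<sigma> :: "'v set" and p :: "('v, 'k) laurent set"
  show "restrict_section N \<Sigma> V (toric_transfer N \<Sigma> q E U s) \<sigma> p =
    toric_transfer N \<Sigma> q E V (restrict_section N \<Sigma> (F_preimage N \<Sigma> q V) s) \<sigma> p"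
  proof (cases "\<sigma> \<in> \<Sigma> \<and> p \<in> on_chart N \<Sigma> V \<sigma>")
    case True
    then have \<sigma>: "\<sigma> \<in> \<Sigma>" and p: "p \<in> on_chart N \<Sigma> V \<sigma>" by auto
    have "{0} \<in> on_chart N \<Sigma> (F_preimage N \<Sigma> q V) \<sigma>"
      unfolding on_chart_F_preimage[OF \<sigma>]
      by (rule semilinear_map.generic_preimage(2)[OF semilinear[OF \<sigma>] open_chart[OF V(1) \<sigma>] p])
    moreover have "p \<in> on_chart N \<Sigma> U \<sigma>" using True V(2) by (auto simp: on_chart_def)
    ultimately show ?thesis
      using \<sigma> p by (simp add: restrict_section_def toric_transfer_def) (intro transfer_cong, simp_all)
  qed (auto simp: restrict_section_def toric_transfer_def transfer_def)
qed

lemma splitting_toric_transfer: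
  "splitting N \<Sigma> q (toric_transfer N \<Sigma> q E :: ('v, 'k::field) toric_point set \<Rightarrow> _)"
  unfolding splitting_def module_map_def
proof (intro conjI allI impI ballI)
  fix U :: "('v, 'k) toric_point set" assume U: "toric_open N \<Sigma> U"
  show "toric_transfer N \<Sigma> q E U \<in> carrier (toric_sheaf N \<Sigma> (F_preimage N \<Sigma> q U)) \<rightarrow> carrier (toric_sheaf N \<Sigma> U)"
    using toric_transfer_section[OF U] by blast
  {
    fix s t assume s: "s \<in> carrier (toric_sheaf N \<Sigma> (F_preimage N \<Sigma> q U))"
      and t: "t \<in> carrier (toric_sheaf N \<Sigma> (F_preimage N \<Sigma> q U))"
    show "toric_transfer N \<Sigma> q E U (s \<oplus>\<^bsub>toric_sheaf N \<Sigma> (F_preimage N \<Sigma> q U)\<^esub> t) =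
      toric_transfer N \<Sigma> q E U s \<oplus>\<^bsub>toric_sheaf N \<Sigma> U\<^esub> toric_transfer N \<Sigma> q E U t"
    proof
      fix \<sigma>
      show "toric_transfer N \<Sigma> q E U (s \<oplus>\<^bsub>toric_sheaf N \<Sigma> (F_preimage N \<Sigma> q U)\<^esub> t) \<sigma> =
        (toric_transfer N \<Sigma> q E U s \<oplus>\<^bsub>toric_sheaf N \<Sigma> U\<^esub> toric_transfer N \<Sigma> q E U t) \<sigma>"
      proof (cases "\<sigma> \<in> \<Sigma>")
        case True
        then show ?thesis
          using semilinear_map.transfer_add[OF semilinear[OF True] open_chart[OF U True]
              section_on_preimage[OF s True] section_on_preimage[OF t True]]
          by (simp add: toric_transfer_def toric_sheaf_def chart_ring_eq on_chart_F_preimage)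
      qed (simp add: toric_transfer_def toric_sheaf_def)
    qed
  }
  {
    fix a s assume a: "a \<in> carrier (toric_sheaf N \<Sigma> U)"
      and s: "s \<in> carrier (toric_sheaf N \<Sigma> (F_preimage N \<Sigma> q U))"
    show "toric_transfer N \<Sigma> q E U (F_pullback N \<Sigma> q U a \<otimes>\<^bsub>toric_sheaf N \<Sigma> (F_preimage N \<Sigma> q U)\<^esub> s) =
      a \<otimes>\<^bsub>toric_sheaf N \<Sigma> U\<^esub> toric_transfer N \<Sigma> q E U s"
    proof
      fix \<sigma>
      show "toric_transfer N \<Sigma> q E U (F_pullback N \<Sigma> q U a \<otimes>\<^bsub>toric_sheaf N \<Sigma> (F_preimage N \<Sigma> q U)\<^esub> s) \<sigma> =
        (a \<otimes>\<^bsub>toric_sheaf N \<Sigma> U\<^esub> toric_transfer N \<Sigma> q E U s) \<sigma>"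
      proof (cases "\<sigma> \<in> \<Sigma>")
        case True
        then show ?thesis
          using semilinear_map.transfer_mult[OF semilinear[OF True] open_chart[OF U True]
              toric_sectionD[OF a True] section_on_preimage[OF s True]]
          by (simp add: toric_transfer_def toric_sheaf_def chart_ring_eq on_chart_F_preimage F_pullback_eq)
      qed (simp add: toric_transfer_def toric_sheaf_def)
    qed
  }
  {
    fix a assume a: "a \<in> carrier (toric_sheaf N \<Sigma> U)"
    show "toric_transfer N \<Sigma> q E U (F_pullback N \<Sigma> q U a) = a"
    proof
      fix \<sigma>
      show "toric_transfer N \<Sigma> q E U (F_pullback N \<Sigma> q U a) \<sigma> = a \<sigma>"
      proof (cases "\<sigma> \<in> \<Sigma>")
        case True
        then show ?thesis
          using semilinear_map.transfer_pullback[OF semilinear[OF True] open_chart[OF U True]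
              toric_sectionD[OF a True] monomial_map_one]
          by (simp add: toric_transfer_def F_pullback_eq)
      next
        case False
        then show ?thesis using a by (auto simp: toric_transfer_def toric_sheaf_def PiE_iff extensional_def)
      qed
    qed
  }
  fix V s assume "toric_open N \<Sigma> V \<and> V \<subseteq> U"
  then show "restrict_section N \<Sigma> V (toric_transfer N \<Sigma> q E U s) =
    toric_transfer N \<Sigma> q E V (restrict_section N \<Sigma> (F_preimage N \<Sigma> q V) s)"
    using toric_transfer_restrict[OF U] by blast
qed

end

text \<open>By \<open>exponent_diagonal\<close>, restricting functions to the diagonal turns the map
  given by \<open>E\<close> into the one given by \<open>E\<^sub>0\<close>. A function that vanishes
  on the diagonal is therefore sent to another one, and \<open>transfer_vanishing\<close> extends
  this to sections.\<close>

lemma compatible_with_diagonal: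
  fixes N :: "'v::real_vector set"
  assumes sp: "monomial_splitting (N \<times> N) (product_fan \<Sigma> \<Sigma>) q E"
    and sp0: "monomial_splitting N \<Sigma> q E\<^sub>0"
    and \<delta>: "toric_morphism N \<Sigma> (N \<times> N) (product_fan \<Sigma> \<Sigma>) (\<lambda>v. (v, v))"
    and exponent_diagonal: "\<And>u. u \<in> dual_lattice (N \<times> N) \<Longrightarrow>
      map_option (\<lambda>w. w \<circ> (\<lambda>v. (v, v))) (E u) = E\<^sub>0 (u \<circ> (\<lambda>v. (v, v)))"
  shows "compatible_with (N \<times> N) (product_fan \<Sigma> \<Sigma>) q (diagonal_ideal N \<Sigma>)
    (toric_transfer (N \<times> N) (product_fan \<Sigma> \<Sigma>) q E :: ('v \<times> 'v, 'k::field) toric_point set \<Rightarrow> _)"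
  unfolding compatible_with_def
proof (intro allI impI subsetI, elim imageE)
  let ?\<delta> = "\<lambda>v::'v. (v, v)"
  interpret X: monomial_splitting "N \<times> N" "product_fan \<Sigma> \<Sigma>" q E by fact
  interpret Y: monomial_splitting N \<Sigma> q E\<^sub>0 by fact
  interpret \<delta>: toric_morphism N \<Sigma> "N \<times> N" "product_fan \<Sigma> \<Sigma>" ?\<delta> by fact
  fix U :: "('v \<times> 'v, 'k) toric_point set" and s t
  assume U: "toric_open (N \<times> N) (product_fan \<Sigma> \<Sigma>) U"
    and t: "t = toric_transfer (N \<times> N) (product_fan \<Sigma> \<Sigma>) q E U s"
    and s: "s \<in> diagonal_ideal N \<Sigma> (F_preimage (N \<times> N) (product_fan \<Sigma> \<Sigma>) q U)"
  let ?pre = "toric_preimage N \<Sigma> (N \<times> N) (product_fan \<Sigma> \<Sigma>) ?\<delta>"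
  let ?U' = "F_preimage (N \<times> N) (product_fan \<Sigma> \<Sigma>) q U"
  have sc: "s \<in> carrier (toric_sheaf (N \<times> N) (product_fan \<Sigma> \<Sigma>) ?U')"
    and s0: "toric_pullback N \<Sigma> (N \<times> N) (product_fan \<Sigma> \<Sigma>) ?\<delta> ?U' s = \<zero>\<^bsub>toric_sheaf N \<Sigma> (?pre ?U')\<^esub>"
    using s by (auto simp: diagonal_ideal_def)
  have tc: "t \<in> carrier (toric_sheaf (N \<times> N) (product_fan \<Sigma> \<Sigma>) U)"
    unfolding t by (rule X.toric_transfer_section[OF U sc])
  have commute: "comonomial ?\<delta> (monomial_map E f) = monomial_map E\<^sub>0 (comonomial ?\<delta> f)"
    if "Poly_Mapping.keys f \<subseteq> dual_lattice (N \<times> N)" for f :: "('v \<times> 'v, 'k) laurent"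
    using that
  proof (rule additive_eqI)
    fix u c assume "u \<in> dual_lattice (N \<times> N)"
    from exponent_diagonal[OF this]
    show "comonomial ?\<delta> (monomial_map E (Poly_Mapping.single u c)) =
      monomial_map E\<^sub>0 (comonomial ?\<delta> (Poly_Mapping.single u (c :: 'k)))"
      by (cases "E u") (simp_all add: monomial_map_single comonomial_eq)
  qed (simp_all add: comonomial_add monomial_map_add)
  have commute_mult: "comonomial ?\<delta> (comonomial (mult_by q) f) = comonomial (mult_by q) (comonomial ?\<delta> f)"
    for f :: "('v \<times> 'v, 'k) laurent"
  proof (rule additive_eqI[of f UNIV])
    fix u :: "'v \<times> 'v \<Rightarrow> real" and c :: 'k
    have "u \<circ> mult_by q \<circ> ?\<delta> = u \<circ> ?\<delta> \<circ> mult_by q" by (simp add: fun_eq_iff)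
    then show "comonomial ?\<delta> (comonomial (mult_by q) (Poly_Mapping.single u c)) =
      comonomial (mult_by q) (comonomial ?\<delta> (Poly_Mapping.single u c))" by simp
  qed (simp_all add: comonomial_add)
  have "toric_pullback N \<Sigma> (N \<times> N) (product_fan \<Sigma> \<Sigma>) ?\<delta> U t \<sigma> p = \<zero>\<^bsub>toric_sheaf N \<Sigma> (?pre U)\<^esub> \<sigma> p" for \<sigma> p
  proof (cases "\<sigma> \<in> \<Sigma> \<and> p \<in> on_chart N \<Sigma> (?pre U) \<sigma>")
    case True
    then have \<sigma>: "\<sigma> \<in> \<Sigma>" and p: "p \<in> on_chart N \<Sigma> (?pre U) \<sigma>" by auto
    let ?C = "chart_carrier (N \<times> N) (\<delta>.target_cone \<sigma>) :: ('v \<times> 'v, 'k) laurent set"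
    let ?D = "chart_carrier N \<sigma> :: ('v, 'k) laurent set"
    note c = \<delta>.image_cone_in[OF \<sigma>]
    have p': "p \<in> Spec (ring_on ?D)" "\<delta>.point_map \<sigma> p \<in> on_chart (N \<times> N) (product_fan \<Sigma> \<Sigma>) U (\<delta>.target_cone \<sigma>)"
      using p unfolding \<delta>.on_chart_preimage[OF \<sigma>] by auto
    have van: "spec_pullback (ring_on ?C) (ring_on ?D) (comonomial ?\<delta>) (on_chart N \<Sigma> (?pre ?U') \<sigma>) (s (\<delta>.target_cone \<sigma>)) P =
        fraction (ring_on ?D) P 0 1" if "P \<in> on_chart N \<Sigma> (?pre ?U') \<sigma>" for P
      using fun_cong[OF fun_cong[OF s0, of \<sigma>], of P] that \<sigma>
      by (simp add: toric_pullback_def toric_sheaf_def spec_sheaf_def chart_ring_eq chart.localization_zero)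
    have "spec_pullback (ring_on ?C) (ring_on ?D) (comonomial ?\<delta>) (on_chart N \<Sigma> (?pre U) \<sigma>)
        (transfer ?C (comonomial (mult_by q)) (monomial_map E) (on_chart (N \<times> N) (product_fan \<Sigma> \<Sigma>) U (\<delta>.target_cone \<sigma>)) (s (\<delta>.target_cone \<sigma>))) p =
        fraction (ring_on ?D) p 0 1"
      by (rule semilinear_map.transfer_vanishing[OF X.semilinear[OF c] \<delta>.hom Y.semilinear[OF \<sigma>] commute_mult _
            X.open_chart[OF U c] X.section_on_preimage[OF sc c] p' p _ van])
        (auto simp: chart_carrier_def \<delta>.on_chart_preimage[OF \<sigma>] X.on_chart_F_preimage[OF c] intro!: commute)
    then show ?thesis
      using \<sigma> p c by (simp add: toric_pullback_def toric_sheaf_def spec_sheaf_def chart_ring_eq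
          chart.localization_zero t toric_transfer_def)
  qed (auto simp: toric_pullback_def toric_sheaf_def spec_sheaf_def spec_pullback_def)
  then show "t \<in> diagonal_ideal N \<Sigma> U"
    using tc by (simp add: diagonal_ideal_def fun_eq_iff)
qed

section \<open>Diagonal splittings from unimodularity\<close>

text \<open>The fan cuts out \<open>\<sigma> \<inter> \<tau>\<close> by a real functional; an
  integral one with the same zeros among the generators defines the same face by
  \<open>face_eq\<close>.\<close>

lemma toric_fan:
  fixes N :: "'v::real_vector set"
  assumes N: "full_lattice N" and fan: "is_fan N \<Sigma>"
  shows "toric N \<Sigma>"
proof
  have gen: "\<exists>S. finite S \<and> S \<subseteq> N \<and> \<sigma> = convex_cone hull S" if "\<sigma> \<in> \<Sigma>" for \<sigma>
    using fan that unfolding is_fan_def rational_pointed_cone_def by blast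
  fix \<sigma> assume \<sigma>: "\<sigma> \<in> \<Sigma>"
  obtain S where S: "finite S" "S \<subseteq> N" "\<sigma> = convex_cone hull S" using gen[OF \<sigma>] by blast
  show "0 \<in> \<sigma>" using S(3) convex_cone_hull_contains_0 by blast
  show "c *\<^sub>R v \<in> \<sigma>" if "v \<in> \<sigma>" "0 \<le> c" for c v
    using that convex_cone_hull_mul unfolding S(3) by blast
  have dual: "u \<in> dual_cone \<sigma> \<longleftrightarrow> linear u \<and> (\<forall>s\<in>S. 0 \<le> u s)" for u
    unfolding dual_cone_def S(3) using hull_nonneg[of u S] hull_inc[of _ S convex_cone] by blast
  show "\<exists>k::nat. \<forall>v\<in>\<sigma>. 0 \<le> of_nat k * m v + u v"
    if "m \<in> dual_cone \<sigma>" "linear u" "\<And>v. v \<in> \<sigma> \<Longrightarrow> m v = 0 \<Longrightarrow> 0 \<le> u v" for m u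
    unfolding S(3)
  proof (rule nonneg_shift[OF S(1) _ _ that(2)])
    show "0 \<le> u s" if "s \<in> S" "m s = 0" for s
      using \<open>\<And>v. v \<in> \<sigma> \<Longrightarrow> m v = 0 \<Longrightarrow> 0 \<le> u v\<close>[of s] that hull_inc[of s S convex_cone] S(3) by simp
  qed (use that(1) dual in auto)
  fix \<tau> assume \<tau>: "\<tau> \<in> \<Sigma>"
  have face: "cone_face (\<sigma> \<inter> \<tau>) \<sigma>" using fan \<sigma> \<tau> unfolding is_fan_def by blast
  then show "\<sigma> \<inter> \<tau> \<in> \<Sigma>" using fan \<sigma> unfolding is_fan_def by blast
  obtain u where u: "u \<in> dual_cone \<sigma>" "\<sigma> \<inter> \<tau> = {v \<in> \<sigma>. u v = 0}" using face unfolding cone_face_def by blast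
  then have u': "linear u" "\<And>s. s \<in> S \<Longrightarrow> 0 \<le> u s" by (auto simp: dual)
  obtain m where m: "m \<in> dual_lattice N" "\<And>s. s \<in> S \<Longrightarrow> 0 \<le> m s" "\<And>s. s \<in> S \<Longrightarrow> m s = 0 \<longleftrightarrow> u s = 0"
    using rational_supporting_functional[OF N S(1,2) u'] by blast
  have "\<sigma> \<inter> \<tau> = {v \<in> \<sigma>. m v = 0}"
    using u(2) face_eq[OF S(1) u' dual_latticeD[OF m(1)] m(2)] m(3) S(3) by simp
  moreover have "m \<in> dual_cone \<sigma>" using m dual_latticeD[OF m(1)] by (simp add: dual)
  ultimately show "\<exists>m\<in>dual_cone \<sigma> \<inter> dual_lattice N. \<sigma> \<inter> \<tau> = {v \<in> \<sigma>. m v = 0}" using m(1) by blast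
qed

section \<open>Products of fans and the diagonal morphism\<close>

lemma linear_pair_split: "linear u \<Longrightarrow> u (v, w) = u (v, 0) + u (0, w)"
  using linear_add[of u "(v, 0)" "(0, w)"] by simp

lemma linear_pair_fst: "linear u \<Longrightarrow> linear (\<lambda>v. u (v, 0))"
  by (rule linear_compose[of "\<lambda>v. (v, 0)" u, unfolded comp_def]) (auto intro: linearI)

lemma linear_pair_snd: "linear u \<Longrightarrow> linear (\<lambda>w. u (0, w))"
  by (rule linear_compose[of "\<lambda>w. (0, w)" u, unfolded comp_def]) (auto intro: linearI)

lemma linear_pair_sum:
  assumes "linear a" "linear b"
  shows "linear (\<lambda>x. a (fst x) + b (snd x))"
  using linear_compose_add[OF linear_compose[OF linear_fst assms(1)] linear_compose[OF linear_snd assms(2)]]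
  by (simp add: comp_def)

lemma pair_sum_dual_lattice:
  "a \<in> dual_lattice N \<Longrightarrow> b \<in> dual_lattice N' \<Longrightarrow> (\<lambda>x. a (fst x) + b (snd x)) \<in> dual_lattice (N \<times> N')"
  by (auto simp: dual_lattice_def intro: linear_pair_sum)

lemma pair_sum_dual_cone:
  "a \<in> dual_cone \<sigma> \<Longrightarrow> b \<in> dual_cone \<tau> \<Longrightarrow> (\<lambda>x. a (fst x) + b (snd x)) \<in> dual_cone (\<sigma> \<times> \<tau>)"
  by (auto simp: dual_cone_def intro: linear_pair_sum)

lemma dual_cone_Times:
  assumes "u \<in> dual_cone (\<sigma> \<times> \<tau>)" "0 \<in> \<sigma>" "0 \<in> \<tau>"
  shows "(\<lambda>v. u (v, 0)) \<in> dual_cone \<sigma>" "(\<lambda>w. u (0, w)) \<in> dual_cone \<tau>"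
  using assms by (auto simp: dual_cone_def linear_pair_fst linear_pair_snd)

lemma dual_lattice_Times:
  assumes "u \<in> dual_lattice (N \<times> N')" "0 \<in> N" "0 \<in> N'"
  shows "(\<lambda>v. u (v, 0)) \<in> dual_lattice N" "(\<lambda>w. u (0, w)) \<in> dual_lattice N'"
  using assms by (auto simp: dual_lattice_def linear_pair_fst linear_pair_snd)

text \<open>A functional on the product is the sum of its restrictions to the factors, and is
  nonnegative on \<open>\<sigma> \<times> \<tau>\<close> exactly when both restrictions are
  nonnegative. Every property is thus inherited factor by factor.\<close>

lemma toric_product:
  assumes "toric N \<Sigma>" "toric N' \<Sigma>'"
  shows "toric (N \<times> N') (product_fan \<Sigma> \<Sigma>')"
proof
  interpret A: toric N \<Sigma> by fact
  interpret B: toric N' \<Sigma>' by fact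
  fix \<rho> assume "\<rho> \<in> product_fan \<Sigma> \<Sigma>'"
  then obtain \<sigma> \<tau> where \<rho>: "\<rho> = \<sigma> \<times> \<tau>" "\<sigma> \<in> \<Sigma>" "\<tau> \<in> \<Sigma>'" by (auto simp: product_fan_def)
  note zero = A.zero_mem[OF \<rho>(2)] B.zero_mem[OF \<rho>(3)]
  show "0 \<in> \<rho>" using zero by (simp add: \<rho>(1) zero_prod_def)
  show "c *\<^sub>R v \<in> \<rho>" if "v \<in> \<rho>" "0 \<le> c" for c v
    using that A.scaling[OF \<rho>(2)] B.scaling[OF \<rho>(3)] by (auto simp: \<rho>(1))
  show "\<exists>k::nat. \<forall>x\<in>\<rho>. 0 \<le> of_nat k * m x + u x"
    if m: "m \<in> dual_cone \<rho>" and u: "linear u" "\<And>x. x \<in> \<rho> \<Longrightarrow> m x = 0 \<Longrightarrow> 0 \<le> u x" for m u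
  proof -
    have ml: "linear m" using m by (simp add: dual_cone_def)
    note m12 = dual_cone_Times[OF m[unfolded \<rho>(1)] zero]
    obtain k where k: "\<forall>v\<in>\<sigma>. 0 \<le> of_nat k * m (v, 0) + u (v, 0)"
      using A.shift[OF \<rho>(2) m12(1) linear_pair_fst[OF u(1)]] u(2) zero by (auto simp: \<rho>(1))
    obtain l where l: "\<forall>w\<in>\<tau>. 0 \<le> of_nat l * m (0, w) + u (0, w)"
      using B.shift[OF \<rho>(3) m12(2) linear_pair_snd[OF u(1)]] u(2) zero by (auto simp: \<rho>(1))
    \<comment> \<open>One constant has to serve both factors. Raising \<open>k\<close> and
      \<open>l\<close> to \<open>k + l\<close> adds nonnegative terms only.\<close>
    have "0 \<le> of_nat (k + l) * m (v, w) + u (v, w)" if vw: "v \<in> \<sigma>" "w \<in> \<tau>" for v w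
    proof -
      have "0 \<le> m (v, 0)" "0 \<le> m (0, w)" using m12 vw by (auto simp: dual_cone_def)
      then have "0 \<le> of_nat l * m (v, 0)" "0 \<le> of_nat k * m (0, w)" by simp_all
      moreover have "of_nat (k + l) * m (v, w) + u (v, w) =
          (of_nat k * m (v, 0) + u (v, 0)) + (of_nat l * m (0, w) + u (0, w)) + of_nat l * m (v, 0) + of_nat k * m (0, w)"
        unfolding linear_pair_split[OF ml, of v w] linear_pair_split[OF u(1), of v w]
        by (simp add: algebra_simps)
      ultimately show ?thesis using k l vw by simp
    qed
    then show ?thesis by (intro exI[of _ "k + l"]) (auto simp: \<rho>(1))
  qed
  fix \<rho>' assume "\<rho>' \<in> product_fan \<Sigma> \<Sigma>'"
  then obtain \<sigma>' \<tau>' where \<rho>': "\<rho>' = \<sigma>' \<times> \<tau>'" "\<sigma>' \<in> \<Sigma>" "\<tau>' \<in> \<Sigma>'" by (auto simp: product_fan_def)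
  have int: "\<rho> \<inter> \<rho>' = (\<sigma> \<inter> \<sigma>') \<times> (\<tau> \<inter> \<tau>')" unfolding \<rho>(1) \<rho>'(1) by blast
  then show "\<rho> \<inter> \<rho>' \<in> product_fan \<Sigma> \<Sigma>'"
    using A.inter[OF \<rho>(2) \<rho>'(2)] B.inter[OF \<rho>(3) \<rho>'(3)] unfolding product_fan_def by blast
  obtain a where a: "a \<in> dual_cone \<sigma>" "a \<in> dual_lattice N" "\<sigma> \<inter> \<sigma>' = {v \<in> \<sigma>. a v = 0}"
    using A.separating[OF \<rho>(2) \<rho>'(2)] by blast
  obtain b where b: "b \<in> dual_cone \<tau>" "b \<in> dual_lattice N'" "\<tau> \<inter> \<tau>' = {v \<in> \<tau>. b v = 0}"
    using B.separating[OF \<rho>(3) \<rho>'(3)] by blast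
  have "a v + b w = 0 \<longleftrightarrow> a v = 0 \<and> b w = 0" if "v \<in> \<sigma>" "w \<in> \<tau>" for v w
    using a(1) b(1) that by (auto simp: dual_cone_def add_nonneg_eq_0_iff)
  then have "(\<sigma> \<inter> \<sigma>') \<times> (\<tau> \<inter> \<tau>') = {x \<in> \<sigma> \<times> \<tau>. a (fst x) + b (snd x) = 0}"
    unfolding a(3) b(3) by auto
  then have "\<rho> \<inter> \<rho>' = {x \<in> \<rho>. a (fst x) + b (snd x) = 0}"
    using int \<rho>(1) by simp
  then show "\<exists>m\<in>dual_cone \<rho> \<inter> dual_lattice (N \<times> N'). \<rho> \<inter> \<rho>' = {v \<in> \<rho>. m v = 0}"
  proof (rule bexI[of _ "\<lambda>x. a (fst x) + b (snd x)"])
    show "(\<lambda>x. a (fst x) + b (snd x)) \<in> dual_cone \<rho> \<inter> dual_lattice (N \<times> N')"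
      using pair_sum_dual_cone[OF a(1) b(1)] pair_sum_dual_lattice[OF a(2) b(2)] \<rho>(1) by simp
  qed
qed

lemma toric_diagonal:
  assumes "toric N \<Sigma>"
  shows "toric_morphism N \<Sigma> (N \<times> N) (product_fan \<Sigma> \<Sigma>) (\<lambda>v. (v, v))"
proof (intro toric_morphism.intro toric_morphism_axioms.intro toric_product assms)
  show "linear (\<lambda>v::'a. (v, v))" by (rule linearI) auto
  then show "u \<circ> (\<lambda>v. (v, v)) \<in> dual_lattice N" if "u \<in> dual_lattice (N \<times> N)" for u
    using that by (auto simp: dual_lattice_def intro: linear_compose)
  show "image_cone (product_fan \<Sigma> \<Sigma>) (\<lambda>v. (v, v)) \<sigma> \<in> product_fan \<Sigma> \<Sigma>" if "\<sigma> \<in> \<Sigma>" for \<sigma>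
  proof -
    \<comment> \<open>If \<open>\<sigma>' \<times> \<tau>'\<close> contains \<open>(v, v)\<close>
      for all \<open>v\<close> in \<sigma>, then both factors contain \<sigma>.\<close>
    have "image_cone (product_fan \<Sigma> \<Sigma>) (\<lambda>v. (v, v)) \<sigma> = \<sigma> \<times> \<sigma>"
      by (rule image_cone_eqI) (use that in \<open>auto simp: product_fan_def\<close>)
    then show ?thesis using that by (auto simp: product_fan_def)
  qed
qed

text \<open>The difference \<open>r a - a/q\<close> is the representative of the class of \<open>-a/q\<close> in \<open>(1/q)M/M\<close> that Payne's
  characterization asks for in the open polytope \<open>\<bar>\<langle>u, v\<rangle>\<bar> < 1\<close>.\<close>

lemma equivariant_rounding:
  fixes N R :: "'v::real_vector set" and q :: nat
  assumes uni: "unimodular N R" and fin: "finite R" and q: "0 < q"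
  obtains r where "\<forall>a\<in>dual_lattice N. r a \<in> dual_lattice N"
    "\<forall>a\<in>dual_lattice N. \<forall>v\<in>R. \<bar>r a v - a v / of_nat q\<bar> < 1"
    "\<forall>a\<in>dual_lattice N. \<forall>m\<in>dual_lattice N. r ((m \<circ> mult_by q) + a) = m + r a"
    "r 0 = 0"
proof -
  let ?M = "dual_lattice N"
  let ?q = "\<lambda>a::'v \<Rightarrow> real. \<lambda>v. a v / of_nat q"
  define P where "P a d \<longleftrightarrow> ?q a + d \<in> ?M \<and> (\<forall>v\<in>R. \<bar>d v\<bar> < 1)" for a d :: "'v \<Rightarrow> real"
  \<comment> \<open>The predicate \<open>P a\<close> is the same for all \<open>a\<close> in one
    class modulo \<open>q M\<close>, so \<open>SOME\<close> chooses the same rounding error for the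
    whole class. On the zero class the error is set to zero to obtain
    \<open>r 0 = 0\<close>.\<close>
  define d where "d a = (if ?q a \<in> ?M then 0 else SOME d. P a d)" for a
  define r where "r a = ?q a + d a" for a
  have P: "P a (d a)" if a: "a \<in> ?M" for a
  proof (cases "?q a \<in> ?M")
    case True
    then show ?thesis by (simp add: P_def d_def)
  next
    case False
    have "linear (?q a)"
      using linear_compose_scale_right[OF dual_latticeD[OF a], of "1 / of_nat q"] by simp
    then obtain m where "m \<in> ?M" "\<And>v. v \<in> R \<Longrightarrow> \<bar>?q a v - m v\<bar> < 1"
      using unimodular_rounding[OF uni fin] by blast
    then have "P a (m - ?q a)" by (auto simp: P_def abs_minus_commute)
    then show ?thesis using False by (simp add: d_def someI[of "P a"])
  qed
  have 1: "r a \<in> ?M" if "a \<in> ?M" for a using P[OF that] by (simp add: P_def r_def)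
  have 2: "\<bar>r a v - a v / of_nat q\<bar> < 1" if "a \<in> ?M" "v \<in> R" for a v
    using P[OF that(1)] that(2) by (simp add: P_def r_def)
  have 3: "r ((m \<circ> mult_by q) + a) = m + r a" if a: "a \<in> ?M" and m: "m \<in> ?M" for a m
  proof -
    have eq: "?q ((m \<circ> mult_by q) + a) = m + ?q a"
      using q by (simp add: fun_eq_iff linear_scale[OF dual_latticeD[OF m]] field_simps)
    have mem: "m + x \<in> ?M \<longleftrightarrow> x \<in> ?M" for x
      using dual_lattice_add[OF m, of x] dual_lattice_diff[OF _ m, of "m + x"] by auto
    have "P ((m \<circ> mult_by q) + a) = P a"
      unfolding P_def eq add.assoc mem ..
    then have "d ((m \<circ> mult_by q) + a) = d a" unfolding d_def eq mem by simp
    then show ?thesis unfolding r_def eq by (simp add: add.assoc)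
  qed
  have "?q 0 = 0" by (simp add: fun_eq_iff)
  then have "r 0 = 0" by (simp add: r_def d_def)
  then show thesis using 1 2 3 by (intro that[of r]) simp_all
qed

theorem theorem1p1:
  fixes N :: "'v::real_vector set" and \<Sigma> :: "'v set set"
  assumes "full_lattice N"
    and "complete_fan N \<Sigma>"
    and "unimodular N (ray_generators N \<Sigma>)"
  shows "\<forall>q\<ge>2. diagonally_split TYPE('k::field) N \<Sigma> q"
proof (intro allI impI)
  fix q :: nat assume "2 \<le> q"
  then have q: "0 < q" by simp
  let ?M = "dual_lattice N" and ?\<Sigma>' = "product_fan \<Sigma> \<Sigma>" and ?R = "ray_generators N \<Sigma>"
  have fan: "is_fan N \<Sigma>" using assms(2) by (simp add: complete_fan_def)
  have X: "toric N \<Sigma>" by (rule toric_fan[OF assms(1) fan])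
  interpret X: toric N \<Sigma> by (rule X)
  have N0: "0 \<in> N" using assms(1) int_span_zero by (auto elim: full_latticeE)
  obtain r where "\<forall>a\<in>?M. r a \<in> ?M" "\<forall>a\<in>?M. \<forall>v\<in>?R. \<bar>r a v - a v / of_nat q\<bar> < 1"
    "\<forall>a\<in>?M. \<forall>m\<in>?M. r ((m \<circ> mult_by q) + a) = m + r a" and r0: "r 0 = 0"
    by (rule equivariant_rounding[OF assms(3) finite_ray_generators[OF fan assms(3)] q])
  then have r: "a \<in> ?M \<Longrightarrow> r a \<in> ?M" "a \<in> ?M \<Longrightarrow> v \<in> ?R \<Longrightarrow> \<bar>r a v - a v / of_nat q\<bar> < 1"
    "a \<in> ?M \<Longrightarrow> m \<in> ?M \<Longrightarrow> r ((m \<circ> mult_by q) + a) = m + r a" for a v m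
    by blast+
  txt \<open>The splitting of \<open>X \<times> X\<close> maps the monomial with exponent \<open>(a, b)\<close> to the one with exponent
    \<open>(r a, (a + b)/q - r a)\<close>, or to zero if \<open>(a + b)/q\<close> is not in \<open>M\<close>. On the diagonal it becomes the
    splitting of \<open>X\<close> that divides exponents by \<open>q\<close>.\<close>
  define E\<^sub>0 where "E\<^sub>0 c = (let s = (\<lambda>v. c v / of_nat q) in if s \<in> ?M then Some s else None)" for c :: "'v \<Rightarrow> real"
  define E where "E u = (let a = (\<lambda>v. u (v, 0)) in
     map_option (\<lambda>s x. r a (fst x) + (s - r a) (snd x)) (E\<^sub>0 (\<lambda>v. u (v, v))))" for u :: "'v \<times> 'v \<Rightarrow> real"
  have E\<^sub>0_shift: "E\<^sub>0 ((m \<circ> mult_by q) + c) = map_option ((+) m) (E\<^sub>0 c)" if m: "m \<in> ?M" for m c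
  proof -
    have "(\<lambda>v. ((m \<circ> mult_by q) + c) v / of_nat q) = m + (\<lambda>v. c v / of_nat q)"
      using q by (simp add: fun_eq_iff linear_scale[OF dual_latticeD[OF m]] field_simps)
    moreover have "m + x \<in> ?M \<longleftrightarrow> x \<in> ?M" for x
      using dual_lattice_add[OF m, of x] dual_lattice_diff[OF _ m, of "m + x"] by auto
    ultimately show ?thesis by (simp add: E\<^sub>0_def Let_def)
  qed
  have "(\<lambda>v. (0 :: 'v \<Rightarrow> real) v / of_nat q) = 0" by (simp add: fun_eq_iff)
  then have E\<^sub>0_zero: "E\<^sub>0 0 = Some 0" unfolding E\<^sub>0_def Let_def by simp
  have nonneg: "w \<in> dual_cone \<sigma>" if \<sigma>: "\<sigma> \<in> \<Sigma>" and w: "w \<in> ?M" "\<And>v. v \<in> ?R \<Longrightarrow> v \<in> \<sigma> \<Longrightarrow> - 1 < w v" for w \<sigma>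
  proof (rule nonneg_on_cone[OF assms(1) fan \<sigma> dual_latticeD[OF w(1)]])
    fix v assume v: "v \<in> ?R" "v \<in> \<sigma>"
    then have "v \<in> N" by (simp add: ray_generators_def primitive_def)
    then obtain k :: int where "w v = of_int k" using w(1) by (auto simp: dual_lattice_def elim: Ints_cases)
    then show "0 \<le> w v" using w(2)[OF v] by simp
  qed
  have sp0: "monomial_splitting N \<Sigma> q E\<^sub>0"
  proof (intro monomial_splitting.intro monomial_splitting_axioms.intro X q)
    fix u w assume u: "u \<in> ?M" "E\<^sub>0 u = Some w"
    then have w: "w = (\<lambda>v. u v / of_nat q)" "w \<in> ?M" by (auto simp: E\<^sub>0_def Let_def split: if_splits)
    then show "w \<in> ?M" by simp
    show "w \<in> dual_cone \<sigma>" if "\<sigma> \<in> \<Sigma>" "u \<in> dual_cone \<sigma>" for \<sigma>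
      using that dual_latticeD[OF w(2)] by (simp add: w(1) dual_cone_def)
  qed (rule E\<^sub>0_shift E\<^sub>0_zero; assumption)+
  have sp: "monomial_splitting (N \<times> N) ?\<Sigma>' q E"
  proof (intro monomial_splitting.intro monomial_splitting_axioms.intro toric_product X q)
    fix u w assume u: "u \<in> dual_lattice (N \<times> N)" "E u = Some w"
    let ?a = "\<lambda>v. u (v, 0)" and ?b = "\<lambda>v. u (0, v)" and ?s = "\<lambda>v. u (v, v) / of_nat q"
    note ab = dual_lattice_Times[OF u(1) N0 N0]
    have s: "?s \<in> ?M" and w: "w = (\<lambda>x. r ?a (fst x) + (?s - r ?a) (snd x))"
      using u(2) by (auto simp: E_def E\<^sub>0_def Let_def split: if_splits)
    have sr: "?s - r ?a \<in> ?M" using dual_lattice_diff[OF s r(1)[OF ab(1)]] .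
    show "w \<in> dual_lattice (N \<times> N)" unfolding w by (rule pair_sum_dual_lattice[OF r(1)[OF ab(1)] sr])
    show "w \<in> dual_cone \<rho>" if \<rho>: "\<rho> \<in> ?\<Sigma>'" "u \<in> dual_cone \<rho>" for \<rho>
    proof -
      obtain \<sigma> \<tau> where \<sigma>\<tau>: "\<rho> = \<sigma> \<times> \<tau>" "\<sigma> \<in> \<Sigma>" "\<tau> \<in> \<Sigma>" using \<rho>(1) by (auto simp: product_fan_def)
      note ab' = dual_cone_Times[OF \<rho>(2)[unfolded \<sigma>\<tau>(1)] X.zero_mem[OF \<sigma>\<tau>(2)] X.zero_mem[OF \<sigma>\<tau>(3)]]
      show ?thesis
        unfolding w \<sigma>\<tau>(1)
      proof (rule pair_sum_dual_cone[OF nonneg[OF \<sigma>\<tau>(2) r(1)[OF ab(1)]] nonneg[OF \<sigma>\<tau>(3) sr]])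
        fix v assume v: "v \<in> ?R"
        have close: "\<bar>r ?a v - u (v, 0) / of_nat q\<bar> < 1" using r(2)[OF ab(1) v] .
        show "- 1 < r ?a v" if "v \<in> \<sigma>"
        proof -
          have "0 \<le> u (v, 0) / of_nat q" using ab'(1) that by (simp add: dual_cone_def)
          then show ?thesis using close by linarith
        qed
        \<comment> \<open>The second component is \<open>?b / q\<close> minus the rounding error
          \<open>r ?a - ?a / q\<close>; here the upper bound on the error is used, and for the first
          component the lower one.\<close>
        show "- 1 < (?s - r ?a) v" if "v \<in> \<tau>"
        proof -
          have "0 \<le> u (0, v) / of_nat q" using ab'(2) that by (simp add: dual_cone_def)
          moreover have "?s v = u (v, 0) / of_nat q + u (0, v) / of_nat q"
            using linear_pair_split[OF dual_latticeD[OF u(1)], of v v] by (simp add: add_divide_distrib)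
          ultimately show ?thesis using close by simp
        qed
      qed
    qed
  next
    fix u w assume u: "u \<in> dual_lattice (N \<times> N)" and w: "w \<in> dual_lattice (N \<times> N)"
    note a = dual_lattice_Times(1)[OF u N0 N0] dual_lattice_Times(1)[OF w N0 N0]
    have d: "(\<lambda>v. u (v, v)) \<in> ?M"
      using toric_morphism.dual_lattice_comp[OF toric_diagonal[OF X] u] by (simp add: comp_def)
    have e1: "(\<lambda>v. ((u \<circ> mult_by q) + w) (v, 0)) = ((\<lambda>v. u (v, 0)) \<circ> mult_by q) + (\<lambda>v. w (v, 0))"
      and e2: "(\<lambda>v. ((u \<circ> mult_by q) + w) (v, v)) = ((\<lambda>v. u (v, v)) \<circ> mult_by q) + (\<lambda>v. w (v, v))"
      by (simp_all add: fun_eq_iff)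
    \<comment> \<open>The second component of \<open>u\<close> is the diagonal value minus the first
      component. Shifting \<open>s\<close> by the former and \<open>r\<close> by the latter thus
      adds exactly \<open>u\<close>.\<close>
    have ul: "u (v, v') = u (v, 0) + (u (v', v') - u (v', 0))" for v v'
      using linear_pair_split[OF dual_latticeD[OF u], of v v'] linear_pair_split[OF dual_latticeD[OF u], of v' v'] by simp
    show "E ((u \<circ> mult_by q) + w) = map_option ((+) u) (E w)"
      unfolding E_def Let_def e1 e2 E\<^sub>0_shift[OF d] r(3)[OF a(2,1)]
    proof (cases "E\<^sub>0 (\<lambda>v. w (v, v))")
      case (Some s)
      have "(\<lambda>x. ((\<lambda>v. u (v, 0)) + r (\<lambda>v. w (v, 0))) (fst x) +
          ((\<lambda>v. u (v, v)) + s - ((\<lambda>v. u (v, 0)) + r (\<lambda>v. w (v, 0)))) (snd x)) =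
        u + (\<lambda>x. r (\<lambda>v. w (v, 0)) (fst x) + (s - r (\<lambda>v. w (v, 0))) (snd x))"
      proof
        fix x :: "'v \<times> 'v"
        obtain v v' where x: "x = (v, v')" by fastforce
        show "((\<lambda>v. u (v, 0)) + r (\<lambda>v. w (v, 0))) (fst x) +
            ((\<lambda>v. u (v, v)) + s - ((\<lambda>v. u (v, 0)) + r (\<lambda>v. w (v, 0)))) (snd x) =
          (u + (\<lambda>x. r (\<lambda>v. w (v, 0)) (fst x) + (s - r (\<lambda>v. w (v, 0))) (snd x))) x"
          unfolding x using ul[of v v'] by simp
      qed
      then show "map_option (\<lambda>s x. ((\<lambda>v. u (v, 0)) + r (\<lambda>v. w (v, 0))) (fst x) +
            (s - ((\<lambda>v. u (v, 0)) + r (\<lambda>v. w (v, 0)))) (snd x))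
          (map_option ((+) (\<lambda>v. u (v, v))) (E\<^sub>0 (\<lambda>v. w (v, v)))) =
        map_option ((+) u) (map_option (\<lambda>s x. r (\<lambda>v. w (v, 0)) (fst x) + (s - r (\<lambda>v. w (v, 0))) (snd x)) (E\<^sub>0 (\<lambda>v. w (v, v))))"
        by (simp add: Some)
    qed simp
  next
    show "E 0 = Some 0" using r0 E\<^sub>0_zero by (simp add: E_def Let_def zero_fun_def)
  qed
  \<comment> \<open>On the diagonal the rounding cancels:
    \<open>r a + (s - r a) = s\<close>.\<close>
  have "map_option (\<lambda>w. w \<circ> (\<lambda>v. (v, v))) (E u) = E\<^sub>0 (u \<circ> (\<lambda>v. (v, v)))" for u
    by (cases "E\<^sub>0 (\<lambda>v. u (v, v))") (auto simp: E_def Let_def comp_def fun_eq_iff)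
  then show "diagonally_split TYPE('k) N \<Sigma> q"
    unfolding diagonally_split_def
    using monomial_splitting.splitting_toric_transfer[OF sp]
      compatible_with_diagonal[OF sp sp0 toric_diagonal[OF X]] by blast
qed

end
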